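(* Let $\alpha>0$ and let $u\in C_0^\infty(\mathbb{R}^3;\mathbb{R}_+)$. Let $u^*$ be the rearrangement of $u$ (defined in the context). Then $$\int_{\mathbb{R}^3_{s_1}}|\nabla_G u^*|^2\,dx_1dx_2dy\le\int_{\mathbb{R}^3}|\nabla_G u|^2\,dx_1dx_2dy,$$ where $|\nabla_G u|=\left(u_{x_1}^2+u_{x_2}^2+|x|^{2\alpha}u_y^2\right)^{1/2}$.
   Context: Write points of $\mathbb{R}^3$ as $(x_1,x_2,y)$ with $|x|=\sqrt{x_1^2+x_2^2}$. Let $n(\alpha)$ be the smallest positive integer with $n(\alpha)\ge\alpha+1$, and $\mathbb{R}^3_{s_1}:=\{(r\cos\theta,r\sin\theta,y): r>0,\ \theta\in(0,\pi/n(\alpha)),\ y\in\mathbb{R}\}$, with closure $\overline{\mathbb{R}}^3_{s_1}$. For measurable $A$, $|A|_{2,\alpha}=\int_A|x|^{2\alpha}\,dx_1dx_2dy$. The rearrangement $u^*:\overline{\mathbb{R}}^3_{s_1}\to\mathbb{R}_+$ of $u\in C_0^\infty(\mathbb{R}^3;\mathbb{R}_+)$ is $u^*(x_1,x_2,y)=\phi(r)$ with $r=(|x|^{2\alpha+2}+(\alpha+1)^2y^2)^{1/2}$, where $\phi:\mathbb{R}_+\to\mathbb{R}_+$ is (nonincreasing, right-continuous and) chosen so that $|\{u^*>t\}|_{2,\alpha}=|\{u>t\}|_{2,\alpha}$ for all $t>0$. *)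

theory Defs
  imports "HOL-Analysis.Analysis"
begin

text \<open>Points of R^3 are vectors z :: real^3 with z$1 = x1, z$2 = x2, z$3 = y.\<close>

definition pd :: "(real^3 \<Rightarrow> real) \<Rightarrow> 3 \<Rightarrow> real^3 \<Rightarrow> real" where
  "pd f i z = frechet_derivative f (at z) (axis i 1)"

coinductive smooth3 :: "(real^3 \<Rightarrow> real) \<Rightarrow> bool" where
  "(\<forall>z. f differentiable (at z)) \<Longrightarrow> (\<forall>i. smooth3 (pd f i)) \<Longrightarrow> smooth3 f"

definition xnorm2 :: "real^3 \<Rightarrow> real" where
  "xnorm2 z = (z$1)\<^sup>2 + (z$2)\<^sup>2"

definition nalpha :: "real \<Rightarrow> nat" where
  "nalpha \<alpha> = (LEAST n::nat. 0 < n \<and> \<alpha> + 1 \<le> real n)"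

definition sector :: "real \<Rightarrow> (real^3) set" where
  "sector \<alpha> = {z. \<exists>r>0. \<exists>\<theta>. 0 < \<theta> \<and> \<theta> < pi / real (nalpha \<alpha>) \<and>
                   z$1 = r * cos \<theta> \<and> z$2 = r * sin \<theta>}"

definition wmeasure :: "real \<Rightarrow> (real^3) measure" where
  "wmeasure \<alpha> = density lborel (\<lambda>z. ennreal (xnorm2 z powr \<alpha>))"

definition gauge :: "real \<Rightarrow> real^3 \<Rightarrow> real" where
  "gauge \<alpha> z = sqrt (xnorm2 z powr (\<alpha> + 1) + (\<alpha> + 1)\<^sup>2 * (z$3)\<^sup>2)"

text \<open>Squared Grushin gradient of a function with (weak) partial derivatives g1 g2 g3.\<close>
definition grushin_sq :: "real \<Rightarrow> real^3 \<Rightarrow> real \<Rightarrow> real \<Rightarrow> real \<Rightarrow> real" where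
  "grushin_sq \<alpha> z a b c = a\<^sup>2 + b\<^sup>2 + xnorm2 z powr \<alpha> * c\<^sup>2"

definition test_fun :: "(real^3) set \<Rightarrow> (real^3 \<Rightarrow> real) \<Rightarrow> bool" where
  "test_fun S \<psi> \<longleftrightarrow> smooth3 \<psi> \<and> compact (closure {z. \<psi> z \<noteq> 0}) \<and> closure {z. \<psi> z \<noteq> 0} \<subseteq> S"

definition weak_pd :: "(real^3) set \<Rightarrow> (real^3 \<Rightarrow> real) \<Rightarrow> 3 \<Rightarrow> (real^3 \<Rightarrow> real) \<Rightarrow> bool" where
  "weak_pd S v i g \<longleftrightarrow> g \<in> borel_measurable lborel \<and>
     (\<forall>K. compact K \<and> K \<subseteq> S \<longrightarrow> set_integrable lborel K g) \<and>
     (\<forall>\<psi>. test_fun S \<psi> \<longrightarrow>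
        (\<integral>z\<in>S. v z * pd \<psi> i z \<partial>lborel) = - (\<integral>z\<in>S. g z * \<psi> z \<partial>lborel))"

end

theory Submission
  imports Defs
begin

text \<open>On the sector the map \<open>(\<zeta>, y) \<mapsto> (\<zeta>\<^sup>\<alpha>\<^sup>+\<^sup>1 / (\<alpha> + 1), y)\<close>, with \<open>\<zeta> = x\<^sub>1 + i x\<^sub>2\<close>, turns the weighted measure
  \<open>|x|\<^sup>2\<^sup>\<alpha> dx dy\<close> into Lebesgue measure, the Grushin energy into the Euclidean Dirichlet energy and the gauge into
  a multiple of the norm. The image is a wedge of angle \<open>(\<alpha> + 1) \<pi> / n(\<alpha>) \<le> \<pi>\<close>, hence a convex cone, so the
  Brunn-Minkowski inequality gives a relative isoperimetric inequality in which balls centred at the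
  apex are optimal. Space is the union of \<open>2 n(\<alpha>)\<close> rotated sectors, and since \<open>v \<mapsto> v\<^sup>2\<^sup>/\<^sup>3\<close> is
  subadditive the same inequality, with the constant of a single wedge, holds for sets in all of space.

  Integrated over the levels it yields the coarea inequality
  \<open>3 \<omega> \<integral> c(s) R(s)\<^sup>2 ds \<le> \<integral> c(u) |\<nabla>\<^sub>G u| |x|\<^sup>\<alpha> dx dy\<close>, where \<open>\<omega> R(s)\<^sup>3\<close> is the measure of \<open>{u > s}\<close>. The inequality
  \<open>2ab \<le> a\<^sup>2 + b\<^sup>2\<close> and equimeasurability turn it into a bound on a linear functional of \<open>c\<close> by
  \<open>\<parallel>c\<parallel>\<^sup>2\<close> plus the energy of \<open>u\<close>. By duality the rearranged profile is locally absolutely continuous, and the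
  squared weighted \<open>L\<^sup>2\<close> norm of its derivative, which is the energy of \<open>u\<^sup>*\<close>, is at most the energy of \<open>u\<close>.\<close>

section \<open>The Brunn-Minkowski inequality\<close>

text \<open>A priori the rearranged profile is only monotone: it might jump or have a singular part,
  so its derivative cannot be written down before the inequality that controls it is known. This is
  why the estimate stays in integrated form, as a bound on the measure obtained by pushing levels
  forward to radii; absolute continuity and the energy bound then come out together. The
  isoperimetric constant is the derivative at t = 0 of (v^(1/3) + \<omega>^(1/3) t)^3, namely 3
  \<omega>^(1/3) v^(2/3), which is 3 \<omega> R^2 when v = \<omega> R^3. Since an inequality
  suffices, Minkowski content takes the place of perimeter and no regularity of level sets enters.
  The obstacle is the edge x = 0, where the flattening map degenerates: in flat coordinates the
  gradient of a smooth function may grow like |x|^(-\<alpha>). The weight |x|^(2 \<alpha>) absorbs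
  this, and \<open>hor_dist_le\<close> makes the absorption uniform enough for a passage to the
  limit.\<close>

text \<open>The Hadwiger-Ohmann proof: cut two finite unions of boxes by parallel hyperplanes in the same
  volume ratio and induct on the number of boxes.\<close>

definition disjoint_boxes :: "'a::euclidean_space set set \<Rightarrow> bool" where
  "disjoint_boxes \<A> \<longleftrightarrow> finite \<A> \<and> disjoint \<A> \<and> (\<forall>X\<in>\<A>. X \<noteq> {} \<and> (\<exists>a b. X = box a b))"

lemma box_Int_lower_halfspace:
  fixes a b :: "'a::euclidean_space"
  assumes "i \<in> Basis"
  shows "\<exists>a' b'. box a b \<inter> {x. x \<bullet> i < c} = box a' b'"
proof (intro exI)
  show "box a b \<inter> {x. x \<bullet> i < c} = box a (\<Sum>k\<in>Basis. (if k = i then min (b \<bullet> k) c else b \<bullet> k) *\<^sub>R k)"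
    using assms by (auto simp: mem_box split: if_splits)
qed

lemma box_Int_upper_halfspace:
  fixes a b :: "'a::euclidean_space"
  assumes "i \<in> Basis"
  shows "\<exists>a' b'. box a b \<inter> {x. c < x \<bullet> i} = box a' b'"
proof (intro exI)
  show "box a b \<inter> {x. c < x \<bullet> i} = box (\<Sum>k\<in>Basis. (if k = i then max (a \<bullet> k) c else a \<bullet> k) *\<^sub>R k) b"
    using assms by (auto simp: mem_box split: if_splits)
qed

text \<open>Only one side of a cut is kept, so no box is split in two; a box that misses
  \<open>H\<close> leaves the family, and this strict decrease drives the induction on the number of
  boxes.\<close>

lemma disjoint_boxes_Int:
  assumes \<A>: "disjoint_boxes \<A>" and H: "\<And>a b. \<exists>a' b'. box a b \<inter> H = box a' b'"
  obtains \<A>' where "disjoint_boxes \<A>'" "\<Union>\<A>' = \<Union>\<A> \<inter> H" "card \<A>' \<le> card \<A>"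
    "(\<exists>X\<in>\<A>. X \<inter> H = {}) \<Longrightarrow> card \<A>' < card \<A>"
proof
  let ?F = "(\<lambda>X. X \<inter> H) ` \<A> - {{}}"
  have fin: "finite \<A>" using \<A> by (simp add: disjoint_boxes_def)
  show "disjoint_boxes ?F"
    unfolding disjoint_boxes_def
  proof (intro conjI ballI)
    show "finite ?F" using fin by simp
    show "disjoint ?F"
      using \<A> unfolding disjoint_boxes_def pairwise_def disjnt_def by blast
    show "X \<noteq> {}" if "X \<in> ?F" for X using that by auto
    show "\<exists>a b. X = box a b" if "X \<in> ?F" for X
      using that \<A> H unfolding disjoint_boxes_def by (metis (no_types, lifting) DiffD1 imageE)
  qed
  show "\<Union>?F = \<Union>\<A> \<inter> H" by auto
  show "card ?F \<le> card \<A>"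
    by (meson card_Diff1_le card_image_le fin finite_imageI order_trans)
  show "card ?F < card \<A>" if ex: "\<exists>X\<in>\<A>. X \<inter> H = {}"
  proof -
    obtain X where X: "X \<in> \<A>" "X \<inter> H = {}" using ex by blast
    have "{} \<in> (\<lambda>X. X \<inter> H) ` \<A>" using X by (metis image_eqI)
    then have "card ?F < card ((\<lambda>X. X \<inter> H) ` \<A>)"
      using fin by (intro psubset_card_mono) auto
    also have "\<dots> \<le> card \<A>" by (rule card_image_le[OF fin])
    finally show ?thesis .
  qed
qed

lemma disjoint_boxes_open_bounded:
  assumes "disjoint_boxes \<A>"
  shows "open (\<Union>\<A>)" "bounded (\<Union>\<A>)"
  using assms unfolding disjoint_boxes_def by (auto intro!: open_Union bounded_Union)

lemma open_set_plus:
  fixes A B :: "'a::real_normed_vector set"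
  assumes "open A"
  shows "open (A + B)"
proof -
  have "A + B = (\<Union>x\<in>A. \<Union>y\<in>B. {x + y})" by (auto simp: set_plus_def)
  then show ?thesis using open_sums[of A B] assms by simp
qed

lemma bounded_set_plus:
  fixes A B :: "'a::real_normed_vector set"
  assumes "bounded A" "bounded B"
  shows "bounded (A + B)"
proof -
  obtain a b where "\<And>x. x \<in> A \<Longrightarrow> norm x \<le> a" "\<And>x. x \<in> B \<Longrightarrow> norm x \<le> b"
    using assms by (auto simp: bounded_iff)
  then have "norm z \<le> a + b" if "z \<in> A + B" for z
    using that by (auto simp: set_plus_def intro: norm_triangle_mono)
  then show ?thesis by (auto simp: bounded_iff)
qed

lemma measure_split_hyperplane:
  fixes A :: "'a::euclidean_space set"
  assumes "open A" "bounded A" "i \<in> Basis"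
  shows "measure lebesgue A = measure lebesgue (A \<inter> {x. x \<bullet> i < c}) + measure lebesgue (A \<inter> {x. c < x \<bullet> i})"
proof -
  have 1: "A \<inter> {x. x \<bullet> i < c} \<in> lmeasurable" "A \<inter> {x. c < x \<bullet> i} \<in> lmeasurable"
    using assms by (auto intro!: lmeasurable_open bounded_Int open_Int open_halfspace_component_lt open_halfspace_component_gt)
  have "measure lebesgue (A \<inter> {x. x \<bullet> i < c} \<union> A \<inter> {x. c < x \<bullet> i}) = measure lebesgue A"
  proof (rule measure_negligible_symdiff)
    show "A \<in> lmeasurable" using assms by (simp add: lmeasurable_open)
    show "negligible (A - (A \<inter> {x. x \<bullet> i < c} \<union> A \<inter> {x. c < x \<bullet> i}) \<union> (A \<inter> {x. x \<bullet> i < c} \<union> A \<inter> {x. c < x \<bullet> i} - A))"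
      by (rule negligible_subset[OF negligible_standard_hyperplane[OF assms(3), of c]]) auto
  qed
  also have "measure lebesgue (A \<inter> {x. x \<bullet> i < c} \<union> A \<inter> {x. c < x \<bullet> i})
      = measure lebesgue (A \<inter> {x. x \<bullet> i < c}) + measure lebesgue (A \<inter> {x. c < x \<bullet> i})"
    by (rule measure_Un2[OF 1, THEN trans]) (auto intro!: arg_cong[where f="measure lebesgue"])
  finally show ?thesis by simp
qed

text \<open>Dominated convergence under the indicator of \<open>B\<close>: off the null hyperplane
  at height \<open>c\<close>, the indicators of the moving half-spaces are eventually constant. The
  continuity is what allows a cut in a prescribed volume ratio.\<close>

lemma continuous_measure_halfspace_Int:
  fixes B :: "'a::euclidean_space set"
  assumes B: "B \<in> lmeasurable" and i: "i \<in> Basis"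
  shows "continuous_on UNIV (\<lambda>c. measure lebesgue (B \<inter> {x. x \<bullet> i < c}))"
proof (rule continuous_on_sequentiallyI)
  fix u :: "nat \<Rightarrow> real" and c assume u: "u \<longlonglongrightarrow> c"
  have H: "{x. x \<bullet> i < c} \<in> sets lebesgue" for c
    using open_halfspace_component_lt[of i c] by (auto intro: borel_open)
  have eq: "measure lebesgue (B \<inter> {x. x \<bullet> i < c}) = (\<integral>x. indicat_real (B \<inter> {x. x \<bullet> i < c}) x \<partial>lebesgue)" for c
    by simp
  have ae: "AE x in lebesgue. x \<bullet> i \<noteq> c"
    using negligible_standard_hyperplane[OF i, of c]
    by (intro AE_I'[where N="{x. x \<bullet> i = c}"]) (auto simp: negligible_iff_null_sets)
  show "(\<lambda>n. measure lebesgue (B \<inter> {x. x \<bullet> i < u n})) \<longlonglongrightarrow> measure lebesgue (B \<inter> {x. x \<bullet> i < c})"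
    unfolding eq
  proof (rule integral_dominated_convergence[where w="indicat_real B"])
    show "integrable lebesgue (indicat_real B)" using B by (intro integrable_real_indicator) (auto simp: fmeasurable_def)
    show "AE x in lebesgue. (\<lambda>n. indicat_real (B \<inter> {x. x \<bullet> i < u n}) x) \<longlonglongrightarrow> indicat_real (B \<inter> {x. x \<bullet> i < c}) x"
      using ae
    proof eventually_elim
      case (elim x)
      then consider "x \<bullet> i < c" | "c < x \<bullet> i" by linarith
      then have "eventually (\<lambda>n. indicat_real (B \<inter> {x. x \<bullet> i < u n}) x = indicat_real (B \<inter> {x. x \<bullet> i < c}) x) sequentially"
      proof cases
        case 1
        show ?thesis using order_tendstoD(1)[OF u 1]
          by eventually_elim (use 1 in \<open>auto simp: indicator_def\<close>)
      next
        case 2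
        show ?thesis using order_tendstoD(2)[OF u 2]
          by eventually_elim (use 2 in \<open>auto simp: indicator_def\<close>)
      qed
      then show ?case by (rule tendsto_eventually)
    qed
  qed (use fmeasurableD[OF B] H in \<open>auto intro!: borel_measurable_indicator simp: indicator_def[of B] indicator_def[of "B \<inter> _"]\<close>)
qed

lemma box_plus_box:
  fixes a b c d :: "'a::euclidean_space"
  assumes ne: "box a b \<noteq> {}" "box c d \<noteq> {}"
  shows "box (a + c) (b + d) \<subseteq> box a b + box c d"
proof
  fix z assume z: "z \<in> box (a + c) (b + d)"
  \<comment> \<open>In each coordinate \<open>z\<close> sits at some fraction of the way across the
    sum box; \<open>x\<close> takes the same fraction of the first box, which leaves
    \<open>z - x\<close> at that fraction of the second.\<close>
  define x where "x = (\<Sum>i\<in>Basis. (a \<bullet> i + (b \<bullet> i - a \<bullet> i) * ((z \<bullet> i - a \<bullet> i - c \<bullet> i) / (b \<bullet> i + d \<bullet> i - a \<bullet> i - c \<bullet> i))) *\<^sub>R i)"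
  have xi: "x \<bullet> i = a \<bullet> i + (b \<bullet> i - a \<bullet> i) * ((z \<bullet> i - a \<bullet> i - c \<bullet> i) / (b \<bullet> i + d \<bullet> i - a \<bullet> i - c \<bullet> i))" if "i \<in> Basis" for i
    using that by (simp add: x_def)
  have *: "a \<bullet> i < x \<bullet> i \<and> x \<bullet> i < b \<bullet> i \<and> c \<bullet> i < (z - x) \<bullet> i \<and> (z - x) \<bullet> i < d \<bullet> i" if i: "i \<in> Basis" for i
  proof -
    have p: "b \<bullet> i - a \<bullet> i > 0" "d \<bullet> i - c \<bullet> i > 0"
      using ne i by (auto simp: box_ne_empty)
    define t where "t = (z \<bullet> i - a \<bullet> i - c \<bullet> i) / (b \<bullet> i + d \<bullet> i - a \<bullet> i - c \<bullet> i)"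
    have zi: "a \<bullet> i + c \<bullet> i < z \<bullet> i" "z \<bullet> i < b \<bullet> i + d \<bullet> i"
      using z i by (auto simp: mem_box inner_add_left)
    have t: "0 < t" "t < 1"
      using p zi by (auto simp: t_def divide_simps)
    have zt: "z \<bullet> i = a \<bullet> i + c \<bullet> i + t * (b \<bullet> i - a \<bullet> i) + t * (d \<bullet> i - c \<bullet> i)"
    proof -
      have "b \<bullet> i + d \<bullet> i - a \<bullet> i - c \<bullet> i \<noteq> 0" using p by linarith
      then have "t * (b \<bullet> i + d \<bullet> i - a \<bullet> i - c \<bullet> i) = z \<bullet> i - a \<bullet> i - c \<bullet> i"
        by (simp add: t_def)
      then show ?thesis by (simp add: algebra_simps)
    qed
    have xt: "x \<bullet> i = a \<bullet> i + t * (b \<bullet> i - a \<bullet> i)"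
      using xi[OF i] by (simp add: t_def)
    have "t * (b \<bullet> i - a \<bullet> i) > 0" "t * (d \<bullet> i - c \<bullet> i) > 0"
         "t * (b \<bullet> i - a \<bullet> i) < b \<bullet> i - a \<bullet> i" "t * (d \<bullet> i - c \<bullet> i) < d \<bullet> i - c \<bullet> i"
      using p t by auto
    then show ?thesis using xt zt by (simp add: inner_diff_left)
  qed
  then have "x \<in> box a b" "z - x \<in> box c d" by (auto simp: mem_box)
  then show "z \<in> box a b + box c d" by (metis add.commute diff_add_cancel set_plus_intro)
qed

text \<open>Dividing by the root of the product of the \<open>p i + q i\<close> turns both terms
  into geometric means of ratios, and the corresponding arithmetic means add up to 1.\<close>

lemma root_prod_add_le:
  fixes p q :: "'i \<Rightarrow> real"
  assumes I: "finite I" "I \<noteq> {}" and pq: "\<And>i. i \<in> I \<Longrightarrow> p i > 0" "\<And>i. i \<in> I \<Longrightarrow> q i > 0"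
  shows "root (card I) (\<Prod>i\<in>I. p i) + root (card I) (\<Prod>i\<in>I. q i) \<le> root (card I) (\<Prod>i\<in>I. p i + q i)"
proof -
  have n: "card I > 0" using I by (simp add: card_gt_0_iff)
  define S where "S = (\<Prod>i\<in>I. p i + q i)"
  have S: "S > 0" using pq by (auto simp: S_def intro!: prod_pos add_pos_pos)
  have *: "root (card I) (\<Prod>i\<in>I. f i) / root (card I) S \<le> (\<Sum>i\<in>I. (f i / (p i + q i)) / card I)"
    if f: "\<And>i. i \<in> I \<Longrightarrow> f i > 0" for f
  proof -
    have "root (card I) (\<Prod>i\<in>I. f i) / root (card I) S = root (card I) (\<Prod>i\<in>I. f i / (p i + q i))"
      by (simp add: S_def prod_dividef real_root_divide)
    also have "\<dots> = (\<Prod>i\<in>I. f i / (p i + q i)) powr (1 / card I)"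
    proof (rule root_powr_inverse[OF n])
      show "0 \<le> (\<Prod>i\<in>I. f i / (p i + q i))"
        by (intro prod_nonneg divide_nonneg_nonneg add_nonneg_nonneg) (simp_all add: f pq less_imp_le)
    qed
    also have "\<dots> \<le> (\<Sum>i\<in>I. (f i / (p i + q i)) / card I)"
      by (rule arith_geom_mean) (simp_all add: I f pq less_imp_le add_pos_pos)
    finally show ?thesis .
  qed
  have "root (card I) (\<Prod>i\<in>I. p i) / root (card I) S + root (card I) (\<Prod>i\<in>I. q i) / root (card I) S
      \<le> (\<Sum>i\<in>I. (p i / (p i + q i)) / real (card I)) + (\<Sum>i\<in>I. (q i / (p i + q i)) / card I)"
    by (intro add_mono * pq)
  also have "\<dots> = (\<Sum>i\<in>I. 1 / card I)"
    unfolding sum.distrib[symmetric]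
  proof (intro sum.cong refl)
    fix i assume "i \<in> I"
    then have "p i + q i \<noteq> 0" using pq[of i] by linarith
    then show "p i / (p i + q i) / real (card I) + q i / (p i + q i) / real (card I) = 1 / real (card I)"
      by (metis add_divide_distrib divide_self)
  qed
  also have "\<dots> = 1" using n by simp
  finally have "(root (card I) (\<Prod>i\<in>I. p i) + root (card I) (\<Prod>i\<in>I. q i)) / root (card I) S \<le> 1"
    by (simp add: add_divide_distrib)
  moreover have "root (card I) S > 0" using S n by simp
  ultimately show ?thesis by (simp add: S_def)
qed

lemma brunn_minkowski_box:
  fixes a b c d :: "'a::euclidean_space"
  assumes ne: "box a b \<noteq> {}" "box c d \<noteq> {}"
  shows "root DIM('a) (measure lebesgue (box a b)) + root DIM('a) (measure lebesgue (box c d))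
     \<le> root DIM('a) (measure lebesgue (box a b + box c d))"
proof -
  have p: "\<And>i. i \<in> Basis \<Longrightarrow> (b - a) \<bullet> i > 0" "\<And>i. i \<in> Basis \<Longrightarrow> (d - c) \<bullet> i > 0"
      using ne by (auto simp: box_ne_empty inner_diff_left)
  have m: "measure lebesgue (box u v) = (\<Prod>i\<in>Basis. (v - u) \<bullet> i)" if "\<And>i. i \<in> Basis \<Longrightarrow> (v - u) \<bullet> i > 0" for u v :: 'a
    using that by (simp add: inner_diff_left measure_lborel_box_eq less_imp_le)
  have "root DIM('a) (measure lebesgue (box a b)) + root DIM('a) (measure lebesgue (box c d)) \<le>
    root DIM('a) (\<Prod>i\<in>Basis. (b - a) \<bullet> i + (d - c) \<bullet> i)"
    using root_prod_add_le[OF finite_Basis nonempty_Basis, of "\<lambda>i. (b - a) \<bullet> i" "\<lambda>i. (d - c) \<bullet> i"] p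
    by (simp only: m[OF p(1)] m[OF p(2)])
  also have "(\<Prod>i\<in>Basis. (b - a) \<bullet> i + (d - c) \<bullet> i) = measure lebesgue (box (a + c) (b + d))"
  proof -
    have eq: "(b + d - (a + c)) \<bullet> i = (b - a) \<bullet> i + (d - c) \<bullet> i" for i
      by (simp add: inner_diff_left inner_add_left)
    have "(b + d - (a + c)) \<bullet> i > 0" if "i \<in> Basis" for i
      using add_pos_pos[OF p(1)[OF that] p(2)[OF that]] by (simp only: eq)
    from m[OF this] show ?thesis by (simp only: eq)
  qed
  also have "\<dots> \<le> measure lebesgue (box a b + box c d)"
    by (rule measure_mono_fmeasurable[OF box_plus_box[OF ne]])
       (auto intro!: lmeasurable_open bounded_set_plus open_set_plus)
  finally show ?thesis by simp
qed

text \<open>Two nonempty boxes are disjoint only if their projections to some axis are; the upper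
  end of the lower projection serves as \<open>c\<close>.\<close>

lemma disjoint_boxes_separated:
  fixes \<A> :: "'a::euclidean_space set set"
  assumes \<A>: "disjoint_boxes \<A>" and "card \<A> \<ge> 2"
  obtains i c X Y where "i \<in> Basis" "X \<in> \<A>" "Y \<in> \<A>" "X \<inter> {x. c < x \<bullet> i} = {}" "Y \<inter> {x. x \<bullet> i < c} = {}"
proof -
  have "\<not> is_singleton \<A>" "\<A> \<noteq> {}" using assms(2) by (auto simp: is_singleton_altdef)
  then obtain X Y where XY: "X \<in> \<A>" "Y \<in> \<A>" "X \<noteq> Y" by (metis is_singletonI')
  then have "X \<inter> Y = {}" using \<A> by (auto simp: disjoint_boxes_def pairwise_def disjnt_def)
  moreover obtain a b where X: "X = box a b" "box a b \<noteq> {}" using \<A> XY by (metis disjoint_boxes_def)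
  moreover obtain c d where Y: "Y = box c d" "box c d \<noteq> {}" using \<A> XY by (metis disjoint_boxes_def)
  ultimately obtain i where i: "i \<in> Basis" "b \<bullet> i \<le> c \<bullet> i \<or> d \<bullet> i \<le> a \<bullet> i"
    by (auto simp: box_Int_box box_eq_empty not_le min_le_iff_disj le_max_iff_disj)
  from i(2) show thesis
  proof
    assume "b \<bullet> i \<le> c \<bullet> i"
    then have "X \<inter> {x. b \<bullet> i < x \<bullet> i} = {}" "Y \<inter> {x. x \<bullet> i < b \<bullet> i} = {}"
      using i(1) X Y by (force simp: mem_box)+
    then show thesis using that i XY by blast
  next
    assume "d \<bullet> i \<le> a \<bullet> i"
    then have "Y \<inter> {x. d \<bullet> i < x \<bullet> i} = {}" "X \<inter> {x. x \<bullet> i < d \<bullet> i} = {}"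
      using i(1) X Y by (force simp: mem_box)+
    then show thesis using that i XY by blast
  qed
qed

lemma halfspace_measure_eq:
  fixes B :: "'a::euclidean_space set"
  assumes B: "open B" "bounded B" and i: "i \<in> Basis" and t: "0 \<le> t" "t \<le> measure lebesgue B"
  obtains c where "measure lebesgue (B \<inter> {x. x \<bullet> i < c}) = t"
proof -
  obtain r where r: "\<And>x. x \<in> B \<Longrightarrow> norm x \<le> r" using B(2) bounded_iff by blast
  have r': "\<bar>x \<bullet> i\<bar> \<le> \<bar>r\<bar>" if "x \<in> B" for x
    using r[OF that] Basis_le_norm[OF i, of x] by linarith
  have 1: "B \<inter> {x. x \<bullet> i < - \<bar>r\<bar>} = {}" using r' by fastforce
  have 2: "B \<inter> {x. x \<bullet> i < \<bar>r\<bar> + 1} = B" using r' by fastforce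
  have "\<exists>c. -\<bar>r\<bar> \<le> c \<and> c \<le> \<bar>r\<bar> + 1 \<and> measure lebesgue (B \<inter> {x. x \<bullet> i < c}) = t"
    by (rule IVT') (use 1 2 t in \<open>auto intro!: continuous_on_subset[OF continuous_measure_halfspace_Int] lmeasurable_open assms\<close>)
  then show thesis using that by blast
qed

lemma disjoint_boxes_measure_pos:
  fixes \<A> :: "'a::euclidean_space set set"
  assumes \<A>: "disjoint_boxes \<A>"
  shows "measure lebesgue (\<Union>\<A>) > 0 \<longleftrightarrow> \<A> \<noteq> {}"
proof
  assume "\<A> \<noteq> {}"
  then obtain X where X: "X \<in> \<A>" "X \<noteq> {}" using \<A> by (auto simp: disjoint_boxes_def)
  have "\<not> negligible (\<Union>\<A>)"
    using disjoint_boxes_open_bounded[OF \<A>] X by (intro open_not_negligible) auto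
  then show "measure lebesgue (\<Union>\<A>) > 0"
    using lmeasurable_open[OF disjoint_boxes_open_bounded(2,1)[OF \<A>]] negligible_iff_measure0
    by (metis measure_nonneg order_le_less)
qed auto

text \<open>Cutting between two boxes leaves fewer boxes in each half of \<open>\<A>\<close>, while
  each half of \<open>\<B>\<close> has at most as many as before. As \<open>\<B>\<close> is cut in
  the same ratio, the induction hypothesis for matching halves reads |A' + B'| >= |A'| (1 +
  k^(1/n))^n, which is linear in |A'|. The two sums lie on opposite sides of the hyperplane at
  height \<open>c + d\<close>, so their volumes add up.\<close>

lemma brunn_minkowski_cut:
  fixes \<A> \<B> :: "'a::euclidean_space set set"
  assumes \<A>: "disjoint_boxes \<A>" "card \<A> \<ge> 2" and \<B>: "disjoint_boxes \<B>" "\<B> \<noteq> {}"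
    and IH: "\<And>\<A>' \<B>' :: 'a set set. \<lbrakk>disjoint_boxes \<A>'; \<A>' \<noteq> {}; disjoint_boxes \<B>'; \<B>' \<noteq> {}; card \<A>' + card \<B>' < card \<A> + card \<B>\<rbrakk> \<Longrightarrow>
       root DIM('a) (measure lebesgue (\<Union>\<A>')) + root DIM('a) (measure lebesgue (\<Union>\<B>'))
       \<le> root DIM('a) (measure lebesgue (\<Union>\<A>' + \<Union>\<B>'))"
  shows "root DIM('a) (measure lebesgue (\<Union>\<A>)) + root DIM('a) (measure lebesgue (\<Union>\<B>))
       \<le> root DIM('a) (measure lebesgue (\<Union>\<A> + \<Union>\<B>))"
proof -
  let ?m = "measure lebesgue" and ?n = "DIM('a)"
  obtain i c X Y where i: "i \<in> Basis" and XY: "X \<in> \<A>" "Y \<in> \<A>"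
    and X: "X \<inter> {x. c < x \<bullet> i} = {}" and Y: "Y \<inter> {x. x \<bullet> i < c} = {}"
    using disjoint_boxes_separated[OF \<A>] by metis
  have ne: "X \<noteq> {}" "Y \<noteq> {}" using \<A> XY by (auto simp: disjoint_boxes_def)
  obtain A1 where A1: "disjoint_boxes A1" "\<Union>A1 = \<Union>\<A> \<inter> {x. x \<bullet> i < c}" "card A1 < card \<A>"
    using disjoint_boxes_Int[OF \<A>(1) box_Int_lower_halfspace[OF i]] Y XY by metis
  obtain A2 where A2: "disjoint_boxes A2" "\<Union>A2 = \<Union>\<A> \<inter> {x. c < x \<bullet> i}" "card A2 < card \<A>"
    using disjoint_boxes_Int[OF \<A>(1) box_Int_upper_halfspace[OF i]] X XY by metis
  note ob = disjoint_boxes_open_bounded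
  have sA: "?m (\<Union>\<A>) = ?m (\<Union>A1) + ?m (\<Union>A2)"
    unfolding A1 A2 by (rule measure_split_hyperplane[OF ob[OF \<A>(1)] i])
  have opX: "open Z" if "Z \<in> \<A>" for Z using \<A>(1) that by (auto simp: disjoint_boxes_def)
  \<comment> \<open>Otherwise the open box \<open>X\<close> would lie in the hyperplane. Positive
    measure of both halves also makes the matching halves of \<open>\<B>\<close> nonempty.\<close>
  have "A1 \<noteq> {}"
  proof
    assume "A1 = {}"
    then have "X \<inter> {x. x \<bullet> i < c} = {}" using A1 XY by auto
    then have "X \<subseteq> {x. x \<bullet> i = c}" using X by (force simp: not_less order_antisym)
    then have "negligible X" using negligible_standard_hyperplane[OF i] negligible_subset by blast
    then show False using open_not_negligible[OF opX] XY ne by blast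
  qed
  moreover have "A2 \<noteq> {}"
  proof
    assume "A2 = {}"
    then have "Y \<inter> {x. c < x \<bullet> i} = {}" using A2 XY by auto
    then have "Y \<subseteq> {x. x \<bullet> i = c}" using Y by (force simp: not_less order_antisym)
    then have "negligible Y" using negligible_standard_hyperplane[OF i] negligible_subset by blast
    then show False using open_not_negligible[OF opX] XY ne by blast
  qed
  ultimately have pA: "?m (\<Union>A1) > 0" "?m (\<Union>A2) > 0" using A1 A2 disjoint_boxes_measure_pos by blast+
  then have pAA: "?m (\<Union>\<A>) > 0" using sA by simp
  have pB: "?m (\<Union>\<B>) > 0" using \<B> disjoint_boxes_measure_pos by blast
  define k where "k = ?m (\<Union>\<B>) / ?m (\<Union>\<A>)"
  have k: "k > 0" using pAA pB by (simp add: k_def)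
  have kA: "k * ?m (\<Union>\<A>) = ?m (\<Union>\<B>)" using pAA by (simp add: k_def)
  \<comment> \<open>The prescribed volume is attainable, since \<open>k\<close> times the measures
    of the two halves of \<open>\<Union>\<A>\<close> add up to the measure of
    \<open>\<Union>\<B>\<close>.\<close>
  obtain d where d: "?m (\<Union>\<B> \<inter> {x. x \<bullet> i < d}) = k * ?m (\<Union>A1)"
    by (rule halfspace_measure_eq[OF ob[OF \<B>(1)] i, of "k * ?m (\<Union>A1)"])
       (use mult_pos_pos[OF k pA(1)] mult_pos_pos[OF k pA(2)] kA[unfolded sA distrib_left] in linarith)+
  obtain B1 where B1: "disjoint_boxes B1" "\<Union>B1 = \<Union>\<B> \<inter> {x. x \<bullet> i < d}" "card B1 \<le> card \<B>"
    using disjoint_boxes_Int[OF \<B>(1) box_Int_lower_halfspace[OF i]] by metis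
  obtain B2 where B2: "disjoint_boxes B2" "\<Union>B2 = \<Union>\<B> \<inter> {x. d < x \<bullet> i}" "card B2 \<le> card \<B>"
    using disjoint_boxes_Int[OF \<B>(1) box_Int_upper_halfspace[OF i]] by metis
  have sB: "?m (\<Union>\<B>) = ?m (\<Union>B1) + ?m (\<Union>B2)"
    unfolding B1 B2 by (rule measure_split_hyperplane[OF ob[OF \<B>(1)] i])
  have mB1: "?m (\<Union>B1) = k * ?m (\<Union>A1)" using d B1 by simp
  have mB2: "?m (\<Union>B2) = k * ?m (\<Union>A2)" using sA sB mB1 kA by (simp add: algebra_simps)
  have "B1 \<noteq> {}" "B2 \<noteq> {}" using mB1 mB2 k pA by auto
  have est: "?m (\<Union>A') * (1 + root ?n k) ^ ?n \<le> ?m (\<Union>A' + \<Union>B')"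
    if A': "disjoint_boxes A'" "A' \<noteq> {}" "card A' < card \<A>" and B': "disjoint_boxes B'" "B' \<noteq> {}" "card B' \<le> card \<B>"
      and m: "?m (\<Union>B') = k * ?m (\<Union>A')" for A' B' :: "'a set set"
  proof -
    have "root ?n (?m (\<Union>A')) * (1 + root ?n k) = root ?n (?m (\<Union>A')) + root ?n (?m (\<Union>B'))"
      by (simp add: m real_root_mult algebra_simps)
    also have "\<dots> \<le> root ?n (?m (\<Union>A' + \<Union>B'))"
      using IH[OF A'(1,2) B'(1,2)] A'(3) B'(3) by linarith
    finally have "(root ?n (?m (\<Union>A')) * (1 + root ?n k)) ^ ?n \<le> root ?n (?m (\<Union>A' + \<Union>B')) ^ ?n"
      by (rule power_mono) (use k in \<open>auto intro!: mult_nonneg_nonneg add_nonneg_nonneg real_root_ge_zero less_imp_le\<close>)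
    then show ?thesis by (simp add: power_mult_distrib real_root_pow_pos2)
  qed
  note o = open_set_plus[OF ob(1)] and b = bounded_set_plus[OF ob(2) ob(2)]
  have "?m (\<Union>\<A>) * (1 + root ?n k) ^ ?n \<le> ?m (\<Union>A1 + \<Union>B1) + ?m (\<Union>A2 + \<Union>B2)"
    unfolding sA distrib_right
    by (intro add_mono est A1 A2 B1 B2 mB1 mB2 \<open>A1 \<noteq> {}\<close> \<open>A2 \<noteq> {}\<close> \<open>B1 \<noteq> {}\<close> \<open>B2 \<noteq> {}\<close>)
  also have "\<dots> = ?m ((\<Union>A1 + \<Union>B1) \<union> (\<Union>A2 + \<Union>B2))"
  proof (rule measure_Un2[THEN trans, symmetric])
    have "(\<Union>A1 + \<Union>B1) \<inter> (\<Union>A2 + \<Union>B2) = {}"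
    proof -
      have "z \<bullet> i < c + d" if "z \<in> \<Union>A1 + \<Union>B1" for z
        using that A1(2) B1(2) by (force simp: set_plus_def inner_add_left intro: add_strict_mono)
      moreover have "c + d < z \<bullet> i" if "z \<in> \<Union>A2 + \<Union>B2" for z
        using that A2(2) B2(2) by (force simp: set_plus_def inner_add_left intro: add_strict_mono)
      ultimately show ?thesis by force
    qed
    then have "(\<Union>A2 + \<Union>B2) - (\<Union>A1 + \<Union>B1) = \<Union>A2 + \<Union>B2" by blast
    then show "?m (\<Union>A1 + \<Union>B1) + ?m ((\<Union>A2 + \<Union>B2) - (\<Union>A1 + \<Union>B1)) = ?m (\<Union>A1 + \<Union>B1) + ?m (\<Union>A2 + \<Union>B2)"
      by simp
  qed (auto intro!: lmeasurable_open o b A1 A2 B1 B2)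
  also have "\<dots> \<le> ?m (\<Union>\<A> + \<Union>\<B>)"
  proof (rule measure_mono_fmeasurable)
    show "\<Union>A1 + \<Union>B1 \<union> (\<Union>A2 + \<Union>B2) \<subseteq> \<Union>\<A> + \<Union>\<B>"
      using A1(2) A2(2) B1(2) B2(2) by (metis Int_lower1 Un_least set_plus_mono2)
    show "\<Union>A1 + \<Union>B1 \<union> (\<Union>A2 + \<Union>B2) \<in> sets lebesgue"
      using o[OF A1(1)] o[OF A2(1)] by (blast intro: borel_open lborelD open_Un)
    show "\<Union>\<A> + \<Union>\<B> \<in> lmeasurable" by (intro lmeasurable_open o b \<A> \<B>)
  qed
  finally have "root ?n (?m (\<Union>\<A>) * (1 + root ?n k) ^ ?n) \<le> root ?n (?m (\<Union>\<A> + \<Union>\<B>))"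
    by simp
  moreover have "root ?n (?m (\<Union>\<A>) * (1 + root ?n k) ^ ?n) = root ?n (?m (\<Union>\<A>)) * (1 + root ?n k)"
    using k by (simp add: real_root_mult real_root_power_cancel add_nonneg_nonneg)
  moreover have "root ?n (?m (\<Union>\<A>)) * (1 + root ?n k) = root ?n (?m (\<Union>\<A>)) + root ?n (?m (\<Union>\<B>))"
    by (simp add: kA[symmetric] real_root_mult algebra_simps)
  ultimately show ?thesis by simp
qed

lemma brunn_minkowski_disjoint_boxes:
  fixes \<A> \<B> :: "'a::euclidean_space set set"
  assumes "disjoint_boxes \<A>" "\<A> \<noteq> {}" "disjoint_boxes \<B>" "\<B> \<noteq> {}"
  shows "root DIM('a) (measure lebesgue (\<Union>\<A>)) + root DIM('a) (measure lebesgue (\<Union>\<B>))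
       \<le> root DIM('a) (measure lebesgue (\<Union>\<A> + \<Union>\<B>))"
  using assms
proof (induction "card \<A> + card \<B>" arbitrary: \<A> \<B> rule: less_induct)
  case less
  have fin: "finite \<A>" "finite \<B>" using less.prems by (auto simp: disjoint_boxes_def)
  then have "card \<A> > 0" "card \<B> > 0" using less.prems by (auto simp: card_gt_0_iff)
  then consider "card \<A> = 1 \<and> card \<B> = 1" | "card \<A> \<ge> 2" | "card \<B> \<ge> 2" by linarith
  then show ?case
  proof cases
    case 1
    then obtain X Y where XY: "\<A> = {X}" "\<B> = {Y}" by (metis card_1_singletonE)
    then obtain a b c d where "X = box a b" "X \<noteq> {}" "Y = box c d" "Y \<noteq> {}"
      using less.prems by (simp add: disjoint_boxes_def) (metis)
    then show ?thesis using brunn_minkowski_box[of a b c d] XY by simp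
  next
    case 2
    show ?thesis by (rule brunn_minkowski_cut[OF less.prems(1) 2 less.prems(3,4) less.hyps])
  next
    case 3
    have "root DIM('a) (measure lebesgue (\<Union>\<B>)) + root DIM('a) (measure lebesgue (\<Union>\<A>))
       \<le> root DIM('a) (measure lebesgue (\<Union>\<B> + \<Union>\<A>))"
    proof (rule brunn_minkowski_cut[OF less.prems(3) 3 less.prems(1,2)])
      fix A' B' :: "'a set set"
      assume *: "disjoint_boxes A'" "A' \<noteq> {}" "disjoint_boxes B'" "B' \<noteq> {}" "card A' + card B' < card \<B> + card \<A>"
      show "root DIM('a) (measure lebesgue (\<Union>A')) + root DIM('a) (measure lebesgue (\<Union>B'))
       \<le> root DIM('a) (measure lebesgue (\<Union>A' + \<Union>B'))"
        using less.hyps[of B' A'] * by (simp add: add.commute)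
    qed
    then show ?thesis by (simp add: add.commute)
  qed
qed

section \<open>From finite unions of boxes to bounded open sets\<close>

lemma open_approx_disjoint_boxes:
  fixes A :: "'a::euclidean_space set"
  assumes A: "open A" "bounded A" "A \<noteq> {}" and e: "e > 0"
  obtains \<A> where "disjoint_boxes \<A>" "\<A> \<noteq> {}" "\<Union>\<A> \<subseteq> A" "measure lebesgue A - e < measure lebesgue (\<Union>\<A>)"
proof -
  obtain a where a: "A \<subseteq> cbox (-a) a" using bounded_subset_cbox_symmetric[OF A(2)] by blast
  \<comment> \<open>The margin \<open>One\<close> makes the enclosing box nondegenerate, as the
    covering lemma requires.\<close>
  define b where "b = a + One"
  have "-a \<bullet> i \<le> a \<bullet> i" if "i \<in> Basis" for i
    using a A(3) that by (fastforce simp: mem_box)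
  then have bi: "0 < b \<bullet> i" "a \<bullet> i \<le> b \<bullet> i" if "i \<in> Basis" for i
    using that by (force simp: b_def inner_add_left)+
  then have "cbox (-a) a \<subseteq> cbox (-b) b" by (force simp: mem_box)
  then have ab: "A \<subseteq> cbox (-b) b" "box (-b) b \<noteq> {}"
    using a bi by (auto simp: box_ne_empty)
  \<comment> \<open>A covering cube lies in \<open>g x\<close> for a tag \<open>x\<close> in
    \<open>A\<close>, hence inside \<open>A\<close>; the radius 1 at points outside \<open>A\<close>
    is a dummy value, as tags are taken in \<open>A\<close> only.\<close>
  define g where "g x = (if x \<in> A then ball x (SOME r. r > 0 \<and> ball x r \<subseteq> A) else ball x 1)" for x
  have g1: "\<exists>r. r > 0 \<and> ball x r \<subseteq> A" if "x \<in> A" for x using A(1) that by (meson open_contains_ball)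
  have g2: "(SOME r. r > 0 \<and> ball x r \<subseteq> A) > 0 \<and> ball x (SOME r. r > 0 \<and> ball x r \<subseteq> A) \<subseteq> A" if "x \<in> A" for x
    using someI_ex[OF g1[OF that]] by blast
  have "Tagged_Division.gauge g" unfolding Tagged_Division.gauge_def using g2 by (auto simp: g_def)
  then obtain \<D> where D: "countable \<D>" "\<And>K. K \<in> \<D> \<Longrightarrow> interior K \<noteq> {} \<and> (\<exists>c d. K = cbox c d)"
    "pairwise (\<lambda>A B. interior A \<inter> interior B = {}) \<D>"
    "\<And>K. K \<in> \<D> \<Longrightarrow> \<exists>x \<in> A \<inter> K. K \<subseteq> g x" "A \<subseteq> \<Union>\<D>"
    using covering_lemma[OF ab] by metis
  have DA: "K \<subseteq> A" if "K \<in> \<D>" for K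
    using D(4)[OF that] g2 by (fastforce simp: g_def)
  \<comment> \<open>Passing from the closed cubes to their interiors gives pairwise disjoint open
    boxes and discards only countably many null frontiers.\<close>
  define I where "I = interior ` \<D>"
  have cI: "countable I" using D(1) by (simp add: I_def)
  have "\<D> \<noteq> {}" using D(5) A(3) by auto
  then have Ine: "I \<noteq> {}" by (simp add: I_def)
  have fI: "disjoint_boxes F" if F: "finite F" "F \<subseteq> I" for F
    unfolding disjoint_boxes_def
  proof (intro conjI ballI)
    show "disjoint F" unfolding pairwise_def disjnt_def
    proof (intro ballI impI)
      fix X Y assume "X \<in> F" "Y \<in> F" "X \<noteq> Y"
      then obtain K L where "K \<in> \<D>" "X = interior K" "L \<in> \<D>" "Y = interior L" using F(2) unfolding I_def by blast
      then show "X \<inter> Y = {}" using D(3) \<open>X \<noteq> Y\<close> unfolding pairwise_def by metis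
    qed
    fix X assume "X \<in> F"
    then obtain K where "K \<in> \<D>" "X = interior K" using \<open>F \<subseteq> I\<close> by (auto simp: I_def)
    then show "X \<noteq> {}" "\<exists>a b. X = box a b" using D(2)[of K] by (blast, metis interior_cbox)
  qed (rule F)
  have IA: "\<Union>I \<subseteq> A" using DA interior_subset unfolding I_def by blast
  have "negligible (\<Union>K\<in>\<D>. frontier K)"
  proof (rule negligible_countable_Union)
    show "countable (frontier ` \<D>)" using D(1) by simp
    show "negligible X" if "X \<in> frontier ` \<D>" for X
      using that D(2) negligible_convex_frontier convex_box(1) by blast
  qed
  moreover have "A - \<Union>I \<subseteq> (\<Union>K\<in>\<D>. frontier K)"
  proof
    fix x assume x: "x \<in> A - \<Union>I"
    then obtain K where K: "K \<in> \<D>" "x \<in> K" using D(5) by blast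
    then have "x \<in> closure K" "x \<notin> interior K" using x closure_subset[of K] unfolding I_def by blast+
    then show "x \<in> (\<Union>K\<in>\<D>. frontier K)" using K(1) unfolding frontier_def by blast
  qed
  ultimately have "negligible (A - \<Union>I)" using negligible_subset by blast
  moreover have "A - \<Union>I \<union> (\<Union>I - A) = A - \<Union>I" using IA by auto
  ultimately have mI: "measure lebesgue (\<Union>I) = measure lebesgue A"
    by (intro measure_negligible_symdiff lmeasurable_open A) simp
  have sI: "X \<in> sets lebesgue" if "X \<in> I" for X using that by (auto simp: I_def)
  define f where "f = from_nat_into I"
  have rf: "range f = I" using cI Ine by (simp add: f_def range_from_nat_into)
  have fm: "A \<in> lmeasurable" using A by (simp add: lmeasurable_open)
  have "(\<lambda>n. measure lebesgue (\<Union>i\<le>n. f i)) \<longlonglongrightarrow> measure lebesgue (\<Union>n. \<Union>i\<le>n. f i)"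
  proof (rule Lim_measure_incseq)
    show "range (\<lambda>n. \<Union>i\<le>n. f i) \<subseteq> sets lebesgue" using sI rf by auto
    show "incseq (\<lambda>n. \<Union>i\<le>n. f i)" by (fastforce simp: incseq_def intro: order_trans)
    have "emeasure lebesgue (\<Union>n. \<Union>i\<le>n. f i) \<le> emeasure lebesgue A"
      using IA rf A by (intro emeasure_mono) auto
    also have "\<dots> < \<infinity>" using fmeasurableD2[OF fm] by (simp add: less_top)
    finally show "emeasure lebesgue (\<Union>n. \<Union>i\<le>n. f i) \<noteq> \<infinity>" by simp
  qed
  moreover have "(\<Union>n. \<Union>i\<le>n. f i) = \<Union>I" using rf by auto
  ultimately have "eventually (\<lambda>n. measure lebesgue A - e < measure lebesgue (\<Union>i\<le>n. f i)) sequentially"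
    using e mI by (intro order_tendstoD) auto
  then obtain n where n: "measure lebesgue A - e < measure lebesgue (\<Union>i\<le>n. f i)"
    using eventually_happens by force
  show thesis
  proof
    show "disjoint_boxes (f ` {..n})" by (rule fI) (use rf in auto)
    show "\<Union>(f ` {..n}) \<subseteq> A" using rf IA by auto
  qed (use n in auto)
qed

theorem brunn_minkowski_open:
  fixes A B :: "'a::euclidean_space set"
  assumes A: "open A" "bounded A" "A \<noteq> {}" and B: "open B" "bounded B" "B \<noteq> {}"
  shows "root DIM('a) (measure lebesgue A) + root DIM('a) (measure lebesgue B)
       \<le> root DIM('a) (measure lebesgue (A + B))"
proof -
  let ?m = "measure lebesgue" and ?n = "DIM('a)"
  \<comment> \<open>\<open>root\<close> is monotone on all of the reals, negative values included,
    so the estimate holds for every \<open>e > 0\<close> and not only for small ones.\<close>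
  have le: "root ?n (?m A - e) + root ?n (?m B - e) \<le> root ?n (?m (A + B))" if e: "e > 0" for e
  proof -
    obtain \<A> where \<A>: "disjoint_boxes \<A>" "\<A> \<noteq> {}" "\<Union>\<A> \<subseteq> A" "?m A - e < ?m (\<Union>\<A>)"
      using open_approx_disjoint_boxes[OF A e] by metis
    obtain \<B> where \<B>: "disjoint_boxes \<B>" "\<B> \<noteq> {}" "\<Union>\<B> \<subseteq> B" "?m B - e < ?m (\<Union>\<B>)"
      using open_approx_disjoint_boxes[OF B e] by metis
    have "root ?n (?m A - e) + root ?n (?m B - e) \<le> root ?n (?m (\<Union>\<A>)) + root ?n (?m (\<Union>\<B>))"
      using \<A>(4) \<B>(4) by (intro add_mono) auto
    also have "\<dots> \<le> root ?n (?m (\<Union>\<A> + \<Union>\<B>))"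
      by (rule brunn_minkowski_disjoint_boxes[OF \<A>(1,2) \<B>(1,2)])
    also have "\<dots> \<le> root ?n (?m (A + B))"
    proof -
      have "\<Union>\<A> + \<Union>\<B> \<subseteq> A + B" using \<A>(3) \<B>(3) by (rule set_plus_mono2)
      moreover have "A + B \<in> lmeasurable" using A B by (simp add: lmeasurable_open open_set_plus bounded_set_plus)
      moreover have "\<Union>\<A> + \<Union>\<B> \<in> sets lebesgue"
        using open_set_plus[OF disjoint_boxes_open_bounded(1)[OF \<A>(1)]] by simp
      ultimately show ?thesis by (simp add: measure_mono_fmeasurable)
    qed
    finally show ?thesis .
  qed
  have "((\<lambda>e. root ?n (?m A - e) + root ?n (?m B - e)) \<longlongrightarrow> root ?n (?m A - 0) + root ?n (?m B - 0)) (at_right 0)"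
    by (intro tendsto_intros)
  then have "root ?n (?m A - 0) + root ?n (?m B - 0) \<le> root ?n (?m (A + B))"
    by (rule tendsto_upperbound) (auto intro: le eventually_mono[OF eventually_at_right_less])
  then show ?thesis by simp
qed

section \<open>Flat coordinates on the sector\<close>

definition hor :: "real^3 \<Rightarrow> complex" where
  "hor z = Complex (z$1) (z$2)"

definition pt :: "complex \<Rightarrow> real \<Rightarrow> real^3" where
  "pt w y = Re w *\<^sub>R axis 1 1 + Im w *\<^sub>R axis 2 1 + y *\<^sub>R axis 3 1"

text \<open>As \<open>Arg 0 = 0\<close>, the strict lower bound also removes the edge
  \<open>hor z = 0\<close>.\<close>

definition wedge :: "real \<Rightarrow> (real^3) set" where
  "wedge b = {z. 0 < Arg (hor z) \<and> Arg (hor z) < b}"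

text \<open>Dividing by \<open>\<alpha> + 1\<close> normalises the complex derivative to
  \<zeta>^\<alpha>, whose squared modulus is exactly the weight; no constants appear in the change
  of variables.\<close>

definition flat :: "real \<Rightarrow> real^3 \<Rightarrow> real^3" where
  "flat \<alpha> z = pt (hor z powr of_real (\<alpha> + 1) / of_real (\<alpha> + 1)) (z$3)"

definition unflat :: "real \<Rightarrow> real^3 \<Rightarrow> real^3" where
  "unflat \<alpha> p = pt ((of_real (\<alpha> + 1) * hor p) powr of_real (1 / (\<alpha> + 1))) (p$3)"

lemma pt_nth [simp]: "pt w y $ 1 = Re w" "pt w y $ 2 = Im w" "pt w y $ 3 = y"
  by (simp_all add: pt_def axis_def)

lemma hor_pt [simp]: "hor (pt w y) = w"
  by (simp add: hor_def)

lemma pt_hor [simp]: "pt (hor z) (z$3) = z"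
  by (simp add: hor_def vec_eq_iff forall_3)

lemma pt_eq_iff: "z = pt w y \<longleftrightarrow> hor z = w \<and> z$3 = y"
  by (auto simp: hor_def vec_eq_iff forall_3)

lemma norm_3: "norm z = sqrt ((cmod (hor z))\<^sup>2 + (z$3)\<^sup>2)" for z :: "real^3"
  by (simp add: norm_vec_def L2_set_def sum_3 hor_def cmod_def)

lemma xnorm2_hor: "xnorm2 z = (cmod (hor z))\<^sup>2"
  by (simp add: xnorm2_def hor_def cmod_def)

lemma hor_diff: "hor (x - y) = hor x - hor y" and hor_add: "hor (x + y) = hor x + hor y"
  and hor_scaleR: "hor (c *\<^sub>R x) = c *\<^sub>R hor x" and hor_0: "hor 0 = 0"
  by (simp_all add: hor_def complex_eq_iff)

lemma norm_hor_le: "cmod (hor z) \<le> norm z"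
  by (simp add: norm_3 real_le_rsqrt)

lemma norm_le_hor: "norm z \<le> cmod (hor z) + \<bar>z$3\<bar>"
  using sqrt_add_le_add_sqrt[of "(cmod (hor z))\<^sup>2" "(z$3)\<^sup>2"] by (simp add: norm_3)

lemma bounded_linear_hor: "bounded_linear hor"
  by (rule bounded_linear_intro[where K=1]) (auto simp: hor_add hor_scaleR norm_hor_le)

lemma has_derivative_hor [derivative_intros]:
  "(f has_derivative f') F \<Longrightarrow> ((\<lambda>x. hor (f x)) has_derivative (\<lambda>x. hor (f' x))) F"
  by (rule bounded_linear.has_derivative[OF bounded_linear_hor])

lemma continuous_on_hor [continuous_intros]: "continuous_on A f \<Longrightarrow> continuous_on A (\<lambda>x. hor (f x))"
  by (rule bounded_linear.continuous_on[OF bounded_linear_hor])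

lemma continuous_on_pt [continuous_intros]:
  "continuous_on A f \<Longrightarrow> continuous_on A g \<Longrightarrow> continuous_on A (\<lambda>x. pt (f x) (g x))"
  unfolding pt_def by (intro continuous_intros)

lemma has_derivative_pt [derivative_intros]:
  "(f has_derivative f') F \<Longrightarrow> (g has_derivative g') F \<Longrightarrow> ((\<lambda>x. pt (f x) (g x)) has_derivative (\<lambda>h. pt (f' h) (g' h))) F"
  unfolding pt_def by (intro derivative_intros)

lemma nalpha_ge: "real (nalpha \<alpha>) \<ge> \<alpha> + 1" and nalpha_pos: "nalpha \<alpha> > 0"
proof -
  obtain k :: nat where "\<alpha> + 1 \<le> real k" using real_arch_simple by blast
  then have "0 < Suc k \<and> \<alpha> + 1 \<le> real (Suc k)" by simp
  then have "0 < nalpha \<alpha> \<and> \<alpha> + 1 \<le> real (nalpha \<alpha>)"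
    unfolding nalpha_def by (rule LeastI)
  then show "real (nalpha \<alpha>) \<ge> \<alpha> + 1" "nalpha \<alpha> > 0" by auto
qed

text \<open>Up to angle \<open>pi\<close> a wedge is an intersection of two open half-spaces:
  rotating by \<open>-b\<close> brings the upper side to the real axis. Openness and closure under
  addition can be read off from this form.\<close>

lemma wedge_iff:
  assumes "0 < b" "b \<le> pi"
  shows "z \<in> wedge b \<longleftrightarrow> 0 < Im (hor z) \<and> Im (hor z * cis (-b)) < 0"
proof -
  let ?w = "hor z" and ?t = "Arg (hor z)"
  have w: "?w = rcis (cmod ?w) ?t" by (simp add: rcis_cmod_Arg)
  have im: "Im (?w * cis (-b)) = cmod ?w * sin (?t - b)"
    by (subst w) (simp add: rcis_def cis_mult mult.assoc)
  have im0: "0 < Im ?w \<longleftrightarrow> 0 < ?t \<and> ?t < pi" using Arg_lt_pi by blast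
  show ?thesis
  proof (cases "0 < ?t \<and> ?t < pi")
    case True
    then have "?w \<noteq> 0" by (auto simp: Arg_zero)
    then have "Im (?w * cis (-b)) < 0 \<longleftrightarrow> sin (?t - b) < 0"
      unfolding im by (simp add: mult_less_0_iff)
    also have "\<dots> \<longleftrightarrow> ?t < b"
    proof
      assume "sin (?t - b) < 0" then show "?t < b"
        using sin_ge_zero[of "?t - b"] True assms by linarith
    next
      assume "?t < b" then show "sin (?t - b) < 0"
        using sin_gt_zero[of "b - ?t"] True assms sin_minus[of "b - ?t"] by simp
    qed
    finally show ?thesis using True im0 by (simp add: wedge_def)
  next
    case False
    then show ?thesis using im0 assms by (auto simp: wedge_def)
  qed
qed

lemma open_wedge:
  assumes "0 < b" "b \<le> pi" shows "open (wedge b)"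
proof -
  have "wedge b = {z. 0 < Im (hor z)} \<inter> {z. Im (hor z * cis (-b)) < 0}"
    using wedge_iff[OF assms] by auto
  then show ?thesis
    by (auto intro!: open_Int open_Collect_less continuous_intros)
qed

lemma wedge_add: "0 < b \<Longrightarrow> b \<le> pi \<Longrightarrow> x \<in> wedge b \<Longrightarrow> y \<in> wedge b \<Longrightarrow> x + y \<in> wedge b"
  by (simp add: wedge_iff hor_add distrib_right del: Im_complex_div_gt_0 times_complex.sel)

lemma wedge_scaleR: "0 < c \<Longrightarrow> c *\<^sub>R x \<in> wedge b \<longleftrightarrow> x \<in> wedge b"
  by (simp add: wedge_def hor_scaleR scaleR_conv_of_real[where 'a=complex] Arg_times_of_real)

lemma wedge_nonempty: assumes "0 < b" "b \<le> pi" shows "wedge b \<noteq> {}"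
proof -
  have "Arg (cis (b/2)) = b / 2" using assms by (intro Arg_cis) auto
  then have "pt (cis (b/2)) 0 \<in> wedge b" using assms by (simp add: wedge_def)
  then show ?thesis by blast
qed

lemma hor_wedge_nonzero: "z \<in> wedge b \<Longrightarrow> hor z \<noteq> 0"
  by (auto simp: wedge_def Arg_zero)

lemma sector_eq_wedge:
  assumes "\<alpha> > 0"
  shows "sector \<alpha> = wedge (pi / real (nalpha \<alpha>))"
proof -
  let ?b = "pi / real (nalpha \<alpha>)"
  have b: "?b < pi" using nalpha_ge[of \<alpha>] assms pi_gt_zero by (simp add: divide_less_eq)
  show ?thesis
  proof (intro set_eqI iffI)
    fix z assume "z \<in> sector \<alpha>"
    then obtain r t where *: "r > 0" "0 < t" "t < ?b" "z$1 = r * cos t" "z$2 = r * sin t"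
      by (auto simp: sector_def)
    then have "hor z = rcis r t" by (simp add: hor_def complex_eq_iff)
    then have "Arg (hor z) = t" using * b by (intro Arg_unique'[of r]) auto
    then show "z \<in> wedge ?b" using * by (simp add: wedge_def)
  next
    fix z assume z: "z \<in> wedge ?b"
    have w: "hor z = rcis (cmod (hor z)) (Arg (hor z))" by (simp add: rcis_cmod_Arg)
    have "z$1 = cmod (hor z) * cos (Arg (hor z))" "z$2 = cmod (hor z) * sin (Arg (hor z))"
      using arg_cong[OF w, of Re] arg_cong[OF w, of Im] by (simp_all add: hor_def)
    moreover have "cmod (hor z) > 0" using hor_wedge_nonzero[OF z] by simp
    moreover have "0 < Arg (hor z)" "Arg (hor z) < ?b" using z by (simp_all add: wedge_def)
    ultimately show "z \<in> sector \<alpha>" unfolding sector_def by blast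
  qed
qed

text \<open>The bounds on \<open>a * Arg z\<close> say that the power stays on the principal branch,
  so taking \<open>Ln\<close> afterwards does not wrap around.\<close>

lemma Ln_powr_of_real:
  assumes "z \<noteq> 0" "- pi < a * Arg z" "a * Arg z \<le> pi"
  shows "Ln (z powr of_real a) = of_real a * Ln z"
  using assms by (simp add: powr_def Arg_eq_Im_Ln)

section \<open>The flattening map as a bijection from the sector onto the wedge\<close>

locale grushin =
  fixes \<alpha> :: real
  assumes alpha_pos: "\<alpha> > 0"
begin

abbreviation "S \<equiv> sector \<alpha>"

definition "W = wedge ((\<alpha> + 1) * (pi / real (nalpha \<alpha>)))"

lemma angle: "0 < (\<alpha> + 1) * (pi / real (nalpha \<alpha>))" "(\<alpha> + 1) * (pi / real (nalpha \<alpha>)) \<le> pi"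
  using nalpha_pos[of \<alpha>] nalpha_ge[of \<alpha>] alpha_pos by (auto simp: divide_simps)

lemma angle_S: "0 < pi / real (nalpha \<alpha>)" "pi / real (nalpha \<alpha>) \<le> pi"
  using nalpha_pos[of \<alpha>] by (auto simp: divide_simps)

lemmas S_wedge = sector_eq_wedge[OF alpha_pos]

lemma open_S: "open S" unfolding S_wedge by (rule open_wedge[OF angle_S])
lemma open_W: "open W" unfolding W_def by (rule open_wedge[OF angle])
lemmas W_add = wedge_add[OF angle, folded W_def]
lemma W_scaleR: "0 < c \<Longrightarrow> c *\<^sub>R x \<in> W \<longleftrightarrow> x \<in> W" unfolding W_def by (rule wedge_scaleR)

lemma hor_S_nonpos_Reals: "z \<in> S \<Longrightarrow> hor z \<notin> \<real>\<^sub>\<le>\<^sub>0" "z \<in> W \<Longrightarrow> hor z \<notin> \<real>\<^sub>\<le>\<^sub>0"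
  using angle_S angle by (auto simp: S_wedge W_def wedge_iff elim!: nonpos_Reals_cases)

lemma hor_S_nonzero: "z \<in> S \<Longrightarrow> hor z \<noteq> 0" "z \<in> W \<Longrightarrow> hor z \<noteq> 0"
  by (auto simp: S_wedge W_def hor_wedge_nonzero)

text \<open>The argument is multiplied by \<open>\<alpha> + 1\<close>, and the choice of
  \<open>nalpha\<close> keeps the product below \<open>pi\<close>; the principal power is therefore
  undone by the principal root.\<close>

lemma
  assumes z: "z \<in> S"
  shows flat_in_W: "flat \<alpha> z \<in> W" and unflat_flat: "unflat \<alpha> (flat \<alpha> z) = z"
proof -
  have z0: "hor z \<noteq> 0" using z by (rule hor_S_nonzero)
  have A: "0 < Arg (hor z)" "Arg (hor z) < pi / real (nalpha \<alpha>)" using z by (auto simp: S_wedge wedge_def)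
  have aA: "0 < (\<alpha> + 1) * Arg (hor z)" "(\<alpha> + 1) * Arg (hor z) < (\<alpha> + 1) * (pi / real (nalpha \<alpha>))"
    using A alpha_pos mult_strict_left_mono[OF A(2), of "\<alpha> + 1"] by auto
  have L: "Ln (hor z powr of_real (\<alpha> + 1)) = of_real (\<alpha> + 1) * Ln (hor z)"
    by (rule Ln_powr_of_real[OF z0]) (use aA angle in linarith)+
  have nz: "hor z powr of_real (\<alpha> + 1) \<noteq> 0" using z0 by simp
  have a0: "of_real (\<alpha> + 1) \<noteq> (0::complex)" using alpha_pos by (metis add_pos_pos less_irrefl of_real_eq_0_iff zero_less_one)
  have "Arg (hor z powr of_real (\<alpha> + 1)) = (\<alpha> + 1) * Arg (hor z)"
    using L nz z0 by (simp add: Arg_eq_Im_Ln del: of_real_add)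
  then have "Arg (hor (flat \<alpha> z)) = (\<alpha> + 1) * Arg (hor z)"
    unfolding flat_def hor_pt using alpha_pos Arg_times_of_real[of "inverse (\<alpha> + 1)" "hor z powr of_real (\<alpha> + 1)"]
    by (simp add: divide_inverse mult.commute del: of_real_add)
  then show "flat \<alpha> z \<in> W" using aA by (simp add: W_def wedge_def)
  have "(hor z powr of_real (\<alpha> + 1)) powr of_real (1 / (\<alpha> + 1)) = hor z"
    unfolding powr_def[of "hor z powr of_real (\<alpha> + 1)"] L using nz z0 a0
    by (simp del: of_real_add add: of_real_divide)
  then show "unflat \<alpha> (flat \<alpha> z) = z"
    unfolding flat_def unflat_def using a0 by (simp del: of_real_add add: pt_eq_iff[symmetric])
qed

lemma
  assumes p: "p \<in> W"
  shows unflat_in_S: "unflat \<alpha> p \<in> S" and flat_unflat: "flat \<alpha> (unflat \<alpha> p) = p"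
proof -
  define v where "v = of_real (\<alpha> + 1) * hor p"
  have a1: "\<alpha> + 1 > 0" using alpha_pos by simp
  have v0: "v \<noteq> 0" using p a1 hor_S_nonzero(2)[OF p] by (simp add: v_def del: of_real_add)
  have Av: "Arg v = Arg (hor p)" using a1 by (simp add: v_def Arg_times_of_real del: of_real_add)
  have A: "0 < Arg v" "Arg v < (\<alpha> + 1) * (pi / real (nalpha \<alpha>))" using p by (auto simp: Av W_def wedge_def)
  then have aA: "0 < 1 / (\<alpha> + 1) * Arg v" "1 / (\<alpha> + 1) * Arg v < pi / real (nalpha \<alpha>)"
    using a1 by (auto simp: field_simps)
  have L: "Ln (v powr of_real (1 / (\<alpha> + 1))) = of_real (1 / (\<alpha> + 1)) * Ln v"
    by (rule Ln_powr_of_real[OF v0]) (use aA angle_S in linarith)+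
  have nz: "v powr of_real (1 / (\<alpha> + 1)) \<noteq> 0" using v0 by simp
  have a0: "of_real (\<alpha> + 1) \<noteq> (0::complex)" using a1 by (metis less_irrefl of_real_eq_0_iff)
  have "Arg (v powr of_real (1 / (\<alpha> + 1))) = 1 / (\<alpha> + 1) * Arg v"
    using L nz v0 by (simp add: Arg_eq_Im_Ln del: of_real_add of_real_divide)
  then show "unflat \<alpha> p \<in> S" using aA by (simp add: S_wedge unflat_def wedge_def v_def)
  have "(v powr of_real (1 / (\<alpha> + 1))) powr of_real (\<alpha> + 1) = v"
    unfolding powr_def[of "v powr of_real (1 / (\<alpha> + 1))"] L using nz v0 a0
    by (simp del: of_real_add add: of_real_divide)
  then show "flat \<alpha> (unflat \<alpha> p) = p"
    unfolding flat_def unflat_def using a0 by (simp del: of_real_add add: v_def pt_eq_iff[symmetric])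
qed

lemma inj_on_flat: "inj_on (flat \<alpha>) S"
  by (rule inj_on_inverseI[of _ "unflat \<alpha>"]) (rule unflat_flat)

lemma norm_hor_flat: "cmod (hor (flat \<alpha> z)) = cmod (hor z) powr (\<alpha> + 1) / (\<alpha> + 1)"
proof -
  have "cmod (hor z powr of_real (\<alpha> + 1)) = cmod (hor z) powr (\<alpha> + 1)"
    by (subst norm_powr_real_powr') (auto simp del: of_real_add)
  then show ?thesis using alpha_pos by (simp add: flat_def norm_divide del: of_real_add)
qed

lemma norm_flat: "norm (flat \<alpha> z) = gauge \<alpha> z / (\<alpha> + 1)"
proof -
  have "(cmod (hor z) powr (\<alpha> + 1))\<^sup>2 = xnorm2 z powr (\<alpha> + 1)"
    by (simp add: xnorm2_hor power2_eq_square powr_mult)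
  moreover have "sqrt (x / (\<alpha> + 1)\<^sup>2 + y\<^sup>2) = sqrt (x + (\<alpha> + 1)\<^sup>2 * y\<^sup>2) / (\<alpha> + 1)" for x y
  proof -
    have "x / (\<alpha> + 1)\<^sup>2 + y\<^sup>2 = (x + (\<alpha> + 1)\<^sup>2 * y\<^sup>2) / (\<alpha> + 1)\<^sup>2"
      using alpha_pos by (simp add: add_divide_distrib)
    then show ?thesis using alpha_pos by (simp add: real_sqrt_divide)
  qed
  ultimately show ?thesis
    unfolding norm_3 norm_hor_flat by (simp add: gauge_def power_divide flat_def)
qed

lemma has_derivative_flat:
  assumes z: "z \<in> S"
  shows "(flat \<alpha> has_derivative (\<lambda>h. pt (hor z powr of_real \<alpha> * hor h) (h$3))) (at z)"
proof -
  have a0: "of_real (\<alpha> + 1) \<noteq> (0::complex)" using alpha_pos by (metis add_pos_pos less_irrefl of_real_eq_0_iff zero_less_one)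
  have "((\<lambda>w. w powr of_real (\<alpha> + 1) / of_real (\<alpha> + 1)) has_field_derivative hor z powr of_real \<alpha>) (at (hor z))"
    using hor_S_nonpos_Reals(1)[OF z] a0
    by (auto intro!: derivative_eq_intros)
  then have "((\<lambda>w. w powr of_real (\<alpha> + 1) / of_real (\<alpha> + 1)) has_derivative (*) (hor z powr of_real \<alpha>)) (at (hor z))"
    by (simp add: has_field_derivative_def)
  from has_derivative_compose[OF has_derivative_hor[OF has_derivative_ident] this]
  have "((\<lambda>z. hor z powr of_real (\<alpha> + 1) / of_real (\<alpha> + 1)) has_derivative (\<lambda>h. hor z powr of_real \<alpha> * hor h)) (at z)"
    by simp
  then show ?thesis unfolding flat_def
    by (intro derivative_intros bounded_linear.has_derivative[OF bounded_linear_vec_nth]) auto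
qed

lemma has_derivative_unflat:
  assumes p: "p \<in> W"
  shows "(unflat \<alpha> has_derivative (\<lambda>h. pt ((of_real (\<alpha> + 1) * hor p) powr of_real (1 / (\<alpha> + 1) - 1) * hor h) (h$3))) (at p)"
proof -
  let ?a = "of_real (\<alpha> + 1) :: complex" and ?b = "of_real (1 / (\<alpha> + 1)) :: complex"
  have a0: "?a \<noteq> 0" using alpha_pos by (metis add_pos_pos less_irrefl of_real_eq_0_iff zero_less_one)
  have np: "?a * hor p \<notin> \<real>\<^sub>\<le>\<^sub>0"
    using hor_S_nonpos_Reals(2)[OF p] alpha_pos by (auto simp: complex_nonpos_Reals_iff mult_le_0_iff zero_less_mult_iff)
  have ba: "?b * ?a = 1" using a0 by (simp add: of_real_divide del: of_real_add)
  have "((\<lambda>w. (?a * w) powr ?b) has_field_derivative (?b * (?a * hor p) powr (?b - 1) * ?a)) (at (hor p))"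
    using np by (auto intro!: derivative_eq_intros simp del: of_real_add of_real_divide)
  then have "((\<lambda>w. (?a * w) powr ?b) has_field_derivative (?a * hor p) powr of_real (1 / (\<alpha> + 1) - 1)) (at (hor p))"
    by (rule DERIV_cong) (use ba in \<open>simp add: mult.commute mult.left_commute del: of_real_add of_real_divide\<close>)
  then have "((\<lambda>w. (?a * w) powr ?b) has_derivative (*) ((?a * hor p) powr of_real (1 / (\<alpha> + 1) - 1))) (at (hor p))"
    by (simp add: has_field_derivative_def)
  from has_derivative_compose[OF has_derivative_hor[OF has_derivative_ident] this]
  have "((\<lambda>z. (?a * hor z) powr ?b) has_derivative (\<lambda>h. (?a * hor p) powr of_real (1 / (\<alpha> + 1) - 1) * hor h)) (at p)"
    by simp
  then show ?thesis unfolding unflat_def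
    by (intro derivative_intros bounded_linear.has_derivative[OF bounded_linear_vec_nth]) auto
qed

lemma continuous_on_flat: "continuous_on S (flat \<alpha>)"
  using has_derivative_flat has_derivative_continuous continuous_at_imp_continuous_on by blast

lemma continuous_on_unflat: "continuous_on W (unflat \<alpha>)"
  using has_derivative_unflat has_derivative_continuous continuous_at_imp_continuous_on by blast

text \<open>Multiplication by \<open>c\<close> is a rotation combined with a dilation by
  \<open>cmod c\<close> in the horizontal plane, and the third coordinate is unchanged.\<close>

lemma det_conformal:
  "det (matrix (\<lambda>h. pt (c * hor h) (h$3))) = (cmod c)\<^sup>2"
  by (simp add: det_3 matrix_def hor_def axis_def cmod_power2) (simp add: power2_eq_square)

lemma cmod_powr_alpha: "(cmod (hor z powr of_real \<alpha>))\<^sup>2 = xnorm2 z powr \<alpha>"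
  by (simp add: norm_powr_real_powr' xnorm2_hor power2_eq_square powr_mult)

lemma cmod_unflat_coeff:
  assumes "p \<in> W"
  shows "cmod ((of_real (\<alpha> + 1) * hor p) powr of_real (1 / (\<alpha> + 1) - 1)) = cmod (hor (unflat \<alpha> p)) powr (- \<alpha>)"
proof -
  have e: "1 / (\<alpha> + 1) - 1 = 1 / (\<alpha> + 1) * (- \<alpha>)" using alpha_pos by (simp add: field_simps)
  have "cmod (v powr of_real (1 / (\<alpha> + 1) - 1)) = cmod (v powr of_real (1 / (\<alpha> + 1))) powr (- \<alpha>)" for v
    by (simp add: norm_powr_real_powr' powr_powr e del: of_real_diff of_real_divide of_real_mult)
  then show ?thesis by (simp add: unflat_def del: of_real_diff of_real_divide of_real_add)
qed

text \<open>If the segment from \<open>w\<close> to \<open>w'\<close> stays away from the edge, use the mean value theorem for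
  the inverse map; otherwise both points are within a multiple of \<open>cmod (w - w')\<close> of the edge.\<close>

lemma hor_dist_le:
  assumes z: "z \<in> S" and z': "z' \<in> S"
  shows "cmod (hor z - hor z') * cmod (hor z) powr \<alpha> \<le> (2 + 5 * (\<alpha> + 1)) * cmod (hor (flat \<alpha> z) - hor (flat \<alpha> z'))"
proof -
  let ?a = "\<alpha> + 1" and ?w = "hor (flat \<alpha> z)" and ?w' = "hor (flat \<alpha> z')"
  define d where "d = cmod (?w - ?w')"
  have a: "?a > 0" using alpha_pos by simp
  have nz: "cmod (hor z) > 0" "cmod (hor z') > 0" using hor_S_nonzero(1) z z' by auto
  have rz: "cmod (hor z) powr ?a = ?a * cmod ?w" and rz': "cmod (hor z') powr ?a = ?a * cmod ?w'"
    using a by (simp_all add: norm_hor_flat)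
  have rr: "r * r powr \<alpha> = r powr ?a" if "r > 0" for r using that by (simp add: powr_add)
  have d0: "d \<ge> 0" by (simp add: d_def)
  show ?thesis
  proof (cases "d \<le> cmod ?w / 2")
    case True
    \<comment> \<open>\<open>D\<close> is convex and the inverse map is holomorphic on it. Since
      \<open>cmod v\<close> is at least half of \<open>cmod ?w\<close> there, the derivative exceeds
      its size at \<open>?w\<close> by at most the factor (1/2)^(1/(\<alpha>+1) - 1), which is at
      most 2.\<close>
    define D where "D = {v. 0 < Im v} \<inter> cball ?w (cmod ?w / 2)"
    have conv: "convex D" unfolding D_def using convex_halfspace_Im_gt[of 0] by (intro convex_Int convex_cball) auto
    have W: "flat \<alpha> z \<in> W" "flat \<alpha> z' \<in> W" using z z' flat_in_W by auto
    have wD: "?w \<in> D" "?w' \<in> D" using W True wedge_iff[OF angle] by (auto simp: D_def W_def d_def dist_norm)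
    let ?g = "\<lambda>v. (of_real ?a * v) powr of_real (1 / ?a)"
    have g: "?g ?w = hor z" "?g ?w' = hor z'"
      using unflat_flat[OF z] unflat_flat[OF z'] unfolding unflat_def by (metis hor_pt)+
    have "cmod (?g ?w - ?g ?w') \<le> 2 * cmod (hor z) powr (- \<alpha>) * cmod (?w - ?w')"
    proof (rule field_differentiable_bound[OF conv _ _ wD])
      fix v assume v: "v \<in> D"
      have np: "of_real ?a * v \<notin> \<real>\<^sub>\<le>\<^sub>0"
        using v a by (auto simp: D_def complex_nonpos_Reals_iff mult_le_0_iff zero_less_mult_iff)
      have a0: "of_real ?a \<noteq> (0::complex)" using a by (metis less_irrefl of_real_eq_0_iff)
      have ba: "of_real (1 / ?a) * of_real ?a = (1::complex)" using a0 by (simp add: of_real_divide del: of_real_add)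
      have "(?g has_field_derivative (of_real (1 / ?a) * (of_real ?a * v) powr (of_real (1 / ?a) - 1) * of_real ?a)) (at v)"
        using np by (auto intro!: derivative_eq_intros simp del: of_real_add of_real_divide)
      then have "(?g has_field_derivative ((of_real ?a * v) powr of_real (1 / ?a - 1))) (at v)"
        by (rule DERIV_cong) (use ba in \<open>simp add: mult.commute mult.left_commute del: of_real_add of_real_divide\<close>)
      then show "(?g has_field_derivative ((of_real ?a * v) powr of_real (1 / ?a - 1))) (at v within D)"
        by (rule has_field_derivative_at_within)
      have "cmod ?w \<le> cmod v + cmod (?w - v)" by (metis norm_triangle_sub add.commute)
      then have vw: "cmod ?w / 2 \<le> cmod v" using v by (simp add: D_def dist_norm)
      have w0: "cmod ?w > 0" using rz nz a by (metis mult_zero_right order_le_less norm_ge_zero powr_gt_zero less_irrefl)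
      have "cmod ((of_real ?a * v) powr of_real (1 / ?a - 1)) = (?a * cmod v) powr (1 / ?a - 1)"
        using a by (simp add: norm_powr_real_powr' norm_mult del: of_real_add of_real_diff of_real_divide)
      also have "\<dots> \<le> (?a * (cmod ?w / 2)) powr (1 / ?a - 1)"
        using a vw w0 alpha_pos by (intro powr_mono2') auto
      also have "\<dots> = (1/2) powr (1 / ?a - 1) * (cmod (hor z) powr ?a) powr (1 / ?a - 1)"
        unfolding rz using a by (simp add: powr_mult[symmetric])
      also have "(cmod (hor z) powr ?a) powr (1 / ?a - 1) = cmod (hor z) powr (- \<alpha>)"
        using a by (simp add: powr_powr algebra_simps)
      also have "(1/2::real) powr (1 / ?a - 1) \<le> 2"
      proof -
        have "(1/2::real) powr (1 / ?a - 1) \<le> (1/2) powr (-1)" using a by (intro powr_mono') auto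
        then show ?thesis by (simp add: powr_minus)
      qed
      finally show "cmod ((of_real ?a * v) powr of_real (1 / ?a - 1)) \<le> 2 * cmod (hor z) powr (- \<alpha>)"
        by (simp add: mult_right_mono)
    qed
    then have "cmod (hor z - hor z') * cmod (hor z) powr \<alpha> \<le> 2 * cmod (hor z) powr (- \<alpha>) * d * cmod (hor z) powr \<alpha>"
      unfolding g d_def by (intro mult_right_mono) auto
    also have "\<dots> = 2 * d" using nz by (simp add: powr_minus)
    also have "\<dots> \<le> (2 + 5 * ?a) * d" using d0 a by (intro mult_right_mono) auto
    finally show ?thesis by (simp add: d_def)
  next
    case False
    then have w: "cmod ?w \<le> 2 * d" by simp
    have "cmod ?w' \<le> cmod ?w + d" unfolding d_def by (metis norm_triangle_sub norm_minus_commute)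
    then have w': "cmod ?w' \<le> 3 * d" using w by simp
    have m1: "cmod (hor z) powr ?a \<le> ?a * (2 * d)" "cmod (hor z) powr ?a \<le> ?a * (3 * d)" "cmod (hor z') powr ?a \<le> ?a * (3 * d)"
      unfolding rz rz' using w w' a d0 by (auto intro!: mult_left_mono)
    \<comment> \<open>The mixed product is at most the larger of the two radii raised to the power
      \<open>\<alpha> + 1\<close>, and both of these powers are multiples of the distance to the
      edge in flat coordinates.\<close>
    have m2: "cmod (hor z') * cmod (hor z) powr \<alpha> \<le> ?a * (3 * d)"
    proof (cases "cmod (hor z) \<le> cmod (hor z')")
      case True
      then have "cmod (hor z') * cmod (hor z) powr \<alpha> \<le> cmod (hor z') * cmod (hor z') powr \<alpha>"
        using alpha_pos by (intro mult_left_mono powr_mono2) auto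
      then show ?thesis using m1 rr[OF nz(2)] by linarith
    next
      case False
      then have "cmod (hor z') * cmod (hor z) powr \<alpha> \<le> cmod (hor z) * cmod (hor z) powr \<alpha>"
        by (intro mult_right_mono) auto
      then show ?thesis using m1 rr[OF nz(1)] by linarith
    qed
    have "cmod (hor z - hor z') * cmod (hor z) powr \<alpha> \<le> (cmod (hor z) + cmod (hor z')) * cmod (hor z) powr \<alpha>"
      by (intro mult_right_mono norm_triangle_ineq4) auto
    also have "\<dots> \<le> ?a * (2 * d) + ?a * (3 * d)"
      using m1 m2 rr[OF nz(1)] by (simp add: distrib_right)
    also have "\<dots> \<le> (2 + 5 * ?a) * d" using d0 by (simp add: algebra_simps)
    finally show ?thesis by (simp add: d_def)
  qed
qed

end

section \<open>Weighted measure and the isoperimetric inequality in the wedge\<close>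

lemma borel_measurable_xnorm2 [measurable]: "xnorm2 \<in> borel_measurable borel"
  unfolding xnorm2_def[abs_def] by (intro borel_measurable_continuous_onI continuous_intros)

lemma borel_measurable_gauge [measurable]: "gauge \<alpha> \<in> borel_measurable borel"
proof -
  have "(\<lambda>z::real^3. z $ 3) \<in> borel_measurable borel"
    by (intro borel_measurable_continuous_onI continuous_intros)
  then show ?thesis unfolding gauge_def[abs_def] by measurable
qed

text \<open>Continuity from below along balls. It reduces the identification of pushforwards to
  bounded sets, where volumes are finite and the change-of-variables and isometry theorems for
  measurable sets of finite measure apply.\<close>

lemma emeasure_eq_on_bounded:
  fixes M N :: "'a::euclidean_space measure"
  assumes sets: "sets M = sets borel" "sets N = sets borel"
    and eq: "\<And>X. X \<in> sets borel \<Longrightarrow> bounded X \<Longrightarrow> emeasure M X = emeasure N X"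
  shows "M = N"
proof (rule measure_eqI)
  fix X assume "X \<in> sets M"
  then have X: "X \<in> sets borel" using sets by simp
  define Y where "Y n = X \<inter> ball 0 (real n)" for n :: nat
  have Y: "Y n \<in> sets borel" "bounded (Y n)" for n using X by (auto simp: Y_def)
  have inc: "incseq Y" by (auto simp: incseq_def Y_def)
  have "x \<in> (\<Union>n. Y n)" if "x \<in> X" for x
    using reals_Archimedean2[of "norm x"] that by (auto simp: Y_def)
  then have U: "(\<Union>n. Y n) = X" by (auto simp: Y_def)
  have "emeasure M X = (SUP n. emeasure M (Y n))"
    using Y inc sets by (subst SUP_emeasure_incseq) (auto simp: U)
  also have "\<dots> = (SUP n. emeasure N (Y n))" using eq Y by simp
  also have "\<dots> = emeasure N X"
    using Y inc sets by (subst SUP_emeasure_incseq) (auto simp: U)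
  finally show "emeasure M X = emeasure N X" .
qed (use sets in simp)

context grushin
begin

abbreviation "wt z \<equiv> xnorm2 z powr \<alpha>"

definition "mS = density lborel (\<lambda>z. ennreal (indicator S z * wt z))"

text \<open>Cutting off outside \<open>S\<close>, where the principal power may be discontinuous,
  makes the map Borel on the whole space; \<open>mS\<close> does not see the difference.\<close>

definition "flatS z = (if z \<in> S then flat \<alpha> z else 0)"

definition "om = measure lborel (W \<inter> ball 0 1)"

lemma borel_S [measurable]: "S \<in> sets borel" and borel_W [measurable]: "W \<in> sets borel"
  using open_S open_W by auto

lemma borel_measurable_flatS [measurable]: "flatS \<in> borel_measurable borel"
  unfolding flatS_def[abs_def]
  by (rule borel_measurable_continuous_on_if) (auto intro: continuous_on_flat)

text \<open>Change of variables: the Jacobian of \<open>flat\<close> is |\<zeta>^\<alpha>|^2, which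
  is the weight, and \<open>flat\<close> is injective from \<open>S\<close> onto
  \<open>W\<close>.\<close>

lemma distr_flat: "distr mS borel flatS = density lborel (indicator W)"
proof (rule emeasure_eq_on_bounded)
  fix X :: "(real^3) set" assume X[measurable]: "X \<in> sets borel" and b: "bounded X"
  define A where "A = S \<inter> flatS -` X"
  have A[measurable]: "A \<in> sets borel" unfolding A_def by measurable
  have im: "flat \<alpha> ` A = X \<inter> W"
  proof (intro set_eqI iffI)
    fix p assume "p \<in> X \<inter> W"
    then have "unflat \<alpha> p \<in> A" "p = flat \<alpha> (unflat \<alpha> p)"
      by (auto simp: A_def flatS_def unflat_in_S flat_unflat)
    then show "p \<in> flat \<alpha> ` A" by (rule rev_image_eqI)
  qed (auto simp: A_def flatS_def flat_in_W)
  have "A \<in> sets lebesgue" using A by auto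
  moreover have "(flat \<alpha> has_derivative (\<lambda>h. pt (hor z powr of_real \<alpha> * hor h) (h$3))) (at z within A)" if "z \<in> A" for z
    by (rule has_derivative_at_withinI[OF has_derivative_flat]) (use that in \<open>simp add: A_def\<close>)
  moreover have "inj_on (flat \<alpha>) A" by (rule inj_on_subset[OF inj_on_flat]) (simp add: A_def)
  ultimately have "flat \<alpha> ` A \<in> lmeasurable \<and> measure lebesgue (flat \<alpha> ` A) = measure lborel (X \<inter> W)
     \<longleftrightarrow> ((\<lambda>z. \<bar>det (matrix (\<lambda>h. pt (hor z powr of_real \<alpha> * hor h) (h$3)))\<bar>) has_integral measure lborel (X \<inter> W)) A"
    by (rule has_measure_differentiable_image)
  moreover have "X \<inter> W \<in> lmeasurable" using b by (intro bounded_set_imp_lmeasurable) auto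
  ultimately have "((\<lambda>z. wt z) has_integral measure lborel (X \<inter> W)) A"
    by (simp add: im det_conformal cmod_powr_alpha)
  then have "(\<integral>\<^sup>+z. indicator A z * ennreal (wt z) \<partial>lborel) = ennreal (measure lborel (X \<inter> W))"
    using nn_integral_has_integral_lebesgue[of A "\<lambda>z. wt z"] by (simp add: ennreal_mult' indicator_mult_ennreal)
  also have "\<dots> = emeasure lborel (X \<inter> W)"
    using emeasure_bounded_finite[of "X \<inter> W"] bounded_subset[OF b, of "X \<inter> W"] by (intro emeasure_eq_ennreal_measure[symmetric]) auto
  finally have *: "(\<integral>\<^sup>+z. indicator A z * ennreal (wt z) \<partial>lborel) = emeasure lborel (X \<inter> W)" .
  have "emeasure (distr mS borel flatS) X = emeasure mS (flatS -` X)"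
    by (subst emeasure_distr) (auto simp: mS_def)
  also have "\<dots> = (\<integral>\<^sup>+z. ennreal (indicator S z * wt z) * indicator (flatS -` X) z \<partial>lborel)"
    unfolding mS_def using measurable_sets_borel[OF borel_measurable_flatS X] by (subst emeasure_density) auto
  also have "\<dots> = (\<integral>\<^sup>+z. indicator A z * ennreal (wt z) \<partial>lborel)"
    by (intro nn_integral_cong) (auto simp: A_def indicator_def)
  also note *
  also have "emeasure lborel (X \<inter> W) = emeasure (density lborel (indicator W)) X"
    by (subst emeasure_density) (auto simp: indicator_inter_arith[symmetric] Int_commute)
  finally show "emeasure (distr mS borel flatS) X = emeasure (density lborel (indicator W)) X" .
qed (auto simp: mS_def)

lemma nn_integral_mS:
  assumes [measurable]: "F \<in> borel_measurable borel"
  shows "(\<integral>\<^sup>+z. F z \<partial>mS) = (\<integral>\<^sup>+z. indicator S z * ennreal (wt z) * F z \<partial>lborel)"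
  unfolding mS_def by (subst nn_integral_density) (auto intro!: nn_integral_cong simp: indicator_def)

lemma nn_integral_flat:
  assumes [measurable]: "F \<in> borel_measurable borel"
  shows "(\<integral>\<^sup>+z. F (flatS z) \<partial>mS) = (\<integral>\<^sup>+p. indicator W p * F p \<partial>lborel)"
proof -
  have "(\<integral>\<^sup>+z. F (flatS z) \<partial>mS) = (\<integral>\<^sup>+p. F p \<partial>distr mS borel flatS)"
    by (subst nn_integral_distr) (auto simp: mS_def)
  also have "\<dots> = (\<integral>\<^sup>+p. indicator W p * F p \<partial>lborel)"
    unfolding distr_flat by (subst nn_integral_density) auto
  finally show ?thesis .
qed

lemma AE_mS_S: "AE z in mS. z \<in> S"
  unfolding mS_def by (subst AE_density) (auto simp: indicator_def)

lemma om_pos: "om > 0" and emeasure_W_ball1: "emeasure lborel (W \<inter> ball 0 1) = ennreal om"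
proof -
  obtain x where x: "x \<in> W" using wedge_nonempty[OF angle] by (auto simp: W_def)
  have n: "norm x + 1 > 0" by (simp add: add_nonneg_pos)
  then have "norm ((1 / (norm x + 1)) *\<^sub>R x) < 1" by (simp add: divide_simps)
  moreover have "(1 / (norm x + 1)) *\<^sub>R x \<in> W" using x n by (subst W_scaleR) auto
  ultimately have ne: "W \<inter> ball 0 1 \<noteq> {}" by (metis IntI dist_0_norm empty_iff mem_ball)
  have op: "open (W \<inter> ball 0 1)" using open_W by auto
  have lm: "W \<inter> ball 0 1 \<in> lmeasurable" by (intro lmeasurable_open op) auto
  have "\<not> negligible (W \<inter> ball 0 1)" by (rule open_not_negligible[OF op ne])
  then have "measure lebesgue (W \<inter> ball 0 1) \<noteq> 0" using negligible_iff_measure0[OF lm] by simp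
  then show "om > 0" using op by (simp add: om_def zero_less_measure_iff)
  show "emeasure lborel (W \<inter> ball 0 1) = ennreal om"
    unfolding om_def using emeasure_bounded_finite[of "W \<inter> ball 0 1"]
    by (intro emeasure_eq_ennreal_measure) (auto simp: bounded_Int)
qed

text \<open>\<open>W\<close> is a cone, so a dilation by \<open>r\<close> carries the unit piece
  onto this one; the exponent is the dimension.\<close>

lemma emeasure_W_ball:
  assumes "r \<ge> 0"
  shows "emeasure lborel (W \<inter> ball 0 r) = ennreal (om * r ^ 3)"
proof (cases "r = 0")
  case False
  then have r: "r > 0" using assms by simp
  have "emeasure lborel (W \<inter> ball 0 r) = emeasure (density (distr lborel borel (\<lambda>x. 0 + r *\<^sub>R x)) (\<lambda>_. ennreal (\<bar>r\<bar> ^ DIM(real^3)))) (W \<inter> ball 0 r)"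
    using r by (subst lborel_affine[of r "0::real^3"]) auto
  also have "\<dots> = ennreal (r ^ 3) * emeasure lborel ((\<lambda>x. r *\<^sub>R x) -` (W \<inter> ball 0 r))"
    using r by (subst emeasure_density) (auto simp: nn_integral_cmult_indicator emeasure_distr)
  also have "(\<lambda>x. r *\<^sub>R x) -` (W \<inter> ball 0 r) = W \<inter> ball 0 1"
    using r by (auto simp: W_scaleR)
  finally show ?thesis using r om_pos by (simp add: emeasure_W_ball1 ennreal_mult'[symmetric] mult.commute)
qed simp

text \<open>The density is the derivative of \<open>om * r ^ 3\<close>, the volume of a ball in
  \<open>W\<close> about the apex. This is the law of the distance to the apex in flat
  coordinates.\<close>

definition "rad = density lborel (\<lambda>r. ennreal (indicator {0<..} r * (3 * om * r\<^sup>2)))"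

lemma emeasure_rad_lessThan:
  assumes "r \<ge> 0"
  shows "emeasure rad {..<r} = ennreal (om * r ^ 3)"
proof -
  have "emeasure rad {..<r} = (\<integral>\<^sup>+x. ennreal (indicator {0<..} x * (3 * om * x\<^sup>2)) * indicator {..<r} x \<partial>lborel)"
    unfolding rad_def by (subst emeasure_density) auto
  also have "\<dots> = (\<integral>\<^sup>+x. ennreal (3 * om * x\<^sup>2) * indicator {0..r} x \<partial>lborel)"
  proof (rule nn_integral_cong_AE)
    show "AE x in lborel. ennreal (indicator {0<..} x * (3 * om * x\<^sup>2)) * indicator {..<r} x = ennreal (3 * om * x\<^sup>2) * indicator {0..r} x"
      using AE_lborel_singleton[of 0] AE_lborel_singleton[of r]
      by eventually_elim (auto simp: indicator_def)
  qed
  also have "\<dots> = ennreal (om * r ^ 3 - om * 0 ^ 3)"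
    using om_pos assms by (intro nn_integral_FTC_Icc) (auto intro!: derivative_eq_intros)
  finally show ?thesis by simp
qed

lemma measure_eqI_nonneg_lessThan:
  fixes M N :: "real measure"
  assumes sets: "sets M = sets borel" "sets N = sets borel"
    and fin: "\<And>r. r \<ge> 0 \<Longrightarrow> emeasure M {..<r} \<noteq> \<infinity>"
    and eq: "\<And>r. r \<ge> 0 \<Longrightarrow> emeasure M {..<r} = emeasure N {..<r}"
    and neg: "emeasure M {..<0} = 0" "emeasure N {..<0} = 0"
  shows "M = N"
proof (rule measure_eqI_generator_eq_countable)
  let ?E = "range (lessThan :: real \<Rightarrow> real set)"
  show "Int_stable ?E"
  proof -
    have "{..<a} \<inter> {..<b} = {..<min a b}" for a b :: real by auto
    then show ?thesis by (auto simp: Int_stable_def)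
  qed
  show "?E \<subseteq> Pow UNIV" "sets M = sigma_sets UNIV ?E" "sets N = sigma_sets UNIV ?E"
    unfolding sets borel_Iio by auto
  show "emeasure M X = emeasure N X" if "X \<in> ?E" for X
  proof -
    from that obtain r where X: "X = {..<r}" by blast
    show ?thesis
    proof (cases "r \<ge> 0")
      case False
      then have "X \<subseteq> {..<0}" by (auto simp: X)
      then have "emeasure M X \<le> emeasure M {..<0}" "emeasure N X \<le> emeasure N {..<0}"
        using sets by (auto intro!: emeasure_mono)
      then show ?thesis using neg by simp
    qed (use eq X in auto)
  qed
  show "lessThan ` range real \<subseteq> ?E" "countable (lessThan ` range real)" by auto
  show "\<Union>(lessThan ` range real) = UNIV" using reals_Archimedean2 by auto
  show "\<And>a. a \<in> lessThan ` range real \<Longrightarrow> emeasure M a \<noteq> \<infinity>" using fin by auto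
qed

abbreviation "rho z \<equiv> gauge \<alpha> z / (\<alpha> + 1)"

lemma distr_radial: "distr mS borel (\<lambda>z. rho z) = rad"
proof (rule measure_eqI_nonneg_lessThan)
  have 1: "emeasure (distr mS borel (\<lambda>z. rho z)) {..<r} = emeasure lborel (W \<inter> ball 0 r)" for r
  proof -
    have "emeasure (distr mS borel (\<lambda>z. rho z)) {..<r} = (\<integral>\<^sup>+z. indicator {..<r} (rho z) \<partial>mS)"
      by (subst emeasure_distr) (auto simp: mS_def nn_integral_indicator[symmetric] vimage_def simp del: nn_integral_indicator intro!: nn_integral_cong split: split_indicator)
    also have "\<dots> = (\<integral>\<^sup>+z. indicator {..<r} (norm (flatS z)) \<partial>mS)"
      using AE_mS_S by (intro nn_integral_cong_AE) (auto elim!: eventually_mono simp: flatS_def norm_flat)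
    also have "\<dots> = (\<integral>\<^sup>+p. indicator W p * indicator {..<r} (norm p) \<partial>lborel)"
      by (subst nn_integral_flat[where F = "\<lambda>p. indicator {..<r} (norm p)"]) auto
    also have "\<dots> = (\<integral>\<^sup>+p. indicator (W \<inter> ball 0 r) p \<partial>lborel)"
      by (intro nn_integral_cong) (auto simp: indicator_def)
    finally show ?thesis by simp
  qed
  show "emeasure (distr mS borel (\<lambda>z. rho z)) {..<r} \<noteq> \<infinity>" if "r \<ge> 0" for r
    using emeasure_W_ball[OF that] by (simp add: 1)
  show "emeasure (distr mS borel (\<lambda>z. rho z)) {..<r} = emeasure rad {..<r}" if "r \<ge> 0" for r
    using emeasure_W_ball[OF that] emeasure_rad_lessThan[OF that] by (simp add: 1)
  show "emeasure (distr mS borel (\<lambda>z. rho z)) {..<0} = 0" "emeasure rad {..<0} = 0"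
    using emeasure_rad_lessThan[of 0] emeasure_W_ball[of 0] by (auto simp: 1)
qed (auto simp: rad_def)

lemma nn_integral_radial:
  assumes [measurable]: "F \<in> borel_measurable borel"
  shows "(\<integral>\<^sup>+z. F (rho z) \<partial>mS) = (\<integral>\<^sup>+r. F r \<partial>rad)"
  unfolding distr_radial[symmetric] by (subst nn_integral_distr) (auto simp: mS_def)

text \<open>A convex cone is closed under addition, so enlarging \<open>A\<close> by a piece of the
  cone never leaves \<open>W\<close> and the sides of the wedge contribute no boundary.
  Brunn-Minkowski bounds the cube root of the enlarged volume below by that of \<open>A\<close> plus
  \<open>root 3 om * t\<close>; cubing and dropping the terms of order t^2 and t^3 leaves the linear
  term.\<close>

lemma wedge_isoperimetric:
  assumes A: "open A" "bounded A" "A \<subseteq> W" and t: "t > 0"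
  shows "A + W \<inter> ball 0 t \<subseteq> W"
    and "ennreal (t * (3 * root 3 om * (root 3 (measure lborel A))\<^sup>2)) \<le> emeasure lborel ((A + W \<inter> ball 0 t) - A)"
proof -
  let ?K = "W \<inter> ball 0 t"
  show sub: "A + ?K \<subseteq> W" using A(3) W_add by (force simp: set_plus_def)
  have K: "open ?K" "bounded ?K" using open_W by (auto simp: bounded_Int)
  have mK: "measure lborel ?K = om * t ^ 3"
    using emeasure_W_ball[of t] t om_pos by (simp add: measure_def)
  have oAK: "open (A + ?K)" and bAK: "bounded (A + ?K)"
    using open_set_plus[OF A(1)] bounded_set_plus[OF A(2) K(2)] by auto
  show "ennreal (t * (3 * root 3 om * (root 3 (measure lborel A))\<^sup>2)) \<le> emeasure lborel ((A + ?K) - A)"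
  proof (cases "A = {}")
    case False
    let ?a = "root 3 (measure lborel A)" and ?o = "root 3 om"
    have Kne: "?K \<noteq> {}" using mK om_pos t by (metis measure_empty mult_pos_pos less_irrefl zero_less_power)
    have a0: "?a \<ge> 0" "?o \<ge> 0" using om_pos by (auto simp: real_root_ge_zero)
    have "root 3 (measure lborel A) + root 3 (measure lborel ?K) \<le> root 3 (measure lborel (A + ?K))"
      using brunn_minkowski_open[OF A(1,2) False K Kne] A K oAK by simp
    then have "?a + ?o * t \<le> root 3 (measure lborel (A + ?K))"
      using t by (simp add: mK real_root_mult real_root_power_cancel)
    then have "(?a + ?o * t) ^ 3 \<le> root 3 (measure lborel (A + ?K)) ^ 3"
      using a0 t by (intro power_mono) auto
    then have "(?a + ?o * t) ^ 3 \<le> measure lborel (A + ?K)" by simp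
    moreover have "(?a + ?o * t) ^ 3 = measure lborel A + 3 * ?a\<^sup>2 * (?o * t) + 3 * ?a * (?o * t)\<^sup>2 + (?o * t) ^ 3"
    proof -
      have "(x + y) ^ 3 = x ^ 3 + 3 * x\<^sup>2 * y + 3 * x * y\<^sup>2 + y ^ 3" for x y :: real
        by (simp add: power3_eq_cube power2_eq_square algebra_simps)
      then show ?thesis by simp
    qed
    moreover have "3 * ?a * (?o * t)\<^sup>2 + (?o * t) ^ 3 \<ge> 0" using a0 t by simp
    ultimately have "t * (3 * ?o * ?a\<^sup>2) \<le> measure lborel (A + ?K) - measure lborel A"
      by (simp add: algebra_simps)
    then have "ennreal (t * (3 * ?o * ?a\<^sup>2)) \<le> ennreal (measure lborel (A + ?K) - measure lborel A)"
      by (rule ennreal_leI)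
    also have "\<dots> = emeasure lborel (A + ?K) - emeasure lborel A"
      using emeasure_bounded_finite[OF bAK] emeasure_bounded_finite[OF A(2)]
      by (simp add: emeasure_eq_ennreal_measure ennreal_minus)
    also have "\<dots> \<le> emeasure lborel ((A + ?K) - A)"
    proof -
      have "emeasure lborel (A + ?K) \<le> emeasure lborel (((A + ?K) - A) \<union> A)"
        using A oAK by (intro emeasure_mono) auto
      also have "\<dots> \<le> emeasure lborel ((A + ?K) - A) + emeasure lborel A"
        using A oAK by (intro emeasure_subadditive) auto
      finally show ?thesis
        using emeasure_bounded_finite[OF A(2)] by (auto simp: ennreal_minus_le_iff add.commute less_top)
    qed
    finally show ?thesis .
  qed simp
qed

end

section \<open>The coarea inequality\<close>

lemma borel_measurable_antimono:
  fixes g :: "real \<Rightarrow> 'b::{second_countable_topology, linorder_topology}"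
  assumes "antimono g"
  shows "g \<in> borel_measurable borel"
proof (rule borel_measurableI_greater)
  fix y
  have "is_interval {x. y < g x}"
    unfolding is_interval_1 using antimonoD[OF assms] by (auto intro: less_le_trans)
  then show "{x \<in> space borel. y < g x} \<in> sets borel" using real_interval_borel_measurable by simp
qed

lemma borel_measurable_vec_nth_comp [measurable]:
  fixes f :: "'b \<Rightarrow> real^'n"
  shows "f \<in> borel_measurable M \<Longrightarrow> (\<lambda>x. f x $ i) \<in> borel_measurable M"
  by (rule measurable_compose[of f M borel]) (auto intro!: borel_measurable_continuous_onI continuous_intros)

lemma borel_measurable_hor [measurable]: "hor \<in> borel_measurable borel"
  by (intro borel_measurable_continuous_onI continuous_intros)

lemma borel_measurable_root [measurable]:
  "f \<in> borel_measurable M \<Longrightarrow> (\<lambda>x. root n (f x)) \<in> borel_measurable M"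
  by (rule measurable_compose[of f M borel]) (auto intro!: borel_measurable_continuous_onI continuous_intros)

context grushin
begin

definition gnorm :: "(real^3 \<Rightarrow> real^3) \<Rightarrow> real^3 \<Rightarrow> real" where
  "gnorm D z = sqrt (grushin_sq \<alpha> z (D z $ 1) (D z $ 2) (D z $ 3))"

lemma grushin_sq_nonneg: "grushin_sq \<alpha> z a b c \<ge> 0"
  by (simp add: grushin_sq_def)

lemma borel_measurable_gnorm [measurable]:
  assumes [measurable]: "D \<in> borel_measurable borel"
  shows "gnorm D \<in> borel_measurable borel"
  unfolding gnorm_def[abs_def] grushin_sq_def by measurable

lemma gnorm_nonneg: "gnorm D z \<ge> 0"
  by (simp add: gnorm_def grushin_sq_nonneg)

lemma gnorm_sq: "(gnorm D z)\<^sup>2 = grushin_sq \<alpha> z (D z $ 1) (D z $ 2) (D z $ 3)"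
  by (simp add: gnorm_def grushin_sq_nonneg)

text \<open>The derivative of \<open>unflat\<close> acts horizontally as multiplication by
  \<open>c\<close> with modulus |x|^(-\<alpha>); its transpose is multiplication by
  \<open>cnj c\<close>, whence \<open>v\<close>. The vertical component fits the same factor because
  \<open>wt z\<close> times the square of \<open>cmod c\<close> is 1.\<close>

lemma has_derivative_comp_unflat:
  assumes der: "(f has_derivative (\<lambda>h. D z \<bullet> h)) (at z)" and z: "z \<in> S"
  obtains v where "((\<lambda>p. f (unflat \<alpha> p)) has_derivative (\<lambda>h. v \<bullet> h)) (at (flat \<alpha> z))"
    "norm v = gnorm D z * cmod (hor z) powr (- \<alpha>)"
proof
  let ?p = "flat \<alpha> z"
  have p: "?p \<in> W" "unflat \<alpha> ?p = z" using z by (auto simp: flat_in_W unflat_flat)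
  define c where "c = (of_real (\<alpha> + 1) * hor ?p) powr of_real (1 / (\<alpha> + 1) - 1)"
  have c: "cmod c = cmod (hor z) powr (- \<alpha>)" unfolding c_def cmod_unflat_coeff[OF p(1)] p(2) ..
  define v where "v = pt (hor (D z) * cnj c) (D z $ 3)"
  have "((\<lambda>p. f (unflat \<alpha> p)) has_derivative (\<lambda>h. D z \<bullet> pt (c * hor h) (h$3))) (at ?p)"
    using has_derivative_compose[OF has_derivative_unflat[OF p(1), folded c_def], of f "\<lambda>h. D z \<bullet> h"] der p(2) by simp
  moreover have "D z \<bullet> pt (c * hor h) (h$3) = v \<bullet> h" for h
    by (simp add: v_def inner_vec_def sum_3 hor_def algebra_simps)
  ultimately show "((\<lambda>p. f (unflat \<alpha> p)) has_derivative (\<lambda>h. v \<bullet> h)) (at ?p)" by simp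
  have r0: "cmod (hor z) > 0" using hor_S_nonzero(1)[OF z] by simp
  have wt: "wt z = (cmod (hor z) powr \<alpha>)\<^sup>2" by (simp add: xnorm2_hor power2_eq_square powr_mult)
  have c1: "cmod (hor z) powr \<alpha> * cmod c = 1" using r0 by (simp add: c powr_minus)
  have "(norm v)\<^sup>2 = (cmod (hor (D z)))\<^sup>2 * (cmod c)\<^sup>2 + (D z $ 3)\<^sup>2"
    by (simp add: norm_3 v_def norm_mult power_mult_distrib)
  also have "\<dots> = ((cmod (hor (D z)))\<^sup>2 + wt z * (D z $ 3)\<^sup>2) * (cmod c)\<^sup>2"
  proof -
    have "wt z * (cmod c)\<^sup>2 = 1" unfolding wt power_mult_distrib[symmetric] c1 by simp
    moreover have "(x + wt z * y) * (cmod c)\<^sup>2 = x * (cmod c)\<^sup>2 + (wt z * (cmod c)\<^sup>2) * y" for x y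
      by (simp add: algebra_simps)
    ultimately show ?thesis by simp
  qed
  also have "\<dots> = (gnorm D z * cmod c)\<^sup>2"
    by (simp add: power_mult_distrib gnorm_sq grushin_sq_def hor_def cmod_power2)
  finally show "norm v = gnorm D z * cmod (hor z) powr (- \<alpha>)"
    unfolding c[symmetric] by (rule power2_eq_imp_eq) (auto simp: gnorm_nonneg)
qed

lemma comp_unflat_local_bound:
  assumes der: "(f has_derivative (\<lambda>h. D z \<bullet> h)) (at z)" and z: "z \<in> S" and e: "e > 0"
  obtains d where "d > 0" "\<And>p. norm (flat \<alpha> z - p) < d \<Longrightarrow>
     f (unflat \<alpha> p) \<le> f z + (gnorm D z * cmod (hor z) powr (- \<alpha>) + e) * norm (flat \<alpha> z - p)"
proof -
  obtain v where v: "((\<lambda>p. f (unflat \<alpha> p)) has_derivative (\<lambda>h. v \<bullet> h)) (at (flat \<alpha> z))"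
    "norm v = gnorm D z * cmod (hor z) powr (- \<alpha>)"
    using has_derivative_comp_unflat[of f D z, OF der z] by blast
  obtain d where d: "d > 0" "\<And>p. norm (p - flat \<alpha> z) < d \<Longrightarrow>
     norm (f (unflat \<alpha> p) - f (unflat \<alpha> (flat \<alpha> z)) - v \<bullet> (p - flat \<alpha> z)) \<le> e * norm (p - flat \<alpha> z)"
    using v(1) e unfolding has_derivative_at_alt by blast
  show thesis
  proof
    fix p assume "norm (flat \<alpha> z - p) < d"
    then have "norm (f (unflat \<alpha> p) - f z - v \<bullet> (p - flat \<alpha> z)) \<le> e * norm (p - flat \<alpha> z)"
      using d(2)[of p] by (simp add: unflat_flat[OF z] norm_minus_commute)
    moreover have "v \<bullet> (p - flat \<alpha> z) \<le> norm v * norm (p - flat \<alpha> z)" by (rule norm_cauchy_schwarz)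
    ultimately show "f (unflat \<alpha> p) \<le> f z + (gnorm D z * cmod (hor z) powr (- \<alpha>) + e) * norm (flat \<alpha> z - p)"
      by (simp add: v(2) norm_minus_commute algebra_simps)
  qed (rule d(1))
qed

lemma norm_flat_le:
  assumes "norm z \<le> R"
  shows "norm (flat \<alpha> z) \<le> R powr (\<alpha> + 1) + R"
proof -
  have "cmod (hor z) \<le> R" using norm_hor_le[of z] assms by linarith
  then have "cmod (hor z) powr (\<alpha> + 1) \<le> R powr (\<alpha> + 1)" using alpha_pos by (intro powr_mono2) auto
  moreover have "cmod (hor z) powr (\<alpha> + 1) / (\<alpha> + 1) \<le> cmod (hor z) powr (\<alpha> + 1)"
    using alpha_pos divide_left_mono[of 1 "\<alpha> + 1" "cmod (hor z) powr (\<alpha> + 1)"] by simp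
  moreover have "\<bar>z $ 3\<bar> \<le> R" using component_le_norm_cart[of z 3] assms by linarith
  moreover have "flat \<alpha> z $ 3 = z $ 3" by (simp add: flat_def)
  ultimately show ?thesis using norm_le_hor[of "flat \<alpha> z"] by (simp add: norm_hor_flat)
qed

text \<open>A crude growth bound: it turns a bounded region in flat coordinates into a bounded
  region in the original ones, on which the dominating function of the coarea argument is
  supported.\<close>

lemma norm_le_flat: "norm z \<le> 1 + (\<alpha> + 2) * norm (flat \<alpha> z)"
proof -
  let ?r = "cmod (hor z)"
  have "?r \<le> 1 + ?r powr (\<alpha> + 1)"
  proof (cases "?r \<le> 1")
    case False
    then have "?r powr 1 \<le> ?r powr (\<alpha> + 1)" using alpha_pos by (intro powr_mono) auto
    then show ?thesis using False by simp
  qed (metis add_increasing2 powr_ge_zero)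
  moreover have "?r powr (\<alpha> + 1) = (\<alpha> + 1) * cmod (hor (flat \<alpha> z))" using alpha_pos by (simp add: norm_hor_flat)
  moreover have "(\<alpha> + 1) * cmod (hor (flat \<alpha> z)) \<le> (\<alpha> + 1) * norm (flat \<alpha> z)"
    using alpha_pos by (intro mult_left_mono norm_hor_le) auto
  moreover have "\<bar>z $ 3\<bar> \<le> norm (flat \<alpha> z)" using component_le_norm_cart[of "flat \<alpha> z" 3] by (simp add: flat_def)
  ultimately show ?thesis using norm_le_hor[of z] by (simp add: algebra_simps)
qed

text \<open>Integrating the Minkowski content lower bound \<open>wedge_isoperimetric\<close> over the levels
  \<open>s \<in> C\<close> and exchanging the order of integration bounds the left-hand side by the integral of
  \<open>1/t\<close> times the length of the set of \<open>s \<in> C\<close> between \<open>f\<close> and its supremum over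
  a \<open>t\<close>-neighbourhood in flat coordinates; then \<open>t\<close> tends to \<open>0\<close>.\<close>

lemma coarea_wedge:
  fixes f :: "real^3 \<Rightarrow> real" and D :: "real^3 \<Rightarrow> real^3"
  assumes der: "\<And>z. (f has_derivative (\<lambda>h. D z \<bullet> h)) (at z)"
    and D[measurable]: "D \<in> borel_measurable borel"
    and lip: "\<And>x y. \<bar>f x - f y\<bar> \<le> L * norm (x - y)"
    and supp: "\<And>z. norm z > R \<Longrightarrow> f z = 0" and R: "R > 0"
    and C: "compact C" "C \<subseteq> {0<..}"
  shows "(\<integral>\<^sup>+s. ennreal (3 * root 3 om * (root 3 (measure mS {z. s < f z}))\<^sup>2) * indicator C s \<partial>lborel)
     \<le> (\<integral>\<^sup>+z. ennreal (gnorm D z * cmod (hor z) powr (- \<alpha>)) * indicator {z. f z \<in> C} z \<partial>mS)"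
proof -
  have "0 \<le> L * norm (axis 1 1 - 0 :: real^3)" using lip[of "axis 1 1" 0] by linarith
  then have L0: "L \<ge> 0" by (simp add: norm_axis_1)
  have fcont: "continuous_on A f" for A
    by (intro continuous_at_imp_continuous_on ballI has_derivative_continuous[OF der])
  have f[measurable]: "f \<in> borel_measurable borel" by (intro borel_measurable_continuous_onI fcont)
  have kmeas: "(\<lambda>s. ennreal (3 * root 3 om * (root 3 (measure mS {z. s < f z}))\<^sup>2) * indicator C s) \<in> borel_measurable lborel"
  proof -
    have "antimono (\<lambda>s. emeasure mS {z. s < f z})"
      by (intro antimonoI emeasure_mono) (auto simp: mS_def)
    note [measurable] = borel_measurable_antimono[OF this]
    have "C \<in> sets borel" using C by (simp add: borel_compact)
    then show ?thesis unfolding measure_def by measurable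
  qed
  define k where "k s = 3 * root 3 om * (root 3 (measure mS {z. s < f z}))\<^sup>2" for s
  have Cb[measurable]: "C \<in> sets borel" using C by (simp add: borel_compact)
  define U where "U p = f (unflat \<alpha> p)" for p
  have Ucont: "continuous_on W U"
    unfolding U_def by (rule continuous_on_compose2[OF fcont continuous_on_unflat, of UNIV]) auto
  \<comment> \<open>The open subgraph of \<open>U\<close>. Its translates are open too, so their
    uncountable union is still open and the set \<open>E t\<close> built from it is Borel.\<close>
  define O0 where "O0 = {q :: (real^3) \<times> real. fst q \<in> W \<and> snd q < U (fst q)}"
  have O0: "open O0"
  proof -
    have "O0 = W \<times> UNIV \<inter> (\<lambda>q. U (fst q) - snd q) -` {0<..}"
      by (auto simp: O0_def)
    moreover have "open \<dots>"
      by (rule continuous_open_preimage)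
         (auto intro!: continuous_intros continuous_on_compose2[OF Ucont] open_Times open_W)
    ultimately show ?thesis by simp
  qed
  define Kt where "Kt t = W \<inter> ball 0 t" for t :: real
  define O1 where "O1 t = (\<Union>h\<in>Kt t. (\<lambda>q. (fst q + h, snd q)) ` O0)" for t
  have O1: "open (O1 t)" for t
  proof -
    have "(\<lambda>q. (fst q + h, snd q)) ` O0 = (+) (h, 0) ` O0" for h
      by (intro image_cong) (auto simp: plus_prod_def)
    then show ?thesis unfolding O1_def using open_translation[OF O0] by auto
  qed
  \<comment> \<open>The section of \<open>E t\<close> at a level \<open>s\<close> in
    \<open>C\<close> is the shell gained by enlarging the superlevel set \<open>A s\<close>; the
    section at a point \<open>p\<close> consists of the levels in \<open>C\<close> that are at least
    \<open>U p\<close> but are exceeded by \<open>U\<close> at some point \<open>p'\<close> of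
    \<open>W\<close> with \<open>p - p'\<close> in \<open>Kt t\<close>.\<close>
  define E where "E t = ((W \<times> C) - O0) \<inter> O1 t" for t
  have E[measurable]: "E t \<in> sets (lborel \<Otimes>\<^sub>M lborel)" for t
  proof -
    have "W \<times> C \<in> sets borel" using Cb open_W by (intro borel_Times) auto
    then have "E t \<in> sets borel" unfolding E_def using O0 O1[of t] by auto
    then show ?thesis by (metis lborel_prod sets_lborel)
  qed
  have mem_E: "(p, s) \<in> E t \<longleftrightarrow> p \<in> W \<and> s \<in> C \<and> U p \<le> s \<and> (\<exists>p'\<in>W. s < U p' \<and> p - p' \<in> Kt t)" for p s t
  proof -
    have "(p, s) \<in> O1 t \<longleftrightarrow> (\<exists>p'\<in>W. s < U p' \<and> p - p' \<in> Kt t)"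
    proof
      assume "(p, s) \<in> O1 t"
      then obtain h p' where "h \<in> Kt t" "p' \<in> W" "s < U p'" "p = p' + h" by (auto simp: O1_def O0_def)
      then show "\<exists>p'\<in>W. s < U p' \<and> p - p' \<in> Kt t" by (intro bexI[of _ p']) auto
    next
      assume "\<exists>p'\<in>W. s < U p' \<and> p - p' \<in> Kt t"
      then obtain p' where "p' \<in> W" "s < U p'" "p - p' \<in> Kt t" by blast
      then show "(p, s) \<in> O1 t"
        unfolding O1_def by (intro UN_I[of "p - p'"] image_eqI[of _ _ "(p', s)"]) (auto simp: O0_def)
    qed
    then show ?thesis unfolding E_def O0_def by auto
  qed
  obtain c where c: "c > 0" "\<And>s. s \<in> C \<Longrightarrow> c \<le> s"
  proof (cases "C = {}")
    case False
    then obtain c where "c \<in> C" "\<forall>s\<in>C. c \<le> s" using compact_attains_inf[OF C(1)] by blast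
    then show thesis using C(2) that by auto
  qed (use that[of 1] in auto)
  define R1 where "R1 = R powr (\<alpha> + 1) + R"
  have bd: "norm p \<le> R1" if "p \<in> W" "0 < U p" for p
  proof -
    have "norm (unflat \<alpha> p) \<le> R" using supp[of "unflat \<alpha> p"] that by (force simp: U_def)
    then show ?thesis using norm_flat_le[of "unflat \<alpha> p" R] that by (simp add: flat_unflat R1_def)
  qed
  define A where "A s = {p \<in> W. s < U p}" for s
  have A: "open (A s)" "A s \<subseteq> W" for s
  proof -
    have "A s = W \<inter> U -` {s<..}" by (auto simp: A_def)
    moreover have "open \<dots>" by (rule continuous_open_preimage[OF Ucont open_W]) auto
    ultimately show "open (A s)" by simp
  qed (auto simp: A_def)
  have Ab: "bounded (A s)" if "s \<in> C" for s
    unfolding bounded_iff using bd c that by (auto simp: A_def intro!: exI[of _ R1]) (meson less_le_trans less_trans order_le_less_trans)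
  have mA: "measure lborel (A s) = measure mS {z. s < f z}" for s
  proof -
    have [measurable]: "A s \<in> sets borel" using A by auto
    have "emeasure mS {z. s < f z} = (\<integral>\<^sup>+z. indicator {z. s < f z} z \<partial>mS)" by (simp add: mS_def)
    also have "\<dots> = (\<integral>\<^sup>+z. indicator (A s) (flatS z) \<partial>mS)"
      using AE_mS_S by (intro nn_integral_cong_AE) (auto elim!: eventually_mono simp: flatS_def A_def U_def unflat_flat flat_in_W split: split_indicator)
    also have "\<dots> = (\<integral>\<^sup>+p. indicator W p * indicator (A s) p \<partial>lborel)" by (rule nn_integral_flat) measurable
    also have "\<dots> = (\<integral>\<^sup>+p. indicator (A s) p \<partial>lborel)"
      using A(2) by (intro nn_integral_cong) (auto simp: indicator_def)
    finally show ?thesis by (simp add: measure_def)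
  qed
  define d where "d t p = emeasure lborel (Pair p -` E t)" for t p
  have dm[measurable]: "d t \<in> borel_measurable borel" for t
    using lborel.measurable_emeasure_Pair[OF E[of t]] unfolding d_def[abs_def] by simp
  have iso: "ennreal t * (\<integral>\<^sup>+s. ennreal (k s) * indicator C s \<partial>lborel) \<le> (\<integral>\<^sup>+z. d t (flatS z) \<partial>mS)" if t: "t > 0" for t
  proof -
    have "emeasure (lborel \<Otimes>\<^sub>M lborel) (E t) = (\<integral>\<^sup>+s. emeasure lborel ((\<lambda>p. (p, s)) -` E t) \<partial>lborel)"
      by (rule lborel_pair.emeasure_pair_measure_alt2[OF E])
    moreover have "ennreal t * (ennreal (k s) * indicator C s) \<le> emeasure lborel ((\<lambda>p. (p, s)) -` E t)" for s
    proof (cases "s \<in> C")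
      case True
      have "(\<lambda>p. (p, s)) -` E t = (A s + Kt t) - A s"
      proof (intro set_eqI iffI)
        fix p assume "p \<in> (\<lambda>p. (p, s)) -` E t"
        then obtain p' where "p \<in> W" "U p \<le> s" "p' \<in> W" "s < U p'" "p - p' \<in> Kt t" by (auto simp: mem_E)
        then show "p \<in> (A s + Kt t) - A s"
          using set_plus_intro[of p' "A s" "p - p'" "Kt t"] by (auto simp: A_def)
      next
        fix p assume p: "p \<in> (A s + Kt t) - A s"
        then obtain p' h where h: "p = p' + h" "p' \<in> A s" "h \<in> Kt t" by (auto simp: set_plus_def)
        then have "p \<in> W" using W_add by (auto simp: A_def Kt_def)
        moreover have "p - p' \<in> Kt t" using h by simp
        ultimately show "p \<in> (\<lambda>p. (p, s)) -` E t" using p h True by (auto simp: mem_E A_def)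
      qed
      then show ?thesis
        using wedge_isoperimetric(2)[OF A(1) Ab[OF True] A(2) t] True t om_pos
        by (simp add: Kt_def k_def mA ennreal_mult' mult.commute)
    qed simp
    moreover have "emeasure (lborel \<Otimes>\<^sub>M lborel) (E t) = (\<integral>\<^sup>+p. d t p \<partial>lborel)"
      unfolding d_def by (rule lborel.emeasure_pair_measure_alt[OF E])
    moreover have "(\<integral>\<^sup>+p. d t p \<partial>lborel) = (\<integral>\<^sup>+p. indicator W p * d t p \<partial>lborel)"
    proof (intro nn_integral_cong)
      fix p have "Pair p -` E t = {}" if "p \<notin> W" using that by (auto simp: mem_E)
      then show "d t p = indicator W p * d t p" by (cases "p \<in> W") (auto simp: d_def)
    qed
    moreover have "(\<integral>\<^sup>+p. indicator W p * d t p \<partial>lborel) = (\<integral>\<^sup>+z. d t (flatS z) \<partial>mS)"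
      by (rule nn_integral_flat[symmetric]) measurable
    moreover have "ennreal t * (\<integral>\<^sup>+s. ennreal (k s) * indicator C s \<partial>lborel) = (\<integral>\<^sup>+s. ennreal t * (ennreal (k s) * indicator C s) \<partial>lborel)"
      by (rule nn_integral_cmult[symmetric, OF kmeas[folded k_def]])
    ultimately show ?thesis by (simp add: nn_integral_mono)
  qed
  define Q where "Q = (2 + 5 * (\<alpha> + 1))"
  define R2 where "R2 = 1 + (\<alpha> + 2) * (R1 + 1)"
  have Q: "Q > 0" using alpha_pos by (simp add: Q_def)
  have R1: "R1 > 0" using R by (simp add: R1_def add_nonneg_pos)
  have R2: "R2 > 0" using R1 alpha_pos by (simp add: R2_def add_pos_pos)
  \<comment> \<open>A bound linear in \<open>t\<close> with a constant independent of
    \<open>z\<close>. A nonempty section puts \<open>flat \<alpha> z\<close> within distance 1 of a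
    point of norm at most \<open>R1\<close>, so \<open>z\<close> lies in the ball of radius
    \<open>R2\<close>. By \<open>hor_dist_le\<close> the competing points have preimages within
    \<open>t * (Q * r powr (- \<alpha>) + 1)\<close> of \<open>z\<close>, and the Lipschitz bound
    converts this into a length of levels. The weight r^(2 \<alpha>) absorbs the negative
    power.\<close>
  have bound: "d t (flatS z) * ennreal (wt z) \<le> ennreal (t * (L * (Q * R2 powr \<alpha> + (R2 powr \<alpha>)\<^sup>2))) * indicator (ball 0 (R2 + 1)) z"
    if z: "z \<in> S" and t: "0 < t" "t \<le> 1" for z t
  proof (cases "d t (flatS z) = 0")
    case False
    have fz: "flatS z = flat \<alpha> z" "flat \<alpha> z \<in> W" "U (flat \<alpha> z) = f z"
      using z by (auto simp: flatS_def flat_in_W U_def unflat_flat)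
    define r where "r = cmod (hor z)"
    have r: "r > 0" using hor_S_nonzero(1)[OF z] by (simp add: r_def)
    have wtr: "wt z = (r powr \<alpha>)\<^sup>2" by (simp add: r_def xnorm2_hor power2_eq_square powr_mult)
    have "Pair (flat \<alpha> z) -` E t \<noteq> {}" using False unfolding d_def fz by force
    then obtain s0 where "(flat \<alpha> z, s0) \<in> E t" by blast
    then obtain p' where p': "p' \<in> W" "s0 < U p'" "flat \<alpha> z - p' \<in> Kt t" "s0 \<in> C" by (auto simp: mem_E)
    then have "norm p' \<le> R1" using bd[of p'] c(2)[of s0] c(1) by simp
    moreover have "norm (flat \<alpha> z - p') < t" using p'(3) by (simp add: Kt_def)
    ultimately have "norm (flat \<alpha> z) \<le> R1 + 1" using t norm_triangle_sub[of "flat \<alpha> z" p'] by linarith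
    then have "(\<alpha> + 2) * norm (flat \<alpha> z) \<le> (\<alpha> + 2) * (R1 + 1)" using alpha_pos by (intro mult_left_mono) auto
    then have zR: "norm z \<le> R2" using norm_le_flat[of z] by (simp add: R2_def)
    have rR: "r \<le> R2" using zR norm_hor_le[of z] by (simp add: r_def)
    have "Pair (flat \<alpha> z) -` E t \<subseteq> {f z .. f z + L * (t * (Q * r powr (- \<alpha>) + 1))}"
    proof
      fix s assume "s \<in> Pair (flat \<alpha> z) -` E t"
      then have "(flat \<alpha> z, s) \<in> E t" by simp
      then obtain q where q: "f z \<le> s" "q \<in> W" "s < U q" "flat \<alpha> z - q \<in> Kt t" unfolding mem_E fz by blast
      define z' where "z' = unflat \<alpha> q"
      have z': "z' \<in> S" "flat \<alpha> z' = q" using q(2) by (auto simp: z'_def unflat_in_S flat_unflat)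
      have nq: "norm (flat \<alpha> z - q) \<le> t" using q(4) by (simp add: Kt_def)
      have "cmod (hor z - hor z') * r powr \<alpha> \<le> Q * cmod (hor (flat \<alpha> z) - hor q)"
        using hor_dist_le[OF z z'(1)] by (simp add: r_def Q_def z'(2))
      also have "\<dots> \<le> Q * t" using Q norm_hor_le[of "flat \<alpha> z - q"] nq by (intro mult_left_mono) (auto simp: hor_diff)
      finally have "cmod (hor z - hor z') * r powr \<alpha> * r powr (- \<alpha>) \<le> Q * t * r powr (- \<alpha>)" by (intro mult_right_mono) auto
      moreover have "r powr \<alpha> * r powr (- \<alpha>) = 1" using r by (simp add: powr_minus)
      ultimately have h1: "cmod (hor z - hor z') \<le> Q * t * r powr (- \<alpha>)" by (simp add: mult.assoc)
      have "\<bar>(z - z') $ 3\<bar> = \<bar>(flat \<alpha> z - q) $ 3\<bar>" unfolding z'(2)[symmetric] by (simp add: flat_def)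
      then have h2: "\<bar>(z - z') $ 3\<bar> \<le> t" using component_le_norm_cart[of "flat \<alpha> z - q" 3] nq by simp
      have "norm (z - z') \<le> t * (Q * r powr (- \<alpha>) + 1)"
        using norm_le_hor[of "z - z'"] h1 h2 by (simp add: hor_diff algebra_simps)
      then have "L * norm (z - z') \<le> L * (t * (Q * r powr (- \<alpha>) + 1))" using L0 by (rule mult_left_mono)
      then show "s \<in> {f z .. f z + L * (t * (Q * r powr (- \<alpha>) + 1))}"
        using q(1,3) lip[of z z'] by (auto simp: U_def z'_def[symmetric])
    qed
    then have "d t (flatS z) \<le> emeasure lborel {f z .. f z + L * (t * (Q * r powr (- \<alpha>) + 1))}"
      unfolding d_def fz by (rule emeasure_mono) simp
    also have "\<dots> = ennreal (L * (t * (Q * r powr (- \<alpha>) + 1)))"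
      using L0 t Q by (subst emeasure_lborel_Icc) auto
    finally have "d t (flatS z) * ennreal (wt z) \<le> ennreal (L * (t * (Q * r powr (- \<alpha>) + 1))) * ennreal (wt z)"
      by (rule mult_right_mono) simp
    also have "\<dots> = ennreal (t * (L * (Q * r powr \<alpha> + (r powr \<alpha>)\<^sup>2)))"
    proof -
      have "L * (t * (Q * r powr (- \<alpha>) + 1)) * wt z = t * (L * (Q * (r powr (- \<alpha>) * r powr \<alpha>) * r powr \<alpha> + (r powr \<alpha>)\<^sup>2))"
        unfolding wtr by (simp add: power2_eq_square algebra_simps)
      also have "r powr (- \<alpha>) * r powr \<alpha> = 1" using r by (simp add: powr_minus)
      finally show ?thesis using L0 t Q by (subst ennreal_mult'[symmetric]) auto
    qed
    also have "\<dots> \<le> ennreal (t * (L * (Q * R2 powr \<alpha> + (R2 powr \<alpha>)\<^sup>2)))"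
      using rR r t L0 Q alpha_pos by (intro ennreal_leI mult_left_mono add_mono power_mono powr_mono2) auto
    finally show ?thesis using zR by simp
  qed simp
  \<comment> \<open>If \<open>f z\<close> lies in \<open>C\<close>, the first-order expansion
    confines the section to an interval of length \<open>t * G\<close>. If it does not, then, as
    \<open>C\<close> is closed, a whole neighbourhood of \<open>f z\<close> misses \<open>C\<close>
    and the section is empty for small \<open>t\<close>; this is where compactness of the set of
    levels pays off.\<close>
  have loc: "eventually (\<lambda>t. d t (flatS z) \<le> ennreal (t * (gnorm D z * cmod (hor z) powr (- \<alpha>) + e)) * indicator {z. f z \<in> C} z) (at_right 0)"
    if z: "z \<in> S" and e: "e > 0" for z e
  proof -
    define G where "G = gnorm D z * cmod (hor z) powr (- \<alpha>) + e"
    have G: "G > 0" using e by (simp add: G_def gnorm_nonneg add_nonneg_pos)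
    have fz: "flatS z = flat \<alpha> z" "flat \<alpha> z \<in> W" "U (flat \<alpha> z) = f z"
      using z by (auto simp: flatS_def flat_in_W U_def unflat_flat)
    obtain b where b: "b > 0" "\<And>p. norm (flat \<alpha> z - p) < b \<Longrightarrow> U p \<le> f z + G * norm (flat \<alpha> z - p)"
      using comp_unflat_local_bound[of f D z e, OF der z e] unfolding G_def U_def by blast
    have sub: "Pair (flat \<alpha> z) -` E t \<subseteq> C \<inter> {f z .. f z + t * G}" if t: "0 < t" "t < b" for t
    proof
      fix s assume "s \<in> Pair (flat \<alpha> z) -` E t"
      then have "(flat \<alpha> z, s) \<in> E t" by simp
      then obtain q where q: "s \<in> C" "f z \<le> s" "q \<in> W" "s < U q" "flat \<alpha> z - q \<in> Kt t" unfolding mem_E fz by blast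
      then have "norm (flat \<alpha> z - q) < t" by (simp add: Kt_def)
      then have "U q \<le> f z + G * norm (flat \<alpha> z - q)" "G * norm (flat \<alpha> z - q) \<le> G * t"
        using b(2)[of q] t G by (auto intro!: mult_left_mono)
      then show "s \<in> C \<inter> {f z .. f z + t * G}" using q by (auto simp: mult.commute)
    qed
    show ?thesis
    proof (cases "f z \<in> C")
      case True
      have "d t (flatS z) \<le> ennreal (t * G)" if t: "0 < t" "t < b" for t
      proof -
        have "d t (flatS z) \<le> emeasure lborel {f z .. f z + t * G}"
          unfolding d_def fz using sub[OF t] by (intro emeasure_mono) auto
        then show ?thesis using t G by simp
      qed
      then show ?thesis using True b(1) unfolding G_def[symmetric] eventually_at_right_field by auto
    next
      case False
      have "open (- C)" using C(1) compact_imp_closed by auto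
      then obtain n where n: "n > 0" "ball (f z) n \<subseteq> - C" using False by (meson ComplI open_contains_ball)
      have "d t (flatS z) = 0" if t: "0 < t" "t < min b (n / G)" for t
      proof -
        have "t * G < n" using t G by (simp add: pos_less_divide_eq)
        then have "{f z .. f z + t * G} \<subseteq> ball (f z) n" by (auto simp: dist_real_def)
        moreover have "Pair (flat \<alpha> z) -` E t \<subseteq> C \<inter> {f z .. f z + t * G}" using t by (intro sub) auto
        ultimately have "Pair (flat \<alpha> z) -` E t = {}" using n(2) by blast
        then show ?thesis by (simp add: d_def fz)
      qed
      then show ?thesis using False b(1) n(1) G unfolding eventually_at_right_field
        by (intro exI[of _ "min b (n / G)"]) auto
    qed
  qed
  define t where "t n = inverse (real (Suc n))" for n
  have t: "0 < t n" "t n \<le> 1" for n by (auto simp: t_def divide_simps)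
  have t0: "filterlim t (at_right 0) sequentially"
    unfolding filterlim_at using t LIMSEQ_inverse_real_of_nat by (auto simp: t_def[abs_def] less_imp_neq[symmetric])
  define u where "u n z = indicator S z * ennreal (wt z) * (ennreal (real (Suc n)) * d (t n) (flatS z))" for n z
  have tn: "ennreal (real (Suc n)) * ennreal (t n * x) = ennreal x" if "x \<ge> 0" for n x
    using that t[of n] by (subst ennreal_mult'[symmetric]) (auto simp: t_def field_simps)
  have [measurable]: "u n \<in> borel_measurable lborel" for n unfolding u_def[abs_def] by measurable
  have low: "(\<integral>\<^sup>+s. ennreal (k s) * indicator C s \<partial>lborel) \<le> (\<integral>\<^sup>+z. u n z \<partial>lborel)" for n
  proof -
    have "(\<integral>\<^sup>+s. ennreal (k s) * indicator C s \<partial>lborel) = ennreal (real (Suc n)) * ennreal (t n) * (\<integral>\<^sup>+s. ennreal (k s) * indicator C s \<partial>lborel)"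
      using tn[of 1 n] by simp
    also have "\<dots> \<le> ennreal (real (Suc n)) * (\<integral>\<^sup>+z. d (t n) (flatS z) \<partial>mS)"
      using iso[OF t(1)[of n]] by (simp add: mult.assoc mult_left_mono)
    also have "\<dots> = (\<integral>\<^sup>+z. u n z \<partial>lborel)"
      by (subst nn_integral_mS) (auto simp: u_def nn_integral_cmult[symmetric] ac_simps simp del: of_nat_Suc intro!: nn_integral_cong)
    finally show ?thesis .
  qed
  define B where "B = L * (Q * R2 powr \<alpha> + (R2 powr \<alpha>)\<^sup>2)"
  have B: "B \<ge> 0" using L0 Q by (simp add: B_def)
  have ub: "u n z \<le> ennreal B * indicator (ball 0 (R2 + 1)) z" for n z
  proof (cases "z \<in> S")
    case True
    have "u n z = ennreal (real (Suc n)) * (d (t n) (flatS z) * ennreal (wt z))"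
      using True by (simp add: u_def ac_simps del: of_nat_Suc)
    also have "\<dots> \<le> ennreal (real (Suc n)) * (ennreal (t n * B) * indicator (ball 0 (R2 + 1)) z)"
      using bound[OF True t, of n] unfolding B_def by (intro mult_left_mono) auto
    also have "\<dots> = ennreal B * indicator (ball 0 (R2 + 1)) z"
      using tn[OF B, of n] by (simp add: mult.assoc[symmetric] del: of_nat_Suc)
    finally show ?thesis .
  qed (simp add: u_def)
  have lims: "limsup (\<lambda>n. u n z) \<le> indicator S z * ennreal (wt z) * (ennreal (gnorm D z * cmod (hor z) powr (- \<alpha>)) * indicator {z. f z \<in> C} z)" for z
  proof (cases "z \<in> S")
    case True
    define G where "G = gnorm D z * cmod (hor z) powr (- \<alpha>)"
    have G: "G \<ge> 0" by (simp add: G_def gnorm_nonneg)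
    have le: "limsup (\<lambda>n. u n z) \<le> ennreal (wt z) * (ennreal (G + e) * indicator {z. f z \<in> C} z)" if e: "e > 0" for e
    proof (rule Limsup_bounded)
      show "eventually (\<lambda>n. u n z \<le> ennreal (wt z) * (ennreal (G + e) * indicator {z. f z \<in> C} z)) sequentially"
        using filterlim_iff[THEN iffD1, OF t0, rule_format, OF loc[OF True e]]
      proof eventually_elim
        case (elim n)
        have "u n z = ennreal (wt z) * (ennreal (real (Suc n)) * d (t n) (flatS z))"
          using True by (simp add: u_def del: of_nat_Suc)
        also have "\<dots> \<le> ennreal (wt z) * (ennreal (real (Suc n)) * (ennreal (t n * (G + e)) * indicator {z. f z \<in> C} z))"
          using elim unfolding G_def by (intro mult_left_mono) auto
        also have "\<dots> = ennreal (wt z) * (ennreal (G + e) * indicator {z. f z \<in> C} z)"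
          using tn[of "G + e" n] G e by (simp add: mult.assoc[symmetric] del: of_nat_Suc)
        finally show ?case .
      qed
    qed
    have "limsup (\<lambda>n. u n z) \<le> ennreal (wt z) * (ennreal G * indicator {z. f z \<in> C} z)"
    proof (rule tendsto_lowerbound[OF _ _ trivial_limit_at_right_real])
      have "((\<lambda>e. ennreal (wt z * ((G + e) * indicator {z. f z \<in> C} z))) \<longlongrightarrow> ennreal (wt z * ((G + 0) * indicator {z. f z \<in> C} z))) (at_right 0)"
        by (intro tendsto_intros)
      then show "((\<lambda>e. ennreal (wt z * ((G + e) * indicator {z. f z \<in> C} z))) \<longlongrightarrow> ennreal (wt z) * (ennreal G * indicator {z. f z \<in> C} z)) (at_right 0)"
        using G by (simp add: ennreal_mult' ennreal_indicator)
      show "eventually (\<lambda>e. limsup (\<lambda>n. u n z) \<le> ennreal (wt z * ((G + e) * indicator {z. f z \<in> C} z))) (at_right 0)"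
        using eventually_at_right_less[of 0]
      proof eventually_elim
        case (elim e)
        then show ?case using le[of e] G by (simp add: ennreal_mult' ennreal_indicator)
      qed
    qed
    then show ?thesis using True by (simp add: G_def)
  qed (simp add: u_def Limsup_const)
  have "(\<integral>\<^sup>+s. ennreal (k s) * indicator C s \<partial>lborel) \<le> limsup (\<lambda>n. \<integral>\<^sup>+z. u n z \<partial>lborel)"
    using low by (intro le_Limsup) auto
  \<comment> \<open>Reverse Fatou: the upper limit passes under the integral because of the uniform
    bound \<open>ub\<close> by an integrable function.\<close>
  also have "\<dots> \<le> (\<integral>\<^sup>+z. limsup (\<lambda>n. u n z) \<partial>lborel)"
  proof (rule nn_integral_limsup)
    show "(\<integral>\<^sup>+z. ennreal B * indicator (ball 0 (R2 + 1)) z \<partial>(lborel :: (real^3) measure)) < \<infinity>"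
      using emeasure_bounded_finite[of "ball 0 (R2 + 1) :: (real^3) set"]
      by (subst nn_integral_cmult_indicator) (auto simp: ennreal_mult_less_top)
    show "(\<lambda>z. ennreal B * indicator (ball 0 (R2 + 1)) z) \<in> borel_measurable (lborel :: (real^3) measure)"
      by (intro borel_measurable_times_ennreal borel_measurable_const borel_measurable_indicator) simp
  qed (use ub in auto)
  also have "\<dots> \<le> (\<integral>\<^sup>+z. indicator S z * ennreal (wt z) * (ennreal (gnorm D z * cmod (hor z) powr (- \<alpha>)) * indicator {z. f z \<in> C} z) \<partial>lborel)"
    by (intro nn_integral_mono lims)
  also have "\<dots> = (\<integral>\<^sup>+z. ennreal (gnorm D z * cmod (hor z) powr (- \<alpha>)) * indicator {z. f z \<in> C} z \<partial>mS)"
  proof -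
    show ?thesis by (rule nn_integral_mS[symmetric]) measurable
  qed
  finally show ?thesis unfolding k_def .
qed

end

section \<open>Rotations about the edge and the decomposition of space into rotated sectors\<close>

definition rot :: "real \<Rightarrow> real^3 \<Rightarrow> real^3" where
  "rot t z = pt (cis t * hor z) (z$3)"

lemma hor_rot [simp]: "hor (rot t z) = cis t * hor z" and rot_nth_3 [simp]: "rot t z $ 3 = z $ 3"
  by (simp_all add: rot_def)

lemma norm_rot [simp]: "norm (rot t z) = norm z"
  by (simp add: norm_3 norm_mult)

lemma xnorm2_rot [simp]: "xnorm2 (rot t z) = xnorm2 z"
  by (simp add: xnorm2_hor norm_mult)

lemma rot_rot [simp]: "rot s (rot t z) = rot (s + t) z"
  by (simp add: rot_def cis_mult mult.assoc[symmetric])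

lemma rot_0 [simp]: "rot 0 z = z"
  by (simp add: rot_def)

lemma linear_rot: "linear (rot t)"
proof
  show "rot t (x + y) = rot t x + rot t y" for x y
    by (simp add: rot_def hor_add pt_def algebra_simps)
  show "rot t (c *\<^sub>R x) = c *\<^sub>R rot t x" for c x
    by (simp add: rot_def hor_scaleR pt_def algebra_simps)
qed

lemma bounded_linear_rot: "bounded_linear (rot t)"
  by (rule linear_conv_bounded_linear[THEN iffD1, OF linear_rot])

lemma borel_measurable_rot [measurable]: "rot t \<in> borel_measurable borel"
  by (intro borel_measurable_continuous_onI linear_continuous_on bounded_linear_rot)

lemma inner_rot: "x \<bullet> rot t y = rot (- t) x \<bullet> y"
  by (simp add: inner_vec_def sum_3 rot_def hor_def cis.code algebra_simps)

lemma distr_rot: "distr lborel borel (rot t) = lborel"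
proof (rule emeasure_eq_on_bounded)
  fix X :: "(real^3) set" assume X: "X \<in> sets borel" "bounded X"
  have o: "orthogonal_transformation (rot (- t))"
    by (simp add: orthogonal_transformation linear_rot)
  have v: "rot t -` X = rot (- t) ` X"
  proof (intro set_eqI iffI)
    fix z assume "z \<in> rot t -` X"
    then show "z \<in> rot (- t) ` X" by (intro image_eqI[of _ _ "rot t z"]) auto
  qed auto
  have Xl: "X \<in> lmeasurable" using X by (intro bounded_set_imp_lmeasurable) auto
  have b: "bounded (rot (- t) ` X)" using X(2) by (simp add: bounded_iff)
  have Y: "rot t -` X \<in> sets borel" using measurable_sets_borel[OF borel_measurable_rot X(1)] by simp
  have "emeasure (distr lborel borel (rot t)) X = emeasure lborel (rot t -` X)"
    using X by (subst emeasure_distr) auto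
  also have "\<dots> = ennreal (measure lborel (rot t -` X))"
    using emeasure_bounded_finite[OF b] by (intro emeasure_eq_ennreal_measure) (simp add: v)
  also have "measure lborel (rot t -` X) = measure lebesgue (rot (- t) ` X)"
    using Y by (simp add: v)
  also have "\<dots> = measure lborel X" using measure_orthogonal_image[OF o Xl] X by simp
  also have "ennreal \<dots> = emeasure lborel X"
    using emeasure_bounded_finite[OF X(2)] by (intro emeasure_eq_ennreal_measure[symmetric]) simp
  finally show "emeasure (distr lborel borel (rot t)) X = emeasure lborel X" .
qed auto

lemma nn_integral_rot:
  assumes [measurable]: "F \<in> borel_measurable borel"
  shows "(\<integral>\<^sup>+z. F (rot t z) \<partial>lborel) = (\<integral>\<^sup>+z. F z \<partial>lborel)"
  using nn_integral_distr[of "rot t" lborel borel F] by (simp add: distr_rot)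

lemma AE_not_hyperplane:
  fixes v :: "'a::euclidean_space"
  assumes "v \<noteq> 0"
  shows "AE z in lborel. v \<bullet> z \<noteq> c"
proof (rule AE_I')
  have "negligible {z. v \<bullet> z = c}" using assms by (simp add: negligible_hyperplane)
  then have "{z. v \<bullet> z = c} \<in> null_sets lebesgue" by (simp add: negligible_iff_null_sets)
  moreover have "{z. v \<bullet> z = c} \<in> sets lborel" using closed_hyperplane[of v c] by (simp add: borel_closed)
  ultimately show "{z. v \<bullet> z = c} \<in> null_sets lborel" by (simp add: null_sets_completion_iff)
qed auto

text \<open>In terms of the cube roots x and y, the difference of the cubes of the two sides is (x
  y)^2 times a sum of squares.\<close>

lemma root3_sq_add_le:
  assumes "a \<ge> 0" "b \<ge> 0"
  shows "(root 3 (a + b))\<^sup>2 \<le> (root 3 a)\<^sup>2 + (root 3 b)\<^sup>2"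
proof -
  define x y r where "x = root 3 a" and "y = root 3 b" and "r = root 3 (a + b)"
  have xy: "x \<ge> 0" "y \<ge> 0" "x ^ 3 = a" "y ^ 3 = b" "r ^ 3 = a + b" using assms by (auto simp: x_def y_def r_def)
  have "(x\<^sup>2 + y\<^sup>2) ^ 3 - (x ^ 3 + y ^ 3)\<^sup>2 = (x * y)\<^sup>2 * (2 * (x\<^sup>2 + y\<^sup>2) + (x - y)\<^sup>2)"
    by (simp add: power2_eq_square power3_eq_cube algebra_simps)
  then have "(x ^ 3 + y ^ 3)\<^sup>2 \<le> (x\<^sup>2 + y\<^sup>2) ^ 3"
    by (smt (verit) mult_nonneg_nonneg zero_le_power2)
  moreover have "(r\<^sup>2) ^ 3 = (r ^ 3)\<^sup>2" by (simp add: power_mult[symmetric])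
  ultimately have "(r\<^sup>2) ^ 3 \<le> (x\<^sup>2 + y\<^sup>2) ^ 3" by (simp only: xy)
  then show ?thesis unfolding x_def[symmetric] y_def[symmetric] r_def[symmetric]
    using power_mono_iff[of "r\<^sup>2" "x\<^sup>2 + y\<^sup>2" 3] by simp
qed

lemma root3_sq_sum_le:
  assumes "\<And>i. i \<in> I \<Longrightarrow> a i \<ge> 0"
  shows "(root 3 (\<Sum>i\<in>I. a i))\<^sup>2 \<le> (\<Sum>i\<in>I. (root 3 (a i))\<^sup>2)"
  using assms
proof (induction I rule: infinite_finite_induct)
  case (insert x F)
  then have "(root 3 (a x + sum a F))\<^sup>2 \<le> (root 3 (a x))\<^sup>2 + (root 3 (sum a F))\<^sup>2"
    by (intro root3_sq_add_le) (auto intro: sum_nonneg)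
  moreover have "(root 3 (sum a F))\<^sup>2 \<le> (\<Sum>i\<in>F. (root 3 (a i))\<^sup>2)" using insert by auto
  ultimately show ?case using insert.hyps by simp
qed auto

context grushin
begin

definition "sect_angle = pi / real (nalpha \<alpha>)"

lemma sect_angle: "sect_angle > 0" "real (2 * nalpha \<alpha>) * sect_angle = 2 * pi" "sect_angle < pi"
proof -
  have "real (nalpha \<alpha>) > 1" using nalpha_ge[of \<alpha>] alpha_pos by linarith
  then show "sect_angle > 0" "real (2 * nalpha \<alpha>) * sect_angle = 2 * pi" "sect_angle < pi"
    by (auto simp: sect_angle_def divide_less_eq)
qed

text \<open>Outside the null planes bounding the rotated sectors, the index is the integer part of
  the angle in [0, 2 pi) divided by the sector angle. These planes also contain the edge, so
  \<open>hor z\<close> is nonzero and has a well-defined direction.\<close>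

lemma AE_unique_sector:
  "AE z in lborel. \<exists>!k. k < 2 * nalpha \<alpha> \<and> rot (- (real k * sect_angle)) z \<in> S"
proof -
  let ?b = sect_angle and ?n = "2 * nalpha \<alpha>"
  have "AE z in lborel. Im (cis (- (real k * ?b)) * hor z) \<noteq> 0" for k
  proof -
    define v :: "real^3" where "v = pt (Complex (- sin (real k * ?b)) (cos (real k * ?b))) 0"
    have "v \<noteq> 0"
    proof
      assume "v = 0"
      then have "v $ 1 = 0" "v $ 2 = 0" by auto
      then have "sin (real k * ?b) = 0" "cos (real k * ?b) = 0" by (simp_all add: v_def)
      then show False using sin_cos_squared_add[of "real k * ?b"] by simp
    qed
    from AE_not_hyperplane[OF this, of 0] show ?thesis
      by (rule AE_mp) (auto simp: v_def inner_vec_def sum_3 hor_def)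
  qed
  then have "AE z in lborel. \<forall>k. Im (cis (- (real k * ?b)) * hor z) \<noteq> 0"
    by (simp add: AE_all_countable)
  then show ?thesis
  proof eventually_elim
    case (elim z)
    define t where "t = Arg2pi (hor z)"
    define r where "r = cmod (hor z)"
    have "hor z \<noteq> 0" using elim by auto
    then have r: "r > 0" by (simp add: r_def)
    have t: "0 \<le> t" "t < 2 * pi" "hor z = rcis r t"
      using Arg2pi[of "hor z"] by (auto simp: t_def r_def rcis_def cis_conv_exp is_Arg_def)
    have hr: "hor (rot (- (real k * ?b)) z) = rcis r (t - real k * ?b)" for k
      by (simp add: t(3) rcis_def cis_mult mult.left_commute)
    have tb: "t \<noteq> real k * ?b" for k
    proof -
      have "Im (rcis r (t - real k * ?b)) \<noteq> 0"
        using elim[rule_format, of k] hr[of k, symmetric] by (simp only: hor_rot) simp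
      then show ?thesis by auto
    qed
    \<comment> \<open>Membership in \<open>S\<close> is tested with the principal argument, which
      fixes the angle only up to full turns. A full turn is \<open>?n\<close> sector angles, so the
      index is determined modulo \<open>?n\<close>; the integer \<open>m\<close> counts the
      turns.\<close>
    have iff: "rot (- (real k * ?b)) z \<in> S \<longleftrightarrow> (\<exists>m::int. \<lfloor>t / ?b\<rfloor> = int k + int ?n * m)" for k
    proof
      assume "rot (- (real k * ?b)) z \<in> S"
      then have A: "0 < Arg (rcis r (t - real k * ?b))" "Arg (rcis r (t - real k * ?b)) < ?b"
        unfolding S_wedge wedge_def mem_Collect_eq hr sect_angle_def[symmetric] by blast+
      define a where "a = Arg (rcis r (t - real k * ?b))"
      have "cmod (rcis r (t - real k * ?b)) = r" using r by simp
      then have "rcis r (t - real k * ?b) = rcis r a" by (metis a_def rcis_cmod_Arg)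
      then have "cis (t - real k * ?b) = cis a" using r by (simp add: rcis_def)
      then have "sin (t - real k * ?b) = sin a \<and> cos (t - real k * ?b) = cos a" by (simp add: complex_eq_iff)
      then obtain m :: int where m: "t - real k * ?b = a + 2 * pi * of_int m" unfolding sin_cos_eq_iff by blast
      have "t = (real k + real ?n * of_int m) * ?b + a"
      proof -
        have "real ?n * of_int m * ?b = 2 * pi * of_int m" using sect_angle(2) by (metis mult.assoc mult.commute)
        then show ?thesis using m unfolding distrib_right by linarith
      qed
      then have "t / ?b = of_int (int k + int ?n * m) + a / ?b" using sect_angle(1) by (simp add: add_divide_distrib)
      moreover have "0 \<le> a / ?b" "a / ?b < 1" using A sect_angle(1) by (auto simp: a_def)
      ultimately have "\<lfloor>t / ?b\<rfloor> = int k + int ?n * m" by linarith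
      then show "\<exists>m::int. \<lfloor>t / ?b\<rfloor> = int k + int ?n * m" ..
    next
      assume "\<exists>m::int. \<lfloor>t / ?b\<rfloor> = int k + int ?n * m"
      then obtain m where m: "\<lfloor>t / ?b\<rfloor> = int k + int ?n * m" ..
      define q where "q = nat \<lfloor>t / ?b\<rfloor>"
      have tb0: "t / ?b \<ge> 0" using t sect_angle by simp
      then have q: "real q = of_int \<lfloor>t / ?b\<rfloor>" by (simp add: q_def)
      define a where "a = t - real q * ?b"
      have "real q \<le> t / ?b" "t / ?b < real q + 1" unfolding q by linarith+
      then have "0 \<le> a" "a < ?b" using sect_angle(1) by (auto simp: a_def field_simps)
      moreover have "a \<noteq> 0" using tb[of q] by (simp add: a_def)
      ultimately have a: "0 < a" "a < ?b" by auto
      have "t - real k * ?b = a + 2 * pi * of_int m"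
      proof -
        have "real q = real k + real ?n * of_int m" unfolding q m by simp
        then have "t - real k * ?b = a + real ?n * ?b * of_int m" by (simp add: a_def algebra_simps)
        then show ?thesis by (simp only: sect_angle(2))
      qed
      then have "rcis r (t - real k * ?b) = rcis r a"
        unfolding rcis_def by (metis cis_mult cis_multiple_2pi Ints_of_int mult.right_neutral)
      then have "Arg (hor (rot (- (real k * ?b)) z)) = a"
        unfolding hr using r a sect_angle(3) by (intro Arg_unique'[of r]) auto
      then show "rot (- (real k * ?b)) z \<in> S"
        using a unfolding S_wedge wedge_def mem_Collect_eq sect_angle_def[symmetric] by (simp only:)
    qed
    have fl: "0 \<le> \<lfloor>t / ?b\<rfloor>" "\<lfloor>t / ?b\<rfloor> < int ?n"
    proof -
      show "0 \<le> \<lfloor>t / ?b\<rfloor>" using t sect_angle by simp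
      have "t / ?b < real ?n" using t(2) sect_angle by (simp add: pos_divide_less_eq)
      then show "\<lfloor>t / ?b\<rfloor> < int ?n" by linarith
    qed
    show ?case
    proof (rule ex1I[of _ "nat \<lfloor>t / ?b\<rfloor>"])
      show "nat \<lfloor>t / ?b\<rfloor> < ?n \<and> rot (- (real (nat \<lfloor>t / ?b\<rfloor>) * ?b)) z \<in> S"
      proof
        show "nat \<lfloor>t / ?b\<rfloor> < ?n" using fl by linarith
        have "\<lfloor>t / ?b\<rfloor> = int (nat \<lfloor>t / ?b\<rfloor>) + int ?n * 0" using fl by simp
        then show "rot (- (real (nat \<lfloor>t / ?b\<rfloor>) * ?b)) z \<in> S" using iff[of "nat \<lfloor>t / ?b\<rfloor>"] by blast
      qed
      fix k assume k: "k < ?n \<and> rot (- (real k * ?b)) z \<in> S"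
      then obtain m where m: "\<lfloor>t / ?b\<rfloor> = int k + int ?n * m" using iff by blast
      have "\<lfloor>t / ?b\<rfloor> = \<lfloor>t / ?b\<rfloor> mod int ?n" using fl by simp
      also have "\<dots> = int k mod int ?n" unfolding m by simp
      also have "\<dots> = int k" using k by simp
      finally show "k = nat \<lfloor>t / ?b\<rfloor>" by simp
    qed
  qed
qed

text \<open>Rotation invariance of Lebesgue measure carries the pullback on \<open>S\<close> to an
  integral over a rotated sector, and the rotated sectors partition space almost everywhere.\<close>

lemma sum_sectors:
  assumes [measurable]: "F \<in> borel_measurable borel"
  shows "(\<Sum>k<2 * nalpha \<alpha>. \<integral>\<^sup>+z. indicator S z * F (rot (real k * sect_angle) z) \<partial>lborel) = (\<integral>\<^sup>+z. F z \<partial>lborel)"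
proof -
  let ?n = "2 * nalpha \<alpha>" and ?b = sect_angle
  have "(\<integral>\<^sup>+z. indicator S z * F (rot (real k * ?b) z) \<partial>lborel) = (\<integral>\<^sup>+z. indicator S (rot (- (real k * ?b)) z) * F z \<partial>lborel)" for k
    using nn_integral_rot[of "\<lambda>z. indicator S z * F (rot (real k * ?b) z)" "- (real k * ?b)"] by simp
  then have "(\<Sum>k<?n. \<integral>\<^sup>+z. indicator S z * F (rot (real k * ?b) z) \<partial>lborel)
     = (\<Sum>k<?n. \<integral>\<^sup>+z. indicator S (rot (- (real k * ?b)) z) * F z \<partial>lborel)" by (simp only:)
  also have "\<dots> = (\<integral>\<^sup>+z. (\<Sum>k<?n. indicator S (rot (- (real k * ?b)) z) * F z) \<partial>lborel)"
    by (rule nn_integral_sum[symmetric]) measurable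
  also have "\<dots> = (\<integral>\<^sup>+z. F z \<partial>lborel)"
  proof (rule nn_integral_cong_AE)
    show "AE z in lborel. (\<Sum>k<?n. indicator S (rot (- (real k * ?b)) z) * F z) = F z"
      using AE_unique_sector
    proof eventually_elim
      case (elim z)
      then obtain k where k: "k < ?n" "rot (- (real k * ?b)) z \<in> S" "\<And>j. j < ?n \<Longrightarrow> rot (- (real j * ?b)) z \<in> S \<Longrightarrow> j = k" by blast
      have "(\<Sum>j<?n. indicator S (rot (- (real j * ?b)) z) * F z) = (\<Sum>j<?n. if j = k then F z else 0)"
      proof (rule sum.cong[OF refl])
        fix j assume j: "j \<in> {..<?n}"
        show "indicator S (rot (- (real j * ?b)) z) * F z = (if j = k then F z else 0)"
        proof (cases "j = k")
          case False
          then have "rot (- (real j * ?b)) z \<notin> S" using k(3)[of j] j by blast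
          then show ?thesis using False by simp
        qed (simp add: k(2))
      qed
      then show ?case using k(1) by simp
    qed
  qed
  finally show ?thesis .
qed

lemma nn_integral_wmeasure:
  assumes [measurable]: "F \<in> borel_measurable borel"
  shows "(\<integral>\<^sup>+z. F z \<partial>wmeasure \<alpha>) = (\<integral>\<^sup>+z. ennreal (wt z) * F z \<partial>lborel)"
  unfolding wmeasure_def by (subst nn_integral_density) auto

lemma sets_wmeasure [simp, measurable_cong]: "sets (wmeasure \<alpha>) = sets borel"
  by (simp add: wmeasure_def)

lemma sets_mS [simp, measurable_cong]: "sets mS = sets borel"
  by (simp add: mS_def)

lemma space_mS [simp]: "space mS = UNIV" and space_wmeasure [simp]: "space (wmeasure \<alpha>) = UNIV"
  by (simp_all add: mS_def wmeasure_def)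

lemma sum_sectors_mS:
  assumes [measurable]: "F \<in> borel_measurable borel"
  shows "(\<Sum>k<2 * nalpha \<alpha>. \<integral>\<^sup>+z. F (rot (real k * sect_angle) z) \<partial>mS) = (\<integral>\<^sup>+z. F z \<partial>wmeasure \<alpha>)"
  using sum_sectors[of "\<lambda>z. ennreal (wt z) * F z"] by (simp add: nn_integral_mS nn_integral_wmeasure mult.assoc)

lemma gnorm_rot: "gnorm (\<lambda>z. rot s (D (rot t z))) z = gnorm D (rot t z)"
proof -
  have g: "grushin_sq \<alpha> z (D $ 1) (D $ 2) (D $ 3) = (cmod (hor D))\<^sup>2 + wt z * (D $ 3)\<^sup>2" for D z
    by (simp add: grushin_sq_def hor_def cmod_power2)
  show ?thesis unfolding gnorm_def g by (simp add: norm_mult)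
qed

lemma emeasure_wmeasure_bounded:
  assumes "bounded X"
  shows "emeasure (wmeasure \<alpha>) X < \<infinity>"
proof -
  obtain R where R: "\<And>z. z \<in> X \<Longrightarrow> norm z \<le> R" using assms bounded_iff by blast
  have "emeasure (wmeasure \<alpha>) X \<le> emeasure (wmeasure \<alpha>) (cball 0 R)"
    using R by (intro emeasure_mono) auto
  also have "\<dots> = (\<integral>\<^sup>+z. ennreal (wt z) * indicator (cball 0 R) z \<partial>lborel)"
    unfolding wmeasure_def by (subst emeasure_density) auto
  also have "\<dots> \<le> (\<integral>\<^sup>+z. ennreal ((R\<^sup>2) powr \<alpha>) * indicator (cball 0 R) z \<partial>(lborel :: (real^3) measure))"
  proof (intro nn_integral_mono)
    fix z :: "real^3"
    show "ennreal (wt z) * indicator (cball 0 R) z \<le> ennreal ((R\<^sup>2) powr \<alpha>) * indicator (cball 0 R) z"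
    proof (cases "z \<in> cball 0 R")
      case True
      then have "cmod (hor z) \<le> R" using norm_hor_le[of z] by simp
      then have "xnorm2 z \<le> R\<^sup>2" unfolding xnorm2_hor by (rule power_mono) simp
      then have "wt z \<le> (R\<^sup>2) powr \<alpha>" using alpha_pos by (intro powr_mono2) (auto simp: xnorm2_def)
      then show ?thesis using True by (simp add: ennreal_leI)
    qed simp
  qed
  also have "\<dots> = ennreal ((R\<^sup>2) powr \<alpha>) * emeasure lborel (cball 0 R :: (real^3) set)"
    by (rule nn_integral_cmult_indicator) auto
  also have "\<dots> < \<infinity>" using emeasure_bounded_finite[of "cball 0 R :: (real^3) set"]
    by (simp add: ennreal_mult_less_top)
  finally show ?thesis .
qed

text \<open>The wedge inequality is applied to every rotated copy of \<open>f\<close>. On the right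
  the integrals over the sectors add up exactly; on the left subadditivity of the power 2/3 compares
  the sum over the pieces with the measure of the full superlevel set.\<close>

lemma coarea:
  fixes f :: "real^3 \<Rightarrow> real" and D :: "real^3 \<Rightarrow> real^3"
  assumes der: "\<And>z. (f has_derivative (\<lambda>h. D z \<bullet> h)) (at z)"
    and D[measurable]: "D \<in> borel_measurable borel"
    and lip: "\<And>x y. \<bar>f x - f y\<bar> \<le> L * norm (x - y)"
    and supp: "\<And>z. norm z > R \<Longrightarrow> f z = 0" and R: "R > 0"
    and C: "compact C" "C \<subseteq> {0<..}"
  shows "(\<integral>\<^sup>+s. ennreal (3 * root 3 om * (root 3 (measure (wmeasure \<alpha>) {z. s < f z}))\<^sup>2) * indicator C s \<partial>lborel)
     \<le> (\<integral>\<^sup>+z. ennreal (gnorm D z * cmod (hor z) powr (- \<alpha>)) * indicator {z. f z \<in> C} z \<partial>wmeasure \<alpha>)"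
proof -
  let ?n = "2 * nalpha \<alpha>" and ?b = sect_angle
  define fk where "fk k z = f (rot (real k * ?b) z)" for k :: nat and z
  define Dk where "Dk k z = rot (- (real k * ?b)) (D (rot (real k * ?b) z))" for k :: nat and z
  have fcont: "continuous_on A f" for A
    by (intro continuous_at_imp_continuous_on ballI has_derivative_continuous[OF der])
  have f[measurable]: "f \<in> borel_measurable borel" by (intro borel_measurable_continuous_onI fcont)
  have [measurable]: "fk k \<in> borel_measurable borel" for k unfolding fk_def[abs_def] by measurable
  have [measurable]: "C \<in> sets borel" using C by (simp add: borel_compact)
  have am: "antimono (\<lambda>s. emeasure mS {z. s < fk k z})" for k
    by (intro antimonoI emeasure_mono) (auto)
  note [measurable] = borel_measurable_antimono[OF am]
  have wedge: "(\<integral>\<^sup>+s. ennreal (3 * root 3 om * (root 3 (measure mS {z. s < fk k z}))\<^sup>2) * indicator C s \<partial>lborel)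
     \<le> (\<integral>\<^sup>+z. ennreal (gnorm (Dk k) z * cmod (hor z) powr (- \<alpha>)) * indicator {z. fk k z \<in> C} z \<partial>mS)" for k
  proof (rule coarea_wedge[OF _ _ _ _ R C])
    show "(fk k has_derivative (\<lambda>h. Dk k z \<bullet> h)) (at z)" for z
      using has_derivative_compose[OF bounded_linear.has_derivative[OF bounded_linear_rot has_derivative_ident] der]
      by (simp add: fk_def[abs_def] Dk_def inner_rot)
    show "Dk k \<in> borel_measurable borel" unfolding Dk_def[abs_def] by measurable
    show "\<bar>fk k x - fk k y\<bar> \<le> L * norm (x - y)" for x y
      using lip[of "rot (real k * ?b) x" "rot (real k * ?b) y"] linear_diff[OF linear_rot, of "real k * ?b" x y]
      by (simp add: fk_def) (metis norm_rot)
    show "fk k z = 0" if "norm z > R" for z using supp that by (simp add: fk_def)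
  qed
  have sum: "(\<Sum>k<?n. emeasure mS {z. s < fk k z}) = emeasure (wmeasure \<alpha>) {z. s < f z}" for s
  proof -
    have "(\<Sum>k<?n. emeasure mS {z. s < fk k z}) = (\<Sum>k<?n. \<integral>\<^sup>+z. indicator {z. s < f z} (rot (real k * ?b) z) \<partial>mS)"
    proof (rule sum.cong[OF refl])
      fix k
      have "emeasure mS {z. s < fk k z} = (\<integral>\<^sup>+z. indicator {z. s < fk k z} z \<partial>mS)"
        by (rule nn_integral_indicator[symmetric]) simp
      also have "\<dots> = (\<integral>\<^sup>+z. indicator {z. s < f z} (rot (real k * ?b) z) \<partial>mS)"
        by (rule nn_integral_cong) (simp add: fk_def indicator_def)
      finally show "emeasure mS {z. s < fk k z} = (\<integral>\<^sup>+z. indicator {z. s < f z} (rot (real k * ?b) z) \<partial>mS)" .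
    qed
    also have "\<dots> = (\<integral>\<^sup>+z. indicator {z. s < f z} z \<partial>wmeasure \<alpha>)"
      by (rule sum_sectors_mS) simp
    also have "\<dots> = emeasure (wmeasure \<alpha>) {z. s < f z}" by (rule nn_integral_indicator) simp
    finally show ?thesis .
  qed
  \<comment> \<open>\<open>measure\<close> sends infinite mass to 0, so the masses must be known to
    be finite before the extended-real sum over the sectors is turned into a real one. Levels in
    \<open>C\<close> are positive, hence their superlevel sets are bounded.\<close>
  have fin: "emeasure (wmeasure \<alpha>) {z. s < f z} < \<infinity>" if "s \<in> C" for s
  proof -
    have "norm z \<le> R" if "s < f z" for z using supp[of z] that \<open>s \<in> C\<close> C(2) by force
    then show ?thesis by (intro emeasure_wmeasure_bounded) (auto simp: bounded_iff)
  qed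
  have "(\<integral>\<^sup>+s. ennreal (3 * root 3 om * (root 3 (measure (wmeasure \<alpha>) {z. s < f z}))\<^sup>2) * indicator C s \<partial>lborel)
    \<le> (\<integral>\<^sup>+s. (\<Sum>k<?n. ennreal (3 * root 3 om * (root 3 (measure mS {z. s < fk k z}))\<^sup>2) * indicator C s) \<partial>lborel)"
  proof (intro nn_integral_mono)
    fix s
    show "ennreal (3 * root 3 om * (root 3 (measure (wmeasure \<alpha>) {z. s < f z}))\<^sup>2) * indicator C s
      \<le> (\<Sum>k<?n. ennreal (3 * root 3 om * (root 3 (measure mS {z. s < fk k z}))\<^sup>2) * indicator C s)"
    proof (cases "s \<in> C")
      case True
      have "emeasure mS {z. s < fk k z} \<noteq> top" if "k < ?n" for k
      proof -
        have "emeasure mS {z. s < fk k z} \<le> emeasure (wmeasure \<alpha>) {z. s < f z}"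
          unfolding sum[symmetric] using that by (intro member_le_sum) auto
        then show ?thesis using fin[OF True] by (auto simp: top_unique)
      qed
      then have "measure (wmeasure \<alpha>) {z. s < f z} = (\<Sum>k<?n. measure mS {z. s < fk k z})"
        unfolding measure_def sum[symmetric] by (subst enn2real_sum) (auto simp: less_top)
      then have "(root 3 (measure (wmeasure \<alpha>) {z. s < f z}))\<^sup>2 \<le> (\<Sum>k<?n. (root 3 (measure mS {z. s < fk k z}))\<^sup>2)"
        using root3_sq_sum_le[of "{..<?n}" "\<lambda>k. measure mS {z. s < fk k z}"] by simp
      then have "3 * root 3 om * (root 3 (measure (wmeasure \<alpha>) {z. s < f z}))\<^sup>2 \<le> (\<Sum>k<?n. 3 * root 3 om * (root 3 (measure mS {z. s < fk k z}))\<^sup>2)"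
        using om_pos unfolding sum_distrib_left[symmetric] by (intro mult_left_mono) auto
      then show ?thesis using True om_pos by (simp add: sum_ennreal ennreal_leI)
    qed simp
  qed
  also have "\<dots> = (\<Sum>k<?n. \<integral>\<^sup>+s. ennreal (3 * root 3 om * (root 3 (measure mS {z. s < fk k z}))\<^sup>2) * indicator C s \<partial>lborel)"
    unfolding measure_def by (rule nn_integral_sum) measurable
  also have "\<dots> \<le> (\<Sum>k<?n. \<integral>\<^sup>+z. ennreal (gnorm (Dk k) z * cmod (hor z) powr (- \<alpha>)) * indicator {z. fk k z \<in> C} z \<partial>mS)"
    by (intro sum_mono wedge)
  also have "\<dots> = (\<integral>\<^sup>+z. ennreal (gnorm D z * cmod (hor z) powr (- \<alpha>)) * indicator {z. f z \<in> C} z \<partial>wmeasure \<alpha>)"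
  proof (subst sum_sectors_mS[symmetric])
    show "(\<lambda>z. ennreal (gnorm D z * cmod (hor z) powr - \<alpha>) * indicator {z. f z \<in> C} z) \<in> borel_measurable borel"
      by measurable
  qed (auto simp: fk_def Dk_def[abs_def] gnorm_rot norm_mult indicator_def intro!: sum.cong nn_integral_cong)
  finally show ?thesis .
qed

end

section \<open>The profile of the rearrangement\<close>

lemma nn_integral_mono_of_emeasure_le:
  assumes sets: "sets M = sets N" and le: "\<And>A. A \<in> sets M \<Longrightarrow> emeasure M A \<le> emeasure N A"
    and f: "f \<in> borel_measurable M"
  shows "(\<integral>\<^sup>+x. f x \<partial>M) \<le> (\<integral>\<^sup>+x. f x \<partial>N)"
  using f
proof (induction rule: borel_measurable_induct)
  case (cong f g)
  then have "(\<integral>\<^sup>+x. f x \<partial>M) = (\<integral>\<^sup>+x. g x \<partial>M)" "(\<integral>\<^sup>+x. f x \<partial>N) = (\<integral>\<^sup>+x. g x \<partial>N)"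
    using sets_eq_imp_space_eq[OF sets] by (auto intro!: nn_integral_cong)
  then show ?case using cong by simp
next
  case (set A)
  then show ?case using le sets by simp
next
  case (mult u c)
  then have "u \<in> borel_measurable N" using sets measurable_cong_sets by blast
  then show ?case using mult by (simp add: nn_integral_cmult mult_left_mono)
next
  case (add u v)
  then have "u \<in> borel_measurable N" "v \<in> borel_measurable N" using sets measurable_cong_sets by blast+
  then show ?case using add by (simp add: nn_integral_add add_mono)
next
  case (seq U)
  then have "\<And>i. U i \<in> borel_measurable N" using sets measurable_cong_sets by blast
  then have "(\<integral>\<^sup>+x. (SUP i. U i x) \<partial>M) \<le> (\<integral>\<^sup>+x. (SUP i. U i x) \<partial>N)"
    using seq by (subst (1 2) nn_integral_monotone_convergence_SUP) (auto intro!: SUP_subset_mono[OF order_refl])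
  then show ?case by (simp add: SUP_apply image_comp)
qed

text \<open>If the functional \<open>c \<mapsto> \<integral> c dN\<close> is bounded in \<open>L\<^sup>2(M)\<close> in the dual form below,
  then \<open>N\<close> has a density in \<open>L\<^sup>2(M)\<close>: test with large multiples of null sets, then with truncations of
  the Radon-Nikodym derivative itself.\<close>

lemma density_of_quadratic_bound:
  fixes M N :: "'a measure" and E :: ennreal
  assumes M: "sigma_finite_measure M" and sets: "sets N = sets M" and N: "finite_measure N" and E: "E < \<infinity>"
    and bound: "\<And>c :: 'a \<Rightarrow> real. c \<in> borel_measurable M \<Longrightarrow> (\<And>x. c x \<ge> 0) \<Longrightarrow>
       2 * (\<integral>\<^sup>+x. ennreal (c x) \<partial>N) \<le> (\<integral>\<^sup>+x. ennreal ((c x)\<^sup>2) \<partial>M) + E"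
  obtains g :: "'a \<Rightarrow> real" where "g \<in> borel_measurable M" "\<And>x. g x \<ge> 0" "N = density M (\<lambda>x. ennreal (g x))"
    "(\<integral>\<^sup>+x. ennreal ((g x)\<^sup>2) \<partial>M) \<le> E"
proof -
  interpret M: sigma_finite_measure M by fact
  interpret N: finite_measure N by fact
  have [measurable_cong]: "sets N = sets M" by fact
  have "A \<in> null_sets N" if A: "A \<in> null_sets M" for A
  proof -
    have [measurable]: "A \<in> sets M" using A by auto
    have le: "ennreal (2 * real k * measure N A) \<le> E" for k :: nat
    proof -
      have "2 * (\<integral>\<^sup>+x. ennreal (real k * indicator A x) \<partial>N) \<le> (\<integral>\<^sup>+x. ennreal ((real k * indicator A x)\<^sup>2) \<partial>M) + E"
        by (rule bound) auto
      also have "(\<integral>\<^sup>+x. ennreal ((real k * indicator A x)\<^sup>2) \<partial>M) = (\<integral>\<^sup>+x. 0 \<partial>M)"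
      proof (rule nn_integral_cong_AE)
        show "AE x in M. ennreal ((real k * indicator A x)\<^sup>2) = 0"
          using AE_not_in[OF A] by eventually_elim simp
      qed
      also have "(\<integral>\<^sup>+x. ennreal (real k * indicator A x) \<partial>N) = ennreal (real k) * emeasure N A"
        by (simp add: ennreal_mult' ennreal_indicator nn_integral_cmult_indicator sets)
      finally show ?thesis by (simp add: N.emeasure_eq_measure ennreal_mult' mult.assoc)
    qed
    obtain e where e: "E = ennreal e" "e \<ge> 0" using E by (cases E) auto
    have le': "2 * real k * measure N A \<le> e" for k using le[of k] e by simp
    have "measure N A = 0"
    proof (rule ccontr)
      assume "measure N A \<noteq> 0"
      then have "2 * measure N A > 0" using measure_nonneg[of N A] by linarith
      then obtain k :: nat where "e < real k * (2 * measure N A)" using reals_Archimedean3 by blast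
      then show False using le'[of k] by (simp add: mult.commute mult.left_commute)
    qed
    then show ?thesis using sets by (auto simp: null_sets_def N.emeasure_eq_measure)
  qed
  then have "absolutely_continuous M N" by (auto simp: absolutely_continuous_def)
  then obtain f where f[measurable]: "f \<in> borel_measurable M" "density M f = N"
    using M.Radon_Nikodym[OF _ sets] by blast
  have "(\<integral>\<^sup>+x. f x \<partial>M) = emeasure N (space M)"
    unfolding f(2)[symmetric] by (subst emeasure_density) (auto intro!: nn_integral_cong)
  then have "(\<integral>\<^sup>+x. f x \<partial>M) \<noteq> \<infinity>" by simp
  then have fin: "AE x in M. f x \<noteq> \<infinity>" by (intro nn_integral_PInf_AE) auto
  define g where "g x = enn2real (f x)" for x
  have g[measurable]: "g \<in> borel_measurable M" unfolding g_def[abs_def] by measurable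
  have g0: "g x \<ge> 0" for x by (simp add: g_def)
  have Ng: "N = density M (\<lambda>x. ennreal (g x))"
    unfolding f(2)[symmetric] using fin
    by (intro density_cong) (auto elim!: eventually_mono simp: g_def less_top)
  obtain A :: "nat \<Rightarrow> 'a set" where A: "range A \<subseteq> sets M" "(\<Union>i. A i) = space M" "\<And>i. emeasure M (A i) \<noteq> \<infinity>" "incseq A"
    using M.sigma_finite_incseq by blast
  have [measurable]: "A k \<in> sets M" for k using A(1) by auto
  \<comment> \<open>Truncation in height and in support makes the square integral \<open>X\<close>
    finite. Testing with \<open>c k\<close> gives \<open>2 * X \<le> X + E\<close>, from which
    \<open>X\<close> may then be cancelled; Fatou's lemma removes the truncation.\<close>
  define c where "c k x = min (g x) (real k) * indicator (A k) x" for k x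
  have [measurable]: "c k \<in> borel_measurable M" for k unfolding c_def[abs_def] by measurable
  have c0: "c k x \<ge> 0" for k x using g0 by (simp add: c_def)
  have cE: "(\<integral>\<^sup>+x. ennreal ((c k x)\<^sup>2) \<partial>M) \<le> E" for k
  proof -
    define X where "X = (\<integral>\<^sup>+x. ennreal ((c k x)\<^sup>2) \<partial>M)"
    have "X \<le> (\<integral>\<^sup>+x. ennreal ((real k)\<^sup>2) * indicator (A k) x \<partial>M)"
      unfolding X_def using g0 by (intro nn_integral_mono) (auto simp: c_def indicator_def intro!: ennreal_leI power_mono)
    also have "\<dots> = ennreal ((real k)\<^sup>2) * emeasure M (A k)" by (rule nn_integral_cmult_indicator) simp
    also have "\<dots> < \<infinity>" using A(3)[of k] by (simp add: ennreal_mult_eq_top_iff less_top[symmetric])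
    finally have X: "X < \<infinity>" .
    have "X \<le> (\<integral>\<^sup>+x. ennreal (c k x) \<partial>N)"
      unfolding X_def Ng
    proof (subst nn_integral_density)
      show "(\<integral>\<^sup>+x. ennreal ((c k x)\<^sup>2) \<partial>M) \<le> (\<integral>\<^sup>+x. ennreal (g x) * ennreal (c k x) \<partial>M)"
      proof (intro nn_integral_mono)
        fix x
        have "c k x \<le> g x" using g0[of x] by (auto simp: c_def indicator_def)
        then show "ennreal ((c k x)\<^sup>2) \<le> ennreal (g x) * ennreal (c k x)"
          using c0[of k x] g0[of x] by (simp add: ennreal_mult[symmetric] power2_eq_square mult_right_mono ennreal_leI)
      qed
    qed auto
    then have "2 * X \<le> 2 * (\<integral>\<^sup>+x. ennreal (c k x) \<partial>N)" by (rule mult_left_mono) simp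
    also have "\<dots> \<le> X + E" unfolding X_def by (rule bound) (auto simp: c0)
    finally have "X + X \<le> X + E" by (simp add: mult_2)
    then show ?thesis using X unfolding X_def[symmetric] by (metis ennreal_add_left_cancel_le infinity_ennreal_def less_irrefl)
  qed
  have "(\<integral>\<^sup>+x. ennreal ((g x)\<^sup>2) \<partial>M) = (\<integral>\<^sup>+x. liminf (\<lambda>k. ennreal ((c k x)\<^sup>2)) \<partial>M)"
  proof (rule nn_integral_cong)
    fix x assume "x \<in> space M"
    then obtain i where i: "x \<in> A i" using A(2) by blast
    obtain j :: nat where j: "g x \<le> real j" using real_arch_simple by blast
    have "eventually (\<lambda>k. ennreal ((c k x)\<^sup>2) = ennreal ((g x)\<^sup>2)) sequentially"
      using eventually_ge_at_top[of "max i j"]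
    proof eventually_elim
      case (elim k)
      then have "x \<in> A k" "g x \<le> real k" using i j incseqD[OF A(4), of i k] by auto
      then show ?case by (simp add: c_def)
    qed
    then have "(\<lambda>k. ennreal ((c k x)\<^sup>2)) \<longlonglongrightarrow> ennreal ((g x)\<^sup>2)" by (rule tendsto_eventually)
    then show "ennreal ((g x)\<^sup>2) = liminf (\<lambda>k. ennreal ((c k x)\<^sup>2))"
      by (intro lim_imp_Liminf[symmetric]) auto
  qed
  also have "\<dots> \<le> liminf (\<lambda>k. \<integral>\<^sup>+x. ennreal ((c k x)\<^sup>2) \<partial>M)"
    by (rule nn_integral_liminf) auto
  also have "\<dots> \<le> E" using cE by (intro Liminf_le) auto
  finally show thesis using that[OF g g0 Ng] by blast
qed

section \<open>The profile and its level radius as generalised inverses, and the density of the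
  derivative\<close>

context grushin
begin

lemma sigma_finite_rad: "sigma_finite_measure rad"
proof
  have "(\<Union>n::nat. {..<real n}) = UNIV" using reals_Archimedean2 by auto
  then show "\<exists>A. countable A \<and> A \<subseteq> sets rad \<and> \<Union>A = space rad \<and> (\<forall>a\<in>A. emeasure rad a \<noteq> \<infinity>)"
    by (intro exI[of _ "range (\<lambda>n::nat. {..<real n})"]) (auto simp: rad_def emeasure_rad_lessThan[unfolded rad_def])
qed

lemma sets_rad [simp, measurable_cong]: "sets rad = sets borel"
  by (simp add: rad_def)

lemma rho_nonneg: "rho z \<ge> 0"
  using alpha_pos by (simp add: gauge_def)

lemma emeasure_mS_rho_less: "r \<ge> 0 \<Longrightarrow> emeasure mS {z. rho z < r} = ennreal (om * r ^ 3)"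
  using emeasure_rad_lessThan[of r] unfolding distr_radial[symmetric]
  by (subst (asm) emeasure_distr) (auto simp: vimage_def)

text \<open>One factor |x|^\<alpha> of the weight goes to \<open>a\<close>, the other cancels
  |x|^(-\<alpha>); what remains is 2xy <= x^2 + y^2. On the edge the weight vanishes.\<close>

lemma two_mult_le_add_wt:
  assumes "a \<ge> 0"
  shows "2 * a * (gnorm D z * cmod (hor z) powr (- \<alpha>)) * wt z \<le> a\<^sup>2 * wt z + (gnorm D z)\<^sup>2"
proof (cases "hor z = 0")
  case False
  define w where "w = cmod (hor z) powr \<alpha>"
  have w: "w > 0" using False by (simp add: w_def)
  have wt: "wt z = w\<^sup>2" by (simp add: w_def xnorm2_hor power2_eq_square powr_mult)
  have i: "cmod (hor z) powr (- \<alpha>) = 1 / w" by (simp add: w_def powr_minus divide_inverse)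
  have "2 * a * (gnorm D z * cmod (hor z) powr (- \<alpha>)) * wt z = 2 * (a * w) * gnorm D z"
    unfolding wt i using w by (simp add: power2_eq_square)
  also have "\<dots> \<le> (a * w)\<^sup>2 + (gnorm D z)\<^sup>2" by (rule sum_squares_bound)
  finally show ?thesis by (simp add: wt power_mult_distrib)
qed (use assms in simp)

text \<open>Here \<open>\<psi>\<close> is the profile as a function of the radius in flat
  coordinates, and \<open>g\<close> plays the role of its negative derivative. It is found as the
  density, relative to \<open>rad\<close>, of the image under \<open>s \<mapsto> R s\<close> of the
  measure \<open>3 * om * (R s)\<^sup>2\<close> ds on levels, which the coarea inequality bounds in
  the dual sense.\<close>

lemma rearrangement_density:
  fixes f :: "real^3 \<Rightarrow> real" and D :: "real^3 \<Rightarrow> real^3" and \<psi> :: "real \<Rightarrow> real"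
  assumes der: "\<And>z. (f has_derivative (\<lambda>h. D z \<bullet> h)) (at z)"
    and D[measurable]: "D \<in> borel_measurable borel"
    and lip: "\<And>x y. \<bar>f x - f y\<bar> \<le> L * norm (x - y)"
    and supp: "\<And>z. norm z > R0 \<Longrightarrow> f z = 0" and R0: "R0 > 0"
    and fin: "(\<integral>\<^sup>+z. ennreal ((gnorm D z)\<^sup>2) \<partial>lborel) < \<infinity>"
    and psi: "antimono \<psi>" "\<And>r. r \<ge> 0 \<Longrightarrow> continuous (at_right r) \<psi>" "\<And>r. \<psi> r \<ge> 0"
    and equi: "\<And>s. s > 0 \<Longrightarrow> emeasure mS {z. s < \<psi> (rho z)} = emeasure (wmeasure \<alpha>) {z. s < f z}"
  obtains g :: "real \<Rightarrow> real" where "g \<in> borel_measurable borel" "\<And>r. g r \<ge> 0"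
    "\<And>a. a > 0 \<Longrightarrow> ennreal (\<psi> a) = (\<integral>\<^sup>+r. ennreal (g r) * indicator {a<..} r \<partial>lborel)"
    "(\<integral>\<^sup>+r. ennreal ((g r)\<^sup>2) \<partial>rad) \<le> (\<integral>\<^sup>+z. ennreal ((gnorm D z)\<^sup>2) \<partial>lborel)"
proof -
  define E where "E = (\<integral>\<^sup>+z. ennreal ((gnorm D z)\<^sup>2) \<partial>lborel)"
  have fcont: "continuous_on A f" for A
    by (intro continuous_at_imp_continuous_on ballI has_derivative_continuous[OF der])
  have f[measurable]: "f \<in> borel_measurable borel" by (intro borel_measurable_continuous_onI fcont)
  have psim[measurable]: "\<psi> \<in> borel_measurable borel" by (rule borel_measurable_antimono[OF psi(1)])
  define m where "m s = emeasure (wmeasure \<alpha>) {z. s < f z}" for s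
  have am: "antimono m" unfolding m_def[abs_def] by (intro antimonoI emeasure_mono) auto
  note [measurable] = borel_measurable_antimono[OF am]
  have mfin: "m s \<le> m 0" "m 0 < \<infinity>" if "s \<ge> 0" for s
  proof -
    show "m s \<le> m 0" using antimonoD[OF am that] .
    have "norm z \<le> R0" if "0 < f z" for z using supp[of z] that by force
    then show "m 0 < \<infinity>" unfolding m_def by (intro emeasure_wmeasure_bounded) (auto simp: bounded_iff)
  qed
  \<comment> \<open>The radius of the ball about the apex in \<open>W\<close> with the same volume
    as the superlevel set of \<open>f\<close>.\<close>
  define R where "R s = root 3 (enn2real (m s) / om)" for s
  have R[measurable]: "R \<in> borel_measurable borel" unfolding R_def[abs_def] by measurable
  have Rnn: "R s \<ge> 0" for s using om_pos by (simp add: R_def)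
  have mR: "m s = ennreal (om * R s ^ 3)" if "s \<ge> 0" for s
    using mfin[OF that] om_pos by (simp add: R_def)
  \<comment> \<open>Strictness on the right comes from right continuity: \<open>s < \<psi> r\<close>
    persists at some \<open>r' > r\<close>, so the superlevel set contains a strictly larger ball.
    In the other direction monotonicity confines the superlevel set to the open ball of radius
    \<open>r\<close>.\<close>
  have galois: "s < \<psi> r \<longleftrightarrow> r < R s" if s: "s > 0" and r: "r \<ge> 0" for s r
  proof
    assume "s < \<psi> r"
    moreover have "(\<psi> \<longlongrightarrow> \<psi> r) (at_right r)" using psi(2)[OF r] by (simp add: continuous_within)
    ultimately have "eventually (\<lambda>x. s < \<psi> x) (at_right r)" by (simp add: order_tendsto_iff)
    then obtain b where b: "b > r" "\<And>x. r < x \<Longrightarrow> x < b \<Longrightarrow> s < \<psi> x" unfolding eventually_at_right_field by blast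
    define r' where "r' = (r + b) / 2"
    have r': "r < r'" "s < \<psi> r'" using b by (auto simp: r'_def)
    have "ennreal (om * r' ^ 3) = emeasure mS {z. rho z < r'}" using r r' by (intro emeasure_mS_rho_less[symmetric]) auto
    also have "\<dots> \<le> emeasure mS {z. s < \<psi> (rho z)}"
      using r'(2) antimonoD[OF psi(1)] by (intro emeasure_mono) (auto intro: less_le_trans less_imp_le)
    also have "\<dots> = ennreal (om * R s ^ 3)" using s equi[OF s] mR[of s] by (simp add: m_def)
    finally have "r' ^ 3 \<le> R s ^ 3" using om_pos Rnn[of s] by simp
    then have "r' \<le> R s" using Rnn[of s] by (simp add: power_mono_iff r r' less_imp_le order_trans[OF r])
    then show "r < R s" using r' by simp
  next
    assume *: "r < R s"
    show "s < \<psi> r"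
    proof (rule ccontr)
      assume "\<not> s < \<psi> r"
      then have "\<psi> x \<le> s" if "r \<le> x" for x using antimonoD[OF psi(1) that] by linarith
      then have "{z. s < \<psi> (rho z)} \<subseteq> {z. rho z < r}" by (intro Collect_mono) (metis not_less)
      then have "emeasure mS {z. s < \<psi> (rho z)} \<le> emeasure mS {z. rho z < r}" by (intro emeasure_mono) auto
      then have "ennreal (om * R s ^ 3) \<le> ennreal (om * r ^ 3)"
        using s equi[OF s] mR[of s] emeasure_mS_rho_less[OF r] by (simp add: m_def)
      then have "R s ^ 3 \<le> r ^ 3" using om_pos r by simp
      then have "R s \<le> r" using Rnn[of s] r by (simp add: power_mono_iff)
      then show False using * by simp
    qed
  qed
  \<comment> \<open>\<open>M1\<close> and \<open>M2\<close> carry the two sides of the coarea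
    inequality as measures on levels: the isoperimetric lower bound, and the image under
    \<open>f\<close> of the Grushin gradient norm times |x|^\<alpha>.\<close>
  define M1 where "M1 = density lborel (\<lambda>s. ennreal (indicator {0<..} s * (3 * om * (R s)\<^sup>2)))"
  have setsM1[simp, measurable_cong]: "sets M1 = sets borel" by (simp add: M1_def)
  define M2 where "M2 = distr (density (wmeasure \<alpha>) (\<lambda>z. ennreal (gnorm D z * cmod (hor z) powr (- \<alpha>)))) borel f"
  have setsM2[simp, measurable_cong]: "sets M2 = sets borel" by (simp add: M2_def)
  have intM1: "(\<integral>\<^sup>+s. F s \<partial>M1) = (\<integral>\<^sup>+s. ennreal (indicator {0<..} s * (3 * om * (R s)\<^sup>2)) * F s \<partial>lborel)"
    if [measurable]: "F \<in> borel_measurable borel" for F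
    unfolding M1_def by (rule nn_integral_density) auto
  have intM2: "(\<integral>\<^sup>+s. F s \<partial>M2) = (\<integral>\<^sup>+z. ennreal (wt z) * (ennreal (gnorm D z * cmod (hor z) powr (- \<alpha>)) * F (f z)) \<partial>lborel)"
    if [measurable]: "F \<in> borel_measurable borel" for F
    unfolding M2_def by (simp add: nn_integral_distr nn_integral_density nn_integral_wmeasure)
  have comp: "emeasure M1 C \<le> emeasure M2 C" if C: "compact C" "C \<subseteq> {0<..}" for C
  proof -
    have Cb[measurable]: "C \<in> sets borel" using C by (simp add: borel_compact)
    have "emeasure M1 C = (\<integral>\<^sup>+s. ennreal (indicator {0<..} s * (3 * om * (R s)\<^sup>2)) * indicator C s \<partial>lborel)"
      using intM1[of "indicator C"] by simp
    also have "\<dots> = (\<integral>\<^sup>+s. ennreal (3 * root 3 om * (root 3 (measure (wmeasure \<alpha>) {z. s < f z}))\<^sup>2) * indicator C s \<partial>lborel)"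
    proof (intro nn_integral_cong)
      fix s
      \<comment> \<open>With R = (v / om)^(1/3) both sides are 3 om^(1/3) v^(2/3).\<close>
      have e: "3 * om * (R s)\<^sup>2 = 3 * root 3 om * (root 3 (measure (wmeasure \<alpha>) {z. s < f z}))\<^sup>2"
      proof -
        have "root 3 om ^ 3 = om" using om_pos by simp
        then have "om * (1 / root 3 om)\<^sup>2 = root 3 om" using om_pos
          by (simp add: power2_eq_square power3_eq_cube field_simps)
        moreover have "3 * om * (R s)\<^sup>2 = 3 * (om * (1 / root 3 om)\<^sup>2) * (root 3 (measure (wmeasure \<alpha>) {z. s < f z}))\<^sup>2"
          by (simp add: R_def m_def measure_def real_root_divide power_divide)
        ultimately show ?thesis by simp
      qed
      show "ennreal (indicator {0<..} s * (3 * om * (R s)\<^sup>2)) * indicator C s =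
         ennreal (3 * root 3 om * (root 3 (measure (wmeasure \<alpha>) {z. s < f z}))\<^sup>2) * indicator C s"
      proof (cases "s \<in> C")
        case True
        then have "s \<in> {0<..}" using C(2) by blast
        then show ?thesis by (simp only: e indicator_simps mult_1)
      qed simp
    qed
    also have "\<dots> \<le> (\<integral>\<^sup>+z. ennreal (gnorm D z * cmod (hor z) powr (- \<alpha>)) * indicator {z. f z \<in> C} z \<partial>wmeasure \<alpha>)"
      by (rule coarea[OF der D lip supp R0 C])
    also have "\<dots> = emeasure M2 C"
    proof (subst nn_integral_wmeasure)
      have ind: "indicator {z. f z \<in> C} z = (indicator C (f z) :: ennreal)" for z by (simp add: indicator_def)
      show "(\<integral>\<^sup>+z. ennreal (wt z) * (ennreal (gnorm D z * cmod (hor z) powr (- \<alpha>)) * indicator {z. f z \<in> C} z) \<partial>lborel) = emeasure M2 C"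
        unfolding ind using intM2[of "indicator C"] by simp
    qed measurable
    finally show ?thesis .
  qed
  have bd: "f z \<le> \<bar>L\<bar> * (2 * R0 + 1)" for z
  proof (cases "norm z \<le> R0")
    case True
    define e :: "real^3" where "e = (R0 + 1) *\<^sub>R axis 1 1"
    have ne: "norm e = R0 + 1" using R0 by (simp add: e_def norm_axis_1)
    then have "f e = 0" by (intro supp) simp
    then have "f z \<le> L * norm (z - e)" using lip[of z e] by linarith
    also have "\<dots> \<le> \<bar>L\<bar> * (2 * R0 + 1)"
      using norm_triangle_ineq4[of z e] True ne by (intro mult_mono) auto
    finally show ?thesis .
  next
    case False
    then show ?thesis using supp[of z] R0 by simp
  qed
  have Rle: "R s \<le> R 0" if "s > 0" for s
    using mfin[of s] that om_pos unfolding R_def by (intro real_root_le_mono divide_right_mono enn2real_mono) auto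
  have R0': "R s = 0" if "s \<ge> \<bar>L\<bar> * (2 * R0 + 1)" for s
  proof -
    have "{z. s < f z} = {}" using bd that by (auto simp: not_less intro: order_trans)
    then show ?thesis by (simp add: R_def m_def)
  qed
  have fM1: "finite_measure M1"
  proof
    have "emeasure M1 (space M1) = (\<integral>\<^sup>+s. ennreal (indicator {0<..} s * (3 * om * (R s)\<^sup>2)) \<partial>lborel)"
      using intM1[of "\<lambda>_. 1"] by (simp add: M1_def)
    also have "\<dots> \<le> (\<integral>\<^sup>+s. ennreal (3 * om * (R 0)\<^sup>2) * indicator {0..\<bar>L\<bar> * (2 * R0 + 1)} s \<partial>lborel)"
    proof (intro nn_integral_mono)
      fix s
      show "ennreal (indicator {0<..} s * (3 * om * (R s)\<^sup>2)) \<le> ennreal (3 * om * (R 0)\<^sup>2) * indicator {0..\<bar>L\<bar> * (2 * R0 + 1)} s"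
        using Rle[of s] R0'[of s] Rnn[of s] om_pos
        by (auto simp: indicator_def not_le intro!: ennreal_leI mult_left_mono power_mono)
    qed
    also have "\<dots> < \<infinity>" using emeasure_bounded_finite[of "{0..\<bar>L\<bar> * (2 * R0 + 1)}"]
      by (subst nn_integral_cmult_indicator) (auto simp: ennreal_mult_less_top)
    finally show "emeasure M1 (space M1) \<noteq> \<infinity>" by simp
  qed
  \<comment> \<open>Coarea is available on compact sets of positive levels only. \<open>M1\<close>
    is finite and carried by the positive half-line, so inner regularity extends the comparison to
    all Borel sets, in particular to those needed for integrating arbitrary test functions.\<close>
  have le: "emeasure M1 B \<le> emeasure M2 B" if B[measurable]: "B \<in> sets borel" for B
  proof -
    have "emeasure M1 B = emeasure M1 (B \<inter> {0<..})"
    proof -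
      have "(\<integral>\<^sup>+s. indicator B s \<partial>M1) = (\<integral>\<^sup>+s. ennreal (indicator {0<..} s * (3 * om * (R s)\<^sup>2)) * indicator B s \<partial>lborel)"
        by (rule intM1) measurable
      also have "\<dots> = (\<integral>\<^sup>+s. ennreal (indicator {0<..} s * (3 * om * (R s)\<^sup>2)) * indicator (B \<inter> {0<..}) s \<partial>lborel)"
        by (intro nn_integral_cong) (auto simp: indicator_def)
      also have "\<dots> = (\<integral>\<^sup>+s. indicator (B \<inter> {0<..}) s \<partial>M1)"
        by (rule intM1[symmetric]) measurable
      finally show ?thesis by simp
    qed
    also have "\<dots> = (SUP K \<in> {K. K \<subseteq> B \<inter> {0<..} \<and> compact K}. emeasure M1 K)"
      using fM1 by (intro inner_regular) (auto simp: finite_measure_def finite_measure_axioms_def)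
    also have "\<dots> \<le> emeasure M2 B"
    proof (rule SUP_least)
      fix K assume K: "K \<in> {K. K \<subseteq> B \<inter> {0<..} \<and> compact K}"
      then have "emeasure M1 K \<le> emeasure M2 K" by (intro comp) auto
      also have "\<dots> \<le> emeasure M2 B" using K by (intro emeasure_mono) auto
      finally show "emeasure M1 K \<le> emeasure M2 B" .
    qed
    finally show ?thesis .
  qed
  \<comment> \<open>The laws of \<open>f\<close> and of its rearrangement, restricted to positive
    values. The value 0 is cut off because it is attained on a set of infinite measure, about which
    equimeasurability says nothing.\<close>
  define P1 where "P1 = density (distr (wmeasure \<alpha>) borel f) (indicator {0<..})"
  define P2 where "P2 = density (distr mS borel (\<lambda>z. \<psi> (rho z))) (indicator {0<..})"
  have P: "P1 = P2"
  proof (rule measure_eqI_lessThan)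
    have 1: "emeasure P1 {x<..} = m (max x 0)" for x
    proof -
      have "emeasure P1 {x<..} = (\<integral>\<^sup>+z. indicator {0<..} (f z) * indicator {x<..} (f z) \<partial>wmeasure \<alpha>)"
        unfolding P1_def by (simp add: emeasure_density nn_integral_distr)
      also have "\<dots> = (\<integral>\<^sup>+z. indicator {z. max x 0 < f z} z \<partial>wmeasure \<alpha>)"
        by (intro nn_integral_cong) (auto simp: indicator_def)
      finally show ?thesis by (simp add: m_def)
    qed
    have 2: "emeasure P2 {x<..} = emeasure mS {z. max x 0 < \<psi> (rho z)}" for x
    proof -
      have "emeasure P2 {x<..} = (\<integral>\<^sup>+z. indicator {0<..} (\<psi> (rho z)) * indicator {x<..} (\<psi> (rho z)) \<partial>mS)"
        unfolding P2_def by (simp add: emeasure_density nn_integral_distr)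
      also have "\<dots> = (\<integral>\<^sup>+z. indicator {z. max x 0 < \<psi> (rho z)} z \<partial>mS)"
        by (intro nn_integral_cong) (auto simp: indicator_def)
      finally show ?thesis by simp
    qed
    show "emeasure P1 {x<..} < \<infinity>" for x using mfin[of "max x 0"] by (auto simp: 1)
    \<comment> \<open>The level 0 is reached from positive levels by continuity from below.\<close>
    have eq0: "emeasure mS {z. 0 < \<psi> (rho z)} = m 0"
    proof -
      define e where "e n = inverse (real (Suc n))" for n
      have e: "decseq e" "\<And>n. e n > 0" by (auto simp: e_def decseq_def divide_simps)
      have U: "(\<Union>n. {z. e n < h z}) = {z. 0 < h z}" for h :: "real^3 \<Rightarrow> real"
      proof (intro set_eqI iffI)
        fix z assume "z \<in> {z. 0 < h z}"
        then have "0 < h z" by simp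
        then obtain n where "inverse (real (Suc n)) < h z" using reals_Archimedean by blast
        then show "z \<in> (\<Union>n. {z. e n < h z})" by (auto simp: e_def)
      qed (auto intro: less_trans[OF e(2)])
      have "emeasure mS {z. 0 < \<psi> (rho z)} = (SUP n. emeasure mS {z. e n < \<psi> (rho z)})"
        using decseqD[OF e(1)] unfolding U[symmetric]
        by (intro SUP_emeasure_incseq[symmetric]) (auto simp: incseq_def intro: order_le_less_trans)
      also have "\<dots> = (SUP n. emeasure (wmeasure \<alpha>) {z. e n < f z})" using equi e(2) by simp
      also have "\<dots> = m 0"
        unfolding m_def using decseqD[OF e(1)] unfolding U[symmetric]
        by (intro SUP_emeasure_incseq) (auto simp: incseq_def intro: order_le_less_trans)
      finally show ?thesis .
    qed
    show "emeasure P1 {x<..} = emeasure P2 {x<..}" for x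
      unfolding 1 2 using equi[of x] eq0 by (cases "x > 0") (auto simp: m_def max_def)
  qed (auto simp: P1_def P2_def)
  have key: "2 * (\<integral>\<^sup>+r. ennreal (c r) \<partial>distr M1 borel R) \<le> (\<integral>\<^sup>+r. ennreal ((c r)\<^sup>2) \<partial>rad) + E"
    if c[measurable]: "c \<in> borel_measurable rad" and c0: "\<And>r. c r \<ge> 0" for c :: "real \<Rightarrow> real"
  proof -
    have [measurable]: "c \<in> borel_measurable borel" using c by simp
    \<comment> \<open>\<open>Q\<close> contains every value at which \<open>\<psi>\<close> has a plateau; off \<open>Q\<close>, \<open>R\<close> inverts \<open>\<psi>\<close>.\<close>
    define Q where "Q = \<psi> ` \<rat>"
    have Qc: "countable Q" unfolding Q_def by (intro countable_image countable_rat)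
    have [measurable]: "Q \<in> sets borel"
      by (rule sets.countable[OF borel_closed[OF closed_singleton] Qc])
    \<comment> \<open>The radial test function transported to levels. Deleting the countable set
      \<open>Q\<close> changes nothing on the level side, which is absolutely continuous; on the
      radial side it ensures that \<open>G (\<psi> r)\<close> is either \<open>c r\<close> or
      0.\<close>
    define G where "G s = indicator ({0<..} - Q) s * c (R s)" for s
    have [measurable]: "G \<in> borel_measurable borel" unfolding G_def[abs_def] by measurable
    have G0: "G s \<ge> 0" for s using c0 by (simp add: G_def)
    have "2 * (\<integral>\<^sup>+r. ennreal (c r) \<partial>distr M1 borel R) = (\<integral>\<^sup>+s. ennreal (2 * c (R s)) \<partial>M1)"
      by (simp add: nn_integral_distr nn_integral_cmult[symmetric] ennreal_mult')
    also have "\<dots> = (\<integral>\<^sup>+s. ennreal (2 * G s) \<partial>M1)"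
      unfolding intM1
    proof (subst (1 2) intM1)
      have "AE s in lborel. s \<notin> Q"
        using countable_imp_null_set_lborel[OF Qc] AE_not_in by blast
      then show "(\<integral>\<^sup>+s. ennreal (indicator {0<..} s * (3 * om * (R s)\<^sup>2)) * ennreal (2 * c (R s)) \<partial>lborel) =
        (\<integral>\<^sup>+s. ennreal (indicator {0<..} s * (3 * om * (R s)\<^sup>2)) * ennreal (2 * G s) \<partial>lborel)"
        by (intro nn_integral_cong_AE) (auto elim!: eventually_mono simp: G_def indicator_def)
    qed auto
    also have "\<dots> \<le> (\<integral>\<^sup>+s. ennreal (2 * G s) \<partial>M2)"
      by (rule nn_integral_mono_of_emeasure_le) (auto simp: le)
    also have "\<dots> = (\<integral>\<^sup>+z. ennreal (wt z) * (ennreal (gnorm D z * cmod (hor z) powr (- \<alpha>)) * ennreal (2 * G (f z))) \<partial>lborel)"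
      by (rule intM2) measurable
    also have "\<dots> \<le> (\<integral>\<^sup>+z. ennreal (wt z) * ennreal ((G (f z))\<^sup>2) + ennreal ((gnorm D z)\<^sup>2) \<partial>lborel)"
    proof (intro nn_integral_mono)
      fix z
      have "ennreal (wt z) * (ennreal (gnorm D z * cmod (hor z) powr (- \<alpha>)) * ennreal (2 * G (f z)))
        = ennreal (2 * G (f z) * (gnorm D z * cmod (hor z) powr (- \<alpha>)) * wt z)"
        using G0 gnorm_nonneg by (simp add: ennreal_mult[symmetric] ac_simps)
      also have "\<dots> \<le> ennreal ((G (f z))\<^sup>2 * wt z + (gnorm D z)\<^sup>2)"
        by (intro ennreal_leI two_mult_le_add_wt G0)
      also have "\<dots> = ennreal (wt z) * ennreal ((G (f z))\<^sup>2) + ennreal ((gnorm D z)\<^sup>2)"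
        by (simp add: ennreal_mult ac_simps)
      finally show "ennreal (wt z) * (ennreal (gnorm D z * cmod (hor z) powr (- \<alpha>)) * ennreal (2 * G (f z)))
         \<le> ennreal (wt z) * ennreal ((G (f z))\<^sup>2) + ennreal ((gnorm D z)\<^sup>2)" .
    qed
    also have "\<dots> = (\<integral>\<^sup>+z. ennreal (wt z) * ennreal ((G (f z))\<^sup>2) \<partial>lborel) + E"
      unfolding E_def by (rule nn_integral_add) auto
    also have "(\<integral>\<^sup>+z. ennreal (wt z) * ennreal ((G (f z))\<^sup>2) \<partial>lborel) = (\<integral>\<^sup>+z. ennreal ((G (f z))\<^sup>2) \<partial>wmeasure \<alpha>)"
      by (simp add: nn_integral_wmeasure)
    also have "\<dots> = (\<integral>\<^sup>+s. ennreal ((G s)\<^sup>2) \<partial>P1)"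
      unfolding P1_def by (simp add: nn_integral_density nn_integral_distr)
        (intro nn_integral_cong, auto simp: G_def indicator_def)
    also have "\<dots> = (\<integral>\<^sup>+z. ennreal ((G (\<psi> (rho z)))\<^sup>2) \<partial>mS)"
      unfolding P P2_def by (simp add: nn_integral_density nn_integral_distr)
        (intro nn_integral_cong, auto simp: G_def indicator_def)
    also have "\<dots> = (\<integral>\<^sup>+r. ennreal ((G (\<psi> r))\<^sup>2) \<partial>rad)"
      by (rule nn_integral_radial) measurable
    also have "\<dots> \<le> (\<integral>\<^sup>+r. ennreal ((c r)\<^sup>2) \<partial>rad)"
    proof (rule nn_integral_mono_AE)
      have "AE r in rad. 0 < r" unfolding rad_def by (subst AE_density) (auto simp: indicator_def)
      then show "AE r in rad. ennreal ((G (\<psi> r))\<^sup>2) \<le> ennreal ((c r)\<^sup>2)"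
      proof eventually_elim
        case (elim r)
        show ?case
        proof (cases "0 < \<psi> r \<and> \<psi> r \<notin> Q")
          case True
          have "R (\<psi> r) \<le> r" using galois[of "\<psi> r" r] True elim by auto
          moreover have "\<not> R (\<psi> r) < r"
          proof
            assume "R (\<psi> r) < r"
            then obtain q where q: "q \<in> \<rat>" "R (\<psi> r) < q" "q < r" using Rats_dense_in_real by blast
            then have "q \<ge> 0" using Rnn[of "\<psi> r"] by linarith
            then have "\<psi> q \<le> \<psi> r" using galois[of "\<psi> r" q] True q by auto
            moreover have "\<psi> r \<le> \<psi> q" using antimonoD[OF psi(1)] q by simp
            ultimately have "\<psi> r \<in> Q" unfolding Q_def using q(1) by (metis antisym imageI)
            then show False using True by simp
          qed
          ultimately have "R (\<psi> r) = r" by simp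
          then show ?thesis using True by (simp add: G_def)
        qed (auto simp: G_def indicator_def)
      qed
    qed
    finally show ?thesis by (simp add: add_right_mono)
  qed
  have fN: "finite_measure (distr M1 borel R)"
    using fM1 by (rule finite_measure.finite_measure_distr) measurable
  obtain g where g: "g \<in> borel_measurable rad" "\<And>r. g r \<ge> 0" "distr M1 borel R = density rad (\<lambda>r. ennreal (g r))"
    "(\<integral>\<^sup>+r. ennreal ((g r)\<^sup>2) \<partial>rad) \<le> E"
    by (rule density_of_quadratic_bound[OF sigma_finite_rad _ fN _ key]) (use fin in \<open>auto simp: E_def\<close>)
  have gb[measurable]: "g \<in> borel_measurable borel" using g(1) by simp
  show thesis
  proof (rule that[OF gb g(2)])
    show "(\<integral>\<^sup>+r. ennreal ((g r)\<^sup>2) \<partial>rad) \<le> (\<integral>\<^sup>+z. ennreal ((gnorm D z)\<^sup>2) \<partial>lborel)" using g(4) by (simp add: E_def)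
    fix a :: real assume a: "a > 0"
    \<comment> \<open>The positive levels below \<open>\<psi> a\<close> are exactly those with
      \<open>R s > a\<close>, where \<open>R s\<close> is nonzero and the density of
      \<open>M1\<close> can be multiplied in and divided out. In the radial variable the same factor
      cancels against the density of \<open>rad\<close>.\<close>
    have "ennreal (\<psi> a) = emeasure lborel {0<..<\<psi> a}" using psi(3)[of a] by simp
    also have "\<dots> = (\<integral>\<^sup>+s. indicator {0<..<\<psi> a} s \<partial>lborel)" by simp
    also have "\<dots> = (\<integral>\<^sup>+s. ennreal (indicator {0<..} s * (3 * om * (R s)\<^sup>2)) * ennreal (indicator {a<..} (R s) / (3 * om * (R s)\<^sup>2)) \<partial>lborel)"
    proof (intro nn_integral_cong)
      fix s
      show "indicator {0<..<\<psi> a} s = ennreal (indicator {0<..} s * (3 * om * (R s)\<^sup>2)) * ennreal (indicator {a<..} (R s) / (3 * om * (R s)\<^sup>2))"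
        using galois[of s a] a om_pos by (auto simp: indicator_def ennreal_mult[symmetric])
    qed
    also have "\<dots> = (\<integral>\<^sup>+s. ennreal (indicator {a<..} (R s) / (3 * om * (R s)\<^sup>2)) \<partial>M1)"
      by (rule intM1[symmetric]) measurable
    also have "\<dots> = (\<integral>\<^sup>+r. ennreal (indicator {a<..} r / (3 * om * r\<^sup>2)) \<partial>distr M1 borel R)"
      by (rule nn_integral_distr[symmetric]) measurable
    also have "\<dots> = (\<integral>\<^sup>+r. ennreal (indicator {0<..} r * (3 * om * r\<^sup>2)) * (ennreal (g r) * ennreal (indicator {a<..} r / (3 * om * r\<^sup>2))) \<partial>lborel)"
      unfolding g(3) rad_def by (simp add: nn_integral_density)
    also have "\<dots> = (\<integral>\<^sup>+r. ennreal (g r) * indicator {a<..} r \<partial>lborel)"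
    proof (intro nn_integral_cong)
      fix r
      show "ennreal (indicator {0<..} r * (3 * om * r\<^sup>2)) * (ennreal (g r) * ennreal (indicator {a<..} r / (3 * om * r\<^sup>2))) = ennreal (g r) * indicator {a<..} r"
        using a om_pos g(2)[of r] by (auto simp: indicator_def ennreal_mult[symmetric])
    qed
    finally show "ennreal (\<psi> a) = (\<integral>\<^sup>+r. ennreal (g r) * indicator {a<..} r \<partial>lborel)" .
  qed
qed

end

section \<open>Weak derivatives of radial functions\<close>

definition grad3 :: "(real^3 \<Rightarrow> real) \<Rightarrow> real^3 \<Rightarrow> real^3" where
  "grad3 f z = (\<chi> i. pd f i z)"

lemma grad3_nth [simp]: "grad3 f z $ i = pd f i z"
  by (simp add: grad3_def)

lemma has_derivative_grad3:
  assumes "f differentiable (at z)"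
  shows "(f has_derivative (\<lambda>h. grad3 f z \<bullet> h)) (at z)"
proof -
  let ?D = "frechet_derivative f (at z)"
  have D: "(f has_derivative ?D) (at z)" using assms by (simp add: frechet_derivative_works)
  then have l: "linear ?D" by (rule has_derivative_linear)
  have "?D h = grad3 f z \<bullet> h" for h
  proof -
    have "?D h = ?D (\<Sum>i\<in>UNIV. h $ i *s axis i 1)" by (simp add: basis_expansion)
    also have "\<dots> = (\<Sum>i\<in>UNIV. h $ i * pd f i z)"
      by (simp add: linear_sum[OF l] linear_cmul[OF l] scalar_mult_eq_scaleR pd_def)
    finally show ?thesis by (simp add: inner_vec_def mult.commute)
  qed
  then have "?D = (\<lambda>h. grad3 f z \<bullet> h)" by (rule ext)
  with D show ?thesis by (simp only:)
qed

lemma smooth3_differentiable: "smooth3 f \<Longrightarrow> f differentiable (at z)"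
  by (auto elim: smooth3.cases)

lemma smooth3_pd: "smooth3 f \<Longrightarrow> smooth3 (pd f i)"
  by (auto elim: smooth3.cases)

lemma smooth3_continuous: "smooth3 f \<Longrightarrow> continuous_on A f"
  by (intro continuous_at_imp_continuous_on ballI differentiable_imp_continuous_within smooth3_differentiable)

lemma continuous_grad3:
  assumes "smooth3 f" shows "continuous_on A (grad3 f)"
  unfolding grad3_def[abs_def] by (intro continuous_intros smooth3_continuous smooth3_pd assms)

lemma grad3_eq_0:
  assumes "z \<notin> closure {z. f z \<noteq> 0}" shows "grad3 f z = 0"
proof -
  have o: "open (- closure {z. f z \<noteq> 0})" by (intro open_Compl closed_closure)
  have z: "z \<in> - closure {z. f z \<noteq> 0}" using assms by simp
  have f0: "0 = f x" if "x \<in> - closure {z. f z \<noteq> 0}" for x using that closure_subset[of "{z. f z \<noteq> 0}"] by auto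
  have "(f has_derivative (\<lambda>h. 0)) (at z)"
    by (rule has_derivative_transform_within_open[OF has_derivative_const o z f0])
  then have "frechet_derivative f (at z) = (\<lambda>h. 0)" by (rule frechet_derivative_at[symmetric])
  then show ?thesis by (simp add: vec_eq_iff pd_def)
qed

lemma smooth3_compact_support:
  assumes f: "smooth3 f" and c: "compact (closure {z. f z \<noteq> 0})"
  obtains R B where "R > 0" "B \<ge> 0" "\<And>z. norm z > R \<Longrightarrow> f z = 0" "\<And>z. norm z > R \<Longrightarrow> grad3 f z = 0"
    "\<And>z. \<bar>f z\<bar> \<le> B" "\<And>z. norm (grad3 f z) \<le> B" "\<And>x y. \<bar>f x - f y\<bar> \<le> B * norm (x - y)"
proof -
  let ?K = "closure {z. f z \<noteq> 0}"
  obtain R where R: "R > 0" "\<And>z. z \<in> ?K \<Longrightarrow> norm z \<le> R" using compact_imp_bounded[OF c] bounded_pos by blast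
  have "bounded (f ` ?K)" "bounded (grad3 f ` ?K)"
    using c f by (auto intro!: compact_imp_bounded compact_continuous_image smooth3_continuous continuous_grad3)
  then obtain b1 b2 where b: "\<And>z. z \<in> ?K \<Longrightarrow> norm (f z) \<le> b1" "\<And>z. z \<in> ?K \<Longrightarrow> norm (grad3 f z) \<le> b2"
    unfolding bounded_iff by blast
  define B where "B = max 0 (max b1 b2)"
  have out: "f z = 0" "grad3 f z = 0" if "z \<notin> ?K" for z
    using that closure_subset[of "{z. f z \<noteq> 0}"] grad3_eq_0[of z f] by auto
  have B1: "\<bar>f z\<bar> \<le> B" "norm (grad3 f z) \<le> B" for z
    using b[of z] out[of z] by (cases "z \<in> ?K"; force simp: B_def)+
  have "\<bar>f x - f y\<bar> \<le> B * norm (x - y)" for x y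
  proof -
    have "norm (f x - f y) \<le> B * norm (x - y)"
    proof (rule differentiable_bound[OF convex_UNIV])
      show "(f has_derivative (\<lambda>h. grad3 f z \<bullet> h)) (at z within UNIV)" for z
        using has_derivative_grad3[OF smooth3_differentiable[OF f]] by simp
      show "onorm (\<lambda>h. grad3 f z \<bullet> h) \<le> B" for z
      proof (rule onorm_bound)
        show "norm (grad3 f z \<bullet> h) \<le> B * norm h" for h
          using Cauchy_Schwarz_ineq2[of "grad3 f z" h] mult_right_mono[OF B1(2)[of z], of "norm h"] by simp
      qed (simp add: B_def)
    qed auto
    then show ?thesis by simp
  qed
  note lip = this
  have far: "z \<notin> ?K" if "norm z > R" for z using R(2)[of z] that by linarith
  have B0: "B \<ge> 0" by (simp add: B_def)
  show thesis
    by (rule that[OF R(1) B0 out(1)[OF far] out(2)[OF far] B1 lip])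
qed

text \<open>Difference quotients integrate to 0 by translation invariance, and the uniform bound on
  them lets dominated convergence carry this to the derivative. Differentiability is asked for
  almost everywhere only, so that products with a truncation such as
  \<open>max (rho z - x) 0\<close> are covered.\<close>

lemma integral_directional_derivative_zero:
  fixes w w' :: "real^3 \<Rightarrow> real" and e :: "real^3"
  assumes w[measurable]: "w \<in> borel_measurable borel" and w'[measurable]: "w' \<in> borel_measurable borel"
    and e: "norm e \<le> 1"
    and quot: "\<And>z t. 0 < t \<Longrightarrow> t \<le> 1 \<Longrightarrow> \<bar>w (z + t *\<^sub>R e) - w z\<bar> \<le> t * B" and B: "B \<ge> 0"
    and supp: "\<And>z. norm z > R \<Longrightarrow> w z = 0" and wi: "integrable lborel w"
    and der: "AE z in lborel. ((\<lambda>t. w (z + t *\<^sub>R e)) has_real_derivative w' z) (at 0)"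
  shows "integrable lborel w'" "(\<integral>z. w' z \<partial>lborel) = 0"
proof -
  define t where "t n = inverse (real (Suc n))" for n
  have t: "0 < t n" "t n \<le> 1" for n by (auto simp: t_def divide_simps)
  have t0: "filterlim t (at 0) sequentially"
    unfolding filterlim_at using t LIMSEQ_inverse_real_of_nat by (auto simp: t_def[abs_def] less_imp_neq[symmetric])
  define d where "d n z = (w (z + t n *\<^sub>R e) - w z) / t n" for n z
  have [measurable]: "d n \<in> borel_measurable borel" for n unfolding d_def[abs_def] by measurable
  have dz: "d n z = 0" if "norm z > R + 1" for n z
  proof -
    have "norm (t n *\<^sub>R e) \<le> 1" using t[of n] e by (simp add: mult_le_one)
    then have "norm (z + t n *\<^sub>R e) > R" using that norm_diff_ineq[of z "t n *\<^sub>R e"] by linarith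
    then show ?thesis using that supp by (simp add: d_def)
  qed
  have db: "\<bar>d n z\<bar> \<le> B" for n z
    using quot[OF t, of z n] t[of n] by (simp add: d_def abs_div_pos[symmetric] divide_le_eq mult.commute)
  have dom: "norm (d n z) \<le> B * indicator (cball 0 (R + 1)) z" for n z
    using db[of n z] dz[of z n] B by (cases "norm z > R + 1") auto
  have lim: "AE z in lborel. (\<lambda>n. d n z) \<longlonglongrightarrow> w' z"
    using der
  proof eventually_elim
    case (elim z)
    then have "((\<lambda>h. (w (z + h *\<^sub>R e) - w z) / h) \<longlongrightarrow> w' z) (at 0)"
      by (simp add: has_field_derivative_iff)
    from filterlim_compose[OF this t0] show ?case by (simp add: d_def)
  qed
  have ib: "integrable lborel (\<lambda>z::real^3. B * indicator (cball 0 (R + 1)) z)"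
    using emeasure_bounded_finite[of "cball 0 (R + 1) :: (real^3) set"]
    by (intro integrable_mult_right integrable_real_indicator) auto
  have "integrable lborel w' \<and> (\<lambda>n. \<integral>z. d n z \<partial>lborel) \<longlonglongrightarrow> (\<integral>z. w' z \<partial>lborel)"
    using integrable_dominated_convergence[OF _ _ ib lim] integral_dominated_convergence[OF _ _ ib lim] dom by auto
  moreover have "(\<integral>z. d n z \<partial>lborel) = 0" for n
  proof -
    let ?T = "\<lambda>z. t n *\<^sub>R e + z"
    have D: "distr lborel borel ?T = lborel" by (rule lborel_distr_plus)
    have "integrable lborel (\<lambda>z. w (?T z))"
      using wi integrable_distr_eq[of ?T lborel borel w] by (simp add: D)
    moreover have "(\<integral>z. w (?T z) \<partial>lborel) = (\<integral>z. w z \<partial>lborel)"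
      using integral_distr[of ?T lborel borel w] by (simp add: D)
    ultimately have tr: "has_bochner_integral lborel (\<lambda>z. w (z + t n *\<^sub>R e)) (\<integral>z. w z \<partial>lborel)"
      by (simp add: has_bochner_integral_iff add.commute)
    have "(\<integral>z. d n z \<partial>lborel) = ((\<integral>z. w (z + t n *\<^sub>R e) \<partial>lborel) - (\<integral>z. w z \<partial>lborel)) / t n"
      unfolding d_def using tr wi by (simp add: has_bochner_integral_iff)
    then show ?thesis using tr by (simp add: has_bochner_integral_iff)
  qed
  ultimately show "integrable lborel w'" "(\<integral>z. w' z \<partial>lborel) = 0"
    using LIMSEQ_unique[of "\<lambda>n. \<integral>z. d n z \<partial>lborel" 0] by auto
qed

lemma powr_diff_le:
  fixes a s t R :: real
  assumes "a > 1" "0 \<le> s" "s \<le> t" "t \<le> R"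
  shows "t powr a - s powr a \<le> a * R powr (a - 1) * (t - s)"
proof (cases "s = t")
  case False
  then have st: "s < t" using assms by simp
  have c: "continuous_on {s..t} (\<lambda>x. x powr a)"
    using assms by (intro continuous_on_powr' continuous_on_id continuous_on_const) auto
  have d: "((\<lambda>x. x powr a) has_derivative (\<lambda>h. (a * x powr (a - 1)) * h)) (at x)" if "s < x" "x < t" for x
    using has_real_derivative_powr[of x a] that assms by (simp add: has_field_derivative_def)
  obtain x where x: "s < x" "x < t" "t powr a - s powr a = a * x powr (a - 1) * (t - s)"
    using mvt[OF st c d] by blast
  have "x powr (a - 1) \<le> R powr (a - 1)" using x assms by (intro powr_mono2) auto
  then show ?thesis unfolding x(3) using assms st by (intro mult_right_mono mult_left_mono) auto
qed simp

lemma abs_powr_diff_le: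
  fixes a s t R :: real
  assumes "a > 1" "0 \<le> s" "s \<le> R" "0 \<le> t" "t \<le> R"
  shows "\<bar>t powr a - s powr a\<bar> \<le> a * R powr (a - 1) * \<bar>t - s\<bar>"
proof (cases "s \<le> t")
  case True
  then have "s powr a \<le> t powr a" using assms by (intro powr_mono2) auto
  then show ?thesis using powr_diff_le[of a s t R] True assms by simp
next
  case False
  then have "t powr a \<le> s powr a" using assms by (intro powr_mono2) auto
  then show ?thesis using powr_diff_le[of a t s R] False assms by (simp add: abs_minus_commute)
qed

section \<open>The flat radius, its gradient, and the chain rule for radial functions\<close>

context grushin
begin

text \<open>Here the modulus of \<open>hor z\<close> is raised to a power instead of
  \<open>hor z\<close> itself. This map depends on no branch, so a local Lipschitz bound for
  \<open>rho\<close> follows on all of space and not only on the sector.\<close>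

lemma rho_eq: "rho z = norm (pt (of_real (cmod (hor z) powr (\<alpha> + 1) / (\<alpha> + 1))) (z $ 3))"
proof -
  have "norm (pt (of_real (cmod (hor z) powr (\<alpha> + 1) / (\<alpha> + 1))) (z $ 3)) = norm (flat \<alpha> z)"
    using alpha_pos unfolding norm_3 by (simp add: norm_hor_flat norm_divide del: of_real_divide) (simp add: flat_def)
  then show ?thesis by (simp add: norm_flat)
qed

lemma rho_lipschitz:
  assumes "norm z \<le> R" "norm z' \<le> R"
  shows "\<bar>rho z - rho z'\<bar> \<le> (R powr \<alpha> + 1) * norm (z - z')"
proof -
  let ?r = "cmod (hor z)" and ?r' = "cmod (hor z')"
  have le: "?r \<le> R" "?r' \<le> R" using norm_hor_le[of z] norm_hor_le[of z'] assms by auto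
  have "\<bar>?r powr (\<alpha> + 1) - ?r' powr (\<alpha> + 1)\<bar> \<le> (\<alpha> + 1) * R powr \<alpha> * \<bar>?r - ?r'\<bar>"
    using abs_powr_diff_le[of "\<alpha> + 1" ?r' R ?r] le alpha_pos by simp
  also have "\<bar>?r - ?r'\<bar> \<le> norm (z - z')"
    using norm_triangle_ineq3[of "hor z" "hor z'"] norm_hor_le[of "z - z'"] by (simp add: hor_diff)
  finally have "\<bar>?r powr (\<alpha> + 1) - ?r' powr (\<alpha> + 1)\<bar> \<le> (\<alpha> + 1) * R powr \<alpha> * norm (z - z')"
    using alpha_pos by (simp add: mult_left_mono)
  then have 1: "\<bar>?r powr (\<alpha> + 1) / (\<alpha> + 1) - ?r' powr (\<alpha> + 1) / (\<alpha> + 1)\<bar> \<le> R powr \<alpha> * norm (z - z')"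
    using alpha_pos by (simp add: diff_divide_distrib[symmetric] abs_div_pos[symmetric] divide_le_eq algebra_simps)
  have 2: "\<bar>(z - z') $ 3\<bar> \<le> norm (z - z')" by (rule component_le_norm_cart)
  let ?p = "\<lambda>z. pt (of_real (cmod (hor z) powr (\<alpha> + 1) / (\<alpha> + 1))) (z $ 3)"
  have "\<bar>rho z - rho z'\<bar> \<le> norm (?p z - ?p z')"
    unfolding rho_eq by (rule norm_triangle_ineq3)
  also have "\<dots> \<le> cmod (hor (?p z - ?p z')) + \<bar>(?p z - ?p z') $ 3\<bar>" by (rule norm_le_hor)
  also have "cmod (hor (?p z - ?p z')) = \<bar>?r powr (\<alpha> + 1) / (\<alpha> + 1) - ?r' powr (\<alpha> + 1) / (\<alpha> + 1)\<bar>"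
    unfolding hor_diff hor_pt of_real_diff[symmetric] norm_of_real ..
  also have "\<bar>(?p z - ?p z') $ 3\<bar> = \<bar>(z - z') $ 3\<bar>" by simp
  finally show ?thesis using 1 2 by (simp add: algebra_simps)
qed

lemma continuous_on_rho: "continuous_on A (\<lambda>z. rho z)"
proof (rule continuous_at_imp_continuous_on, rule ballI)
  fix z :: "real^3"
  have "((\<lambda>z'. rho z' - rho z) \<longlongrightarrow> 0) (at z)"
  proof (rule Lim_null_comparison)
    show "eventually (\<lambda>z'. norm (rho z' - rho z) \<le> ((norm z + 1) powr \<alpha> + 1) * norm (z' - z)) (at z)"
      unfolding eventually_at
    proof (intro exI[of _ 1] conjI ballI impI)
      fix z' assume "z' \<noteq> z \<and> dist z' z < 1"
      then have "norm z' \<le> norm z + 1" using norm_triangle_sub[of z' z] by (simp add: dist_norm)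
      then show "norm (rho z' - rho z) \<le> ((norm z + 1) powr \<alpha> + 1) * norm (z' - z)"
        using rho_lipschitz[of z' "norm z + 1" z] by simp
    qed simp
    have "((\<lambda>z'. ((norm z + 1) powr \<alpha> + 1) * norm (z' - z)) \<longlongrightarrow> ((norm z + 1) powr \<alpha> + 1) * norm (z - z)) (at z)"
      by (intro tendsto_intros)
    then show "((\<lambda>z'. ((norm z + 1) powr \<alpha> + 1) * norm (z' - z)) \<longlongrightarrow> 0) (at z)" by simp
  qed
  then show "isCont (\<lambda>z. rho z) z" by (simp add: isCont_def LIM_zero_iff)
qed

lemma xnorm2_S_pos: "z \<in> S \<Longrightarrow> xnorm2 z > 0"
  using hor_S_nonzero(1) by (simp add: xnorm2_hor)

lemma rho_S_pos: "z \<in> S \<Longrightarrow> rho z > 0"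
proof -
  assume "z \<in> S"
  then have "flat \<alpha> z \<noteq> 0" using flat_in_W hor_S_nonzero(2)[of "flat \<alpha> z"] hor_0 by metis
  then show ?thesis using norm_flat[of z] by (metis zero_less_norm_iff)
qed

definition "grad_rho z = pt ((wt z / gauge \<alpha> z) *\<^sub>R hor z) ((\<alpha> + 1) * z $ 3 / gauge \<alpha> z)"

lemma has_derivative_rho:
  assumes z: "z \<in> S"
  shows "((\<lambda>z. rho z) has_derivative (\<lambda>h. grad_rho z \<bullet> h)) (at z)"
proof -
  let ?X = "\<lambda>z::real^3. xnorm2 z powr (\<alpha> + 1) + (\<alpha> + 1)\<^sup>2 * (z $ 3)\<^sup>2"
  have xi: "xnorm2 z > 0" using z by (rule xnorm2_S_pos)
  then have X: "?X z > 0" by (simp add: add_pos_nonneg)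
  have nth: "((\<lambda>z::real^3. z $ i) has_derivative (\<lambda>h. h $ i)) (at z)" for i
    by (rule bounded_linear_imp_has_derivative[OF bounded_linear_vec_nth])
  have dxi: "(xnorm2 has_derivative (\<lambda>h. 2 * (z$1 * h$1 + z$2 * h$2))) (at z)"
    unfolding xnorm2_def[abs_def] by (rule derivative_eq_intros nth refl)+ (simp add: algebra_simps)
  have "((\<lambda>x. x powr (\<alpha> + 1)) has_derivative (\<lambda>y. ((\<alpha> + 1) * xnorm2 z powr \<alpha>) * y)) (at (xnorm2 z))"
    using has_real_derivative_powr[OF xi, of "\<alpha> + 1"] by (simp add: has_field_derivative_def)
  note dpow = has_derivative_compose[OF dxi this]
  have dX: "(?X has_derivative (\<lambda>h. (\<alpha> + 1) * wt z * (2 * (z$1 * h$1 + z$2 * h$2)) + (\<alpha> + 1)\<^sup>2 * (2 * z $ 3 * h $ 3))) (at z)"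
    by (rule derivative_eq_intros dpow nth refl)+ (simp add: algebra_simps)
  have "(sqrt has_derivative (*) (inverse (sqrt (?X z)) / 2)) (at (?X z))"
    using DERIV_real_sqrt[OF X] by (simp add: has_field_derivative_def)
  note dg = has_derivative_compose[OF dX this]
  have eq: "gauge \<alpha> = (\<lambda>z. sqrt (?X z))" by (simp add: gauge_def fun_eq_iff)
  have "((\<lambda>z. gauge \<alpha> z / (\<alpha> + 1)) has_derivative (\<lambda>h. (inverse (sqrt (?X z)) / 2 * ((\<alpha> + 1) * wt z * (2 * (z$1 * h$1 + z$2 * h$2)) + (\<alpha> + 1)\<^sup>2 * (2 * z $ 3 * h $ 3))) / (\<alpha> + 1))) (at z)"
    unfolding eq divide_inverse by (rule has_derivative_mult_left[OF dg[unfolded divide_inverse]])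
  moreover have "(inverse (sqrt (?X z)) / 2 * ((\<alpha> + 1) * wt z * (2 * (z$1 * h$1 + z$2 * h$2)) + (\<alpha> + 1)\<^sup>2 * (2 * z $ 3 * h $ 3))) / (\<alpha> + 1) = grad_rho z \<bullet> h" for h
  proof -
    have a: "\<alpha> + 1 \<noteq> 0" using alpha_pos by simp
    have "grad_rho z \<bullet> h = inverse (sqrt (?X z)) * (wt z * (z$1 * h$1 + z$2 * h$2) + (\<alpha> + 1) * z$3 * h$3)"
      by (simp add: grad_rho_def inner_vec_def sum_3 hor_def gauge_def divide_inverse algebra_simps)
    also have "\<dots> = (inverse (sqrt (?X z)) / 2 * ((\<alpha> + 1) * wt z * (2 * (z$1 * h$1 + z$2 * h$2)) + (\<alpha> + 1)\<^sup>2 * (2 * z $ 3 * h $ 3))) / (\<alpha> + 1)"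
    proof -
      have "(\<alpha> + 1) * wt z * (2 * (z$1 * h$1 + z$2 * h$2)) + (\<alpha> + 1)\<^sup>2 * (2 * z $ 3 * h $ 3) =
        2 * (\<alpha> + 1) * (wt z * (z$1 * h$1 + z$2 * h$2) + (\<alpha> + 1) * z$3 * h$3)"
        by (simp add: power2_eq_square algebra_simps)
      then show ?thesis using a by simp
    qed
    finally show ?thesis ..
  qed
  ultimately show ?thesis by simp
qed

text \<open>The eikonal equation: in flat coordinates \<open>rho\<close> is the distance to the
  apex, with a gradient of length 1, and \<open>wt z\<close> is the squared conformal
  factor.\<close>

lemma grushin_sq_grad_rho:
  assumes z: "z \<in> S"
  shows "grushin_sq \<alpha> z (grad_rho z $ 1) (grad_rho z $ 2) (grad_rho z $ 3) = wt z"
proof -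
  let ?g = "gauge \<alpha> z"
  have g: "?g \<noteq> 0" using rho_S_pos[OF z] by auto
  have xi: "xnorm2 z > 0" using z by (rule xnorm2_S_pos)
  have g2: "?g\<^sup>2 = wt z * xnorm2 z + ((\<alpha> + 1) * z $ 3)\<^sup>2"
    using xi by (simp add: gauge_def powr_add power_mult_distrib add_nonneg_nonneg)
  have alg: "(w / g * x)\<^sup>2 + (w / g * y)\<^sup>2 + w * (b / g)\<^sup>2 = w * (w * (x\<^sup>2 + y\<^sup>2) + b\<^sup>2) / g\<^sup>2"
    if "g \<noteq> 0" for w g x y b :: real
    using that by (simp add: field_simps power2_eq_square)
  have "grushin_sq \<alpha> z (grad_rho z $ 1) (grad_rho z $ 2) (grad_rho z $ 3) =
     wt z * (wt z * ((z $ 1)\<^sup>2 + (z $ 2)\<^sup>2) + ((\<alpha> + 1) * z $ 3)\<^sup>2) / ?g\<^sup>2"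
    unfolding alg[OF g, symmetric] by (simp add: grushin_sq_def grad_rho_def hor_def)
  also have "(z $ 1)\<^sup>2 + (z $ 2)\<^sup>2 = xnorm2 z" by (simp add: xnorm2_def)
  finally have "grushin_sq \<alpha> z (grad_rho z $ 1) (grad_rho z $ 2) (grad_rho z $ 3) =
     wt z * (wt z * xnorm2 z + ((\<alpha> + 1) * z $ 3)\<^sup>2) / ?g\<^sup>2" .
  then show ?thesis using g by (simp add: g2[symmetric])
qed

lemma borel_measurable_grad_rho [measurable]: "grad_rho \<in> borel_measurable borel"
proof -
  have [measurable]: "(\<lambda>z::real^3. z $ 3) \<in> borel_measurable borel"
    by (intro borel_measurable_continuous_onI continuous_intros)
  show ?thesis unfolding grad_rho_def[abs_def] pt_def by measurable
qed

lemma continuous_on_grad_rho: "continuous_on S grad_rho"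
proof -
  have c: "continuous_on S (gauge \<alpha>)"
  proof -
    have "continuous_on S (\<lambda>z. (\<alpha> + 1) * rho z)" by (intro continuous_intros continuous_on_rho)
    then show ?thesis using alpha_pos by simp
  qed
  have x: "continuous_on S xnorm2" unfolding xnorm2_def[abs_def] by (intro continuous_intros)
  show ?thesis unfolding grad_rho_def[abs_def]
    using rho_S_pos xnorm2_S_pos alpha_pos
    by (intro continuous_intros c x) (auto simp: less_imp_neq[symmetric] dest: rho_S_pos xnorm2_S_pos)
qed

text \<open>\<open>rad\<close> has a density, so each sphere about the apex is null for
  \<open>mS\<close>, and on \<open>S\<close> the weight is positive.\<close>

lemma AE_rho_neq: "AE z in lborel. z \<in> S \<longrightarrow> rho z \<noteq> x"
proof -
  have "emeasure rad {x} = (\<integral>\<^sup>+r. ennreal (indicator {0<..} r * (3 * om * r\<^sup>2)) * indicator {x} r \<partial>lborel)"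
    unfolding rad_def by (subst emeasure_density) auto
  also have "\<dots> = (\<integral>\<^sup>+r. 0 \<partial>(lborel :: real measure))"
    using AE_lborel_singleton[of x] by (intro nn_integral_cong_AE) (auto elim!: eventually_mono)
  finally have "(\<integral>\<^sup>+z. indicator {x} (rho z) \<partial>mS) = 0"
    using nn_integral_radial[of "indicator {x}"] by simp
  then have "AE z in mS. rho z \<noteq> x" by (subst (asm) nn_integral_0_iff_AE) (auto simp: indicator_def elim!: eventually_mono)
  then have "AE z in lborel. indicator S z * wt z > 0 \<longrightarrow> rho z \<noteq> x"
    unfolding mS_def by (subst (asm) AE_density) auto
  then show ?thesis
    by eventually_elim (use xnorm2_S_pos in force)
qed

text \<open>The product of the truncation with \<open>f\<close> has almost everywhere the derivative
  given by the product rule: the kink is confined to a null sphere, and near points outside the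
  support of \<open>f\<close> the product vanishes. Integrating the derivative gives 0. These
  truncations are the building blocks from which general radial functions are assembled.\<close>

lemma integral_rho_grad:
  assumes f: "smooth3 f" "compact (closure {z. f z \<noteq> 0})" "closure {z. f z \<noteq> 0} \<subseteq> S"
  shows "integrable lborel (\<lambda>z. indicator {z. x < rho z} z * (grad_rho z $ i * f z))"
    and "(\<integral>z. indicator {z. x < rho z} z * (grad_rho z $ i * f z) \<partial>lborel) = - (\<integral>z. max (rho z - x) 0 * pd f i z \<partial>lborel)"
proof -
  define K where "K = closure {z. f z \<noteq> 0}"
  obtain R B where RB: "R > 0" "B \<ge> 0" "\<And>z. norm z > R \<Longrightarrow> f z = 0" "\<And>z. norm z > R \<Longrightarrow> grad3 f z = 0"
    "\<And>z. \<bar>f z\<bar> \<le> B" "\<And>z. norm (grad3 f z) \<le> B" "\<And>x y. \<bar>f x - f y\<bar> \<le> B * norm (x - y)"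
    using smooth3_compact_support[OF f(1,2)] by metis
  have [measurable]: "f \<in> borel_measurable borel" "pd f i \<in> borel_measurable borel"
    by (auto intro!: borel_measurable_continuous_onI smooth3_continuous smooth3_pd f)
  have fK: "f z = 0" "pd f i z = 0" if "z \<notin> K" for z
    using that closure_subset[of "{z. f z \<noteq> 0}"] grad3_eq_0[of z f] grad3_nth[of f z i] unfolding K_def by auto
  define e :: "real^3" where "e = axis i 1"
  have e: "norm e \<le> 1" by (simp add: e_def norm_axis_1)
  \<comment> \<open>A Lipschitz constant of \<open>rho\<close> on the ball of radius
    \<open>R + 2\<close>: difference quotients are compared at points of norm at most
    \<open>R + 1\<close>, shifted by at most 1.\<close>
  define M where "M = (R + 2) powr \<alpha> + 1"
  have M: "M > 0" by (simp add: M_def add_nonneg_pos)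
  define N where "N = \<bar>x\<bar> + (M * (R + 2) + rho 0)"
  have N: "N \<ge> 0" using M RB(1) rho_nonneg[of 0] by (simp add: N_def)
  have rN: "\<bar>max (rho z - x) 0\<bar> \<le> N" if "norm z \<le> R + 2" for z
  proof -
    have "\<bar>rho z - rho 0\<bar> \<le> M * norm z" using rho_lipschitz[OF that, of 0] RB(1) by (simp add: M_def)
    moreover have "M * norm z \<le> M * (R + 2)" using that M by (intro mult_left_mono) auto
    ultimately show ?thesis using rho_nonneg[of z] rho_nonneg[of 0] unfolding N_def by linarith
  qed
  define w where "w z = max (rho z - x) 0 * f z" for z
  define p where "p z = indicator {z. x < rho z} z * (grad_rho z $ i * f z)" for z
  define q where "q z = max (rho z - x) 0 * pd f i z" for z
  have [measurable]: "w \<in> borel_measurable borel" "p \<in> borel_measurable borel" "q \<in> borel_measurable borel"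
    unfolding w_def[abs_def] p_def[abs_def] q_def[abs_def] by measurable
  have integ: "integrable lborel h" if [measurable]: "h \<in> borel_measurable borel"
    and "\<And>z. norm z \<le> R \<Longrightarrow> \<bar>h z\<bar> \<le> C" "\<And>z. norm z > R \<Longrightarrow> h z = 0" for h :: "real^3 \<Rightarrow> real" and C
  proof (rule Bochner_Integration.integrable_bound)
    show "integrable lborel (\<lambda>z::real^3. C * indicator (cball 0 R) z)"
      using emeasure_bounded_finite[of "cball 0 R :: (real^3) set"]
      by (intro integrable_mult_right integrable_real_indicator) auto
    show "AE z in lborel. norm (h z) \<le> norm (C * indicator (cball 0 R) z)"
    proof (rule AE_I2)
      fix z show "norm (h z) \<le> norm (C * indicator (cball 0 R) z)"
        using that(2,3)[of z] by (cases "norm z \<le> R") auto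
    qed
  qed measurable
  have wB: "\<bar>w z\<bar> \<le> N * B" if "norm z \<le> R" for z
    using rN[of z] that RB(5)[of z] N unfolding w_def abs_mult by (intro mult_mono) auto
  have wi: "integrable lborel w" by (rule integ[OF _ wB]) (auto simp: w_def RB)
  have qB: "\<bar>q z\<bar> \<le> N * B" if "norm z \<le> R" for z
  proof -
    have "\<bar>pd f i z\<bar> \<le> B" using component_le_norm_cart[of "grad3 f z" i] RB(6)[of z] by simp
    then show ?thesis using rN[of z] that N unfolding q_def abs_mult by (intro mult_mono) auto
  qed
  have qi: "integrable lborel q"
  proof (rule integ[OF _ qB])
    show "q z = 0" if "norm z > R" for z using RB(4)[OF that] grad3_nth[of f z i] by (simp add: q_def)
  qed auto
  have quot: "\<bar>w (z + t *\<^sub>R e) - w z\<bar> \<le> t * (M * B + N * B)" if t: "0 < t" "t \<le> 1" for z t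
  proof (cases "norm z \<le> R + 1")
    case True
    let ?z = "z + t *\<^sub>R e"
    have te: "norm (t *\<^sub>R e) \<le> t" "norm (t *\<^sub>R e) \<le> 1" using t e by (auto simp: mult_left_le mult_le_one)
    have n: "norm z \<le> R + 2" "norm ?z \<le> R + 2" using True te norm_triangle_ineq[of z "t *\<^sub>R e"] by linarith+
    have "\<bar>rho ?z - rho z\<bar> \<le> M * norm (?z - z)" using rho_lipschitz[OF n(2,1)] by (simp add: M_def)
    also have "\<dots> \<le> M * t" using te M by (simp add: mult_left_mono)
    finally have 1: "\<bar>max (rho ?z - x) 0 - max (rho z - x) 0\<bar> \<le> M * t" by linarith
    have "\<bar>f ?z - f z\<bar> \<le> B * norm (?z - z)" by (rule RB(7))
    also have "\<dots> \<le> B * t" using te RB(2) by (simp add: mult_left_mono)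
    finally have 2: "\<bar>f ?z - f z\<bar> \<le> B * t" .
    have "w ?z - w z = (max (rho ?z - x) 0 - max (rho z - x) 0) * f z + max (rho ?z - x) 0 * (f ?z - f z)"
      by (simp add: w_def algebra_simps)
    then have "\<bar>w ?z - w z\<bar> \<le> \<bar>max (rho ?z - x) 0 - max (rho z - x) 0\<bar> * \<bar>f z\<bar> + \<bar>max (rho ?z - x) 0\<bar> * \<bar>f ?z - f z\<bar>"
      by (metis abs_mult abs_triangle_ineq)
    also have "\<dots> \<le> (M * t) * B + N * (B * t)"
      using 1 2 rN[OF n(2)] RB(5)[of z] M t N RB(2) by (intro add_mono mult_mono) auto
    finally show ?thesis by (simp add: algebra_simps)
  next
    case False
    have "norm (t *\<^sub>R e) \<le> 1" using t e by (simp add: mult_le_one)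
    then have "norm (z + t *\<^sub>R e) > R" using False norm_diff_ineq[of z "t *\<^sub>R e"] by linarith
    then show ?thesis using False RB(1,2,3) t M N by (simp add: w_def)
  qed
  have der: "AE z in lborel. ((\<lambda>t. w (z + t *\<^sub>R e)) has_real_derivative p z + q z) (at 0)"
    using AE_rho_neq[of x]
  proof eventually_elim
    case (elim z)
    have line: "((\<lambda>t. z + t *\<^sub>R e) has_derivative (\<lambda>t. t *\<^sub>R e)) (at 0)"
      by (auto intro!: derivative_eq_intros)
    have tend: "((\<lambda>t. z + t *\<^sub>R e) \<longlongrightarrow> z) (at 0)"
      using has_derivative_continuous[OF line] by (simp add: continuous_within)
    show ?case
    proof (cases "z \<in> K")
      case False
      have "open (- K)" unfolding K_def by (intro open_Compl closed_closure)
      then have ev: "eventually (\<lambda>t. z + t *\<^sub>R e \<in> - K) (at 0)"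
        using topological_tendstoD[OF tend] False by blast
      have "((\<lambda>t. w (z + t *\<^sub>R e)) has_real_derivative 0) (at 0) \<longleftrightarrow> ((\<lambda>t::real. 0::real) has_real_derivative 0) (at 0)"
        by (rule has_field_derivative_cong_eventually) (use ev False fK in \<open>auto simp: w_def elim!: eventually_mono\<close>)
      then show ?thesis using False fK by (simp add: p_def q_def)
    next
      case True
      then have zS: "z \<in> S" using f(3) unfolding K_def by blast
      then have neq: "rho z \<noteq> x" using elim by blast
      have "((\<lambda>t. rho (z + t *\<^sub>R e)) has_derivative (\<lambda>t. grad_rho z \<bullet> (t *\<^sub>R e))) (at 0)"
        using has_derivative_compose[OF line, of "\<lambda>z. rho z" "\<lambda>h. grad_rho z \<bullet> h"] has_derivative_rho[OF zS]
        by (simp del: inner_scaleR_right)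
      then have dr: "((\<lambda>t. rho (z + t *\<^sub>R e)) has_real_derivative grad_rho z $ i) (at 0)"
        by (rule has_derivative_imp_has_field_derivative) (simp add: e_def inner_axis)
      have "((\<lambda>t. f (z + t *\<^sub>R e)) has_derivative (\<lambda>t. grad3 f z \<bullet> (t *\<^sub>R e))) (at 0)"
        using has_derivative_compose[OF line, of f "\<lambda>h. grad3 f z \<bullet> h"] has_derivative_grad3[OF smooth3_differentiable[OF f(1)], of z]
        by (simp del: inner_scaleR_right)
      then have df: "((\<lambda>t. f (z + t *\<^sub>R e)) has_real_derivative pd f i z) (at 0)"
        by (rule has_derivative_imp_has_field_derivative) (simp add: e_def inner_axis)
      have tr: "((\<lambda>t. rho (z + t *\<^sub>R e)) \<longlongrightarrow> rho z) (at 0)"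
        using DERIV_isCont[OF dr] by (simp add: isCont_def)
      show ?thesis
      proof (cases "x < rho z")
        case True
        have ev: "eventually (\<lambda>t. x < rho (z + t *\<^sub>R e)) (at 0)" by (rule order_tendstoD(1)[OF tr True])
        have "((\<lambda>t. w (z + t *\<^sub>R e)) has_real_derivative p z + q z) (at 0) \<longleftrightarrow>
           ((\<lambda>t. (rho (z + t *\<^sub>R e) - x) * f (z + t *\<^sub>R e)) has_real_derivative p z + q z) (at 0)"
          by (rule has_field_derivative_cong_eventually) (use ev True in \<open>auto simp: w_def elim!: eventually_mono\<close>)
        moreover have "((\<lambda>t. (rho (z + t *\<^sub>R e) - x) * f (z + t *\<^sub>R e)) has_real_derivative p z + q z) (at 0)"
          by (rule derivative_eq_intros dr df refl)+ (use True in \<open>simp add: p_def q_def\<close>)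
        ultimately show ?thesis by blast
      next
        case False
        then have lt: "rho z < x" using neq by simp
        have ev: "eventually (\<lambda>t. rho (z + t *\<^sub>R e) < x) (at 0)" by (rule order_tendstoD(2)[OF tr lt])
        have "((\<lambda>t. w (z + t *\<^sub>R e)) has_real_derivative 0) (at 0) \<longleftrightarrow> ((\<lambda>t::real. 0::real) has_real_derivative 0) (at 0)"
          by (rule has_field_derivative_cong_eventually) (use ev lt in \<open>auto simp: w_def elim!: eventually_mono\<close>)
        then show ?thesis using lt by (simp add: p_def q_def)
      qed
    qed
  qed
  have MN: "M * B + N * B \<ge> 0" using M N RB(2) by simp
  have w0: "norm z > R \<Longrightarrow> w z = 0" for z by (simp add: w_def RB)
  have "integrable lborel (\<lambda>z. p z + q z)" "(\<integral>z. p z + q z \<partial>lborel) = 0"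
    using integral_directional_derivative_zero[of w "\<lambda>z. p z + q z", OF _ _ e quot MN w0 wi der] by auto
  moreover from this(1) have pi: "integrable lborel p"
    using Bochner_Integration.integrable_diff[OF _ qi, of "\<lambda>z. p z + q z"] by simp
  ultimately show "integrable lborel (\<lambda>z. indicator {z. x < rho z} z * (grad_rho z $ i * f z))"
    "(\<integral>z. indicator {z. x < rho z} z * (grad_rho z $ i * f z) \<partial>lborel) = - (\<integral>z. max (rho z - x) 0 * pd f i z \<partial>lborel)"
    using qi unfolding p_def[symmetric] q_def[symmetric] by auto
qed

lemma integral_pd_zero:
  assumes f: "smooth3 f" "compact (closure {z. f z \<noteq> 0})"
  shows "integrable lborel (pd f i)" "(\<integral>z. pd f i z \<partial>lborel) = 0"
proof -
  obtain R B where RB: "R > 0" "B \<ge> 0" "\<And>z. norm z > R \<Longrightarrow> f z = 0" "\<And>z. norm z > R \<Longrightarrow> grad3 f z = 0"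
    "\<And>z. \<bar>f z\<bar> \<le> B" "\<And>z. norm (grad3 f z) \<le> B" "\<And>x y. \<bar>f x - f y\<bar> \<le> B * norm (x - y)"
    using smooth3_compact_support[OF f] by metis
  have m: "f \<in> borel_measurable borel" "pd f i \<in> borel_measurable borel"
    by (auto intro!: borel_measurable_continuous_onI smooth3_continuous smooth3_pd f)
  define e :: "real^3" where "e = axis i 1"
  have e: "norm e \<le> 1" by (simp add: e_def norm_axis_1)
  have quot: "\<bar>f (z + t *\<^sub>R e) - f z\<bar> \<le> t * B" if t: "0 < t" "t \<le> 1" for z t
    using RB(7)[of "z + t *\<^sub>R e" z] t by (simp add: e_def norm_axis_1 mult.commute)
  have der: "AE z in lborel. ((\<lambda>t. f (z + t *\<^sub>R e)) has_real_derivative pd f i z) (at 0)"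
  proof (rule AE_I2)
    fix z
    have line: "((\<lambda>t. z + t *\<^sub>R e) has_derivative (\<lambda>t. t *\<^sub>R e)) (at 0)"
      by (auto intro!: derivative_eq_intros)
    have "((\<lambda>t. f (z + t *\<^sub>R e)) has_derivative (\<lambda>t. grad3 f z \<bullet> (t *\<^sub>R e))) (at 0)"
      using has_derivative_compose[OF line, of f "\<lambda>h. grad3 f z \<bullet> h"] has_derivative_grad3[OF smooth3_differentiable[OF f(1)], of z]
      by (simp del: inner_scaleR_right)
    then show "((\<lambda>t. f (z + t *\<^sub>R e)) has_real_derivative pd f i z) (at 0)"
      by (rule has_derivative_imp_has_field_derivative) (simp add: e_def inner_axis)
  qed
  have fi: "integrable lborel f"
  proof (rule Bochner_Integration.integrable_bound)
    show "integrable lborel (\<lambda>z::real^3. B * indicator (cball 0 R) z)"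
      using emeasure_bounded_finite[of "cball 0 R :: (real^3) set"]
      by (intro integrable_mult_right integrable_real_indicator) auto
    show "AE z in lborel. norm (f z) \<le> norm (B * indicator (cball 0 R) z)"
    proof (rule AE_I2)
      fix z show "norm (f z) \<le> norm (B * indicator (cball 0 R) z)"
        using RB(3,5)[of z] RB(2) by (cases "norm z \<le> R") auto
    qed
  qed (use m in simp)
  show "integrable lborel (pd f i)" "(\<integral>z. pd f i z \<partial>lborel) = 0"
    using integral_directional_derivative_zero[OF m e quot RB(2) RB(3) fi der] by auto
qed

text \<open>No pointwise chain rule is at hand, as \<open>g\<close> is only a density. Let
  \<open>q\<close> be the partial derivative of \<open>f\<close>, \<open>p\<close> the product of
  \<open>f\<close> with that of \<open>rho\<close>, and \<open>F s\<close> the integral of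
  \<open>q\<close> over \<open>rho < s\<close>. The truncation formula says that the signed measure
  p dz is carried by \<open>rho\<close> to F ds. Hence the integral of
  \<open>g (rho z) * p z\<close> equals that of \<open>g s * F s\<close>, and Fubini rewrites the
  latter as the integral of \<open>q\<close> against the tail integral of \<open>g\<close>, which is
  \<open>\<psi> (rho z)\<close>.\<close>

lemma integral_psi_pd:
  fixes g \<psi> :: "real \<Rightarrow> real"
  assumes f: "smooth3 f" "compact (closure {z. f z \<noteq> 0})" "closure {z. f z \<noteq> 0} \<subseteq> S"
    and g[measurable]: "g \<in> borel_measurable borel" and g0: "\<And>r. g r \<ge> 0"
    and psi: "antimono \<psi>" "\<And>r. \<psi> r \<ge> 0"
    and psi_eq: "\<And>a. a > 0 \<Longrightarrow> ennreal (\<psi> a) = (\<integral>\<^sup>+r. ennreal (g r) * indicator {a<..} r \<partial>lborel)"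
  shows "(\<integral>z. \<psi> (rho z) * pd f i z \<partial>lborel) = (\<integral>z. g (rho z) * (grad_rho z $ i * f z) \<partial>lborel)"
proof -
  define K where "K = closure {z. f z \<noteq> 0}"
  have K: "compact K" "K \<subseteq> S" using f by (auto simp: K_def)
  have [measurable]: "f \<in> borel_measurable borel" "pd f i \<in> borel_measurable borel"
    by (auto intro!: borel_measurable_continuous_onI smooth3_continuous smooth3_pd f)
  have [measurable]: "\<psi> \<in> borel_measurable borel" by (rule borel_measurable_antimono[OF psi(1)])
  have fK: "f z = 0" "pd f i z = 0" if "z \<notin> K" for z
    using that closure_subset[of "{z. f z \<noteq> 0}"] grad3_eq_0[of z f] grad3_nth[of f z i] unfolding K_def by auto
  define p where "p z = grad_rho z $ i * f z" for z
  define q where "q = pd f i"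
  have [measurable]: "p \<in> borel_measurable borel" "q \<in> borel_measurable borel" unfolding p_def[abs_def] q_def by measurable
  have pK: "p z = 0" "q z = 0" if "z \<notin> K" for z using fK that by (auto simp: p_def q_def)
  have qi: "integrable lborel q" and q0: "(\<integral>z. q z \<partial>lborel) = 0"
    unfolding q_def by (rule integral_pd_zero[OF f(1,2)])+
  have p1: "integrable lborel (\<lambda>z. indicator {z. x < rho z} z * p z)"
    and p2: "(\<integral>z. indicator {z. x < rho z} z * p z \<partial>lborel) = - (\<integral>z. max (rho z - x) 0 * q z \<partial>lborel)" for x
    unfolding p_def q_def by (rule integral_rho_grad[OF f])+
  \<comment> \<open>The support is compact in the open sector, so its radii stay away from 0; only
    there is \<open>g\<close> sure to be integrable.\<close>
  obtain r0 r1 where r: "0 < r0" "r0 \<le> r1" "\<And>z. z \<in> K \<Longrightarrow> r0 \<le> rho z" "\<And>z. z \<in> K \<Longrightarrow> rho z \<le> r1"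
  proof (cases "K = {}")
    case True
    then show thesis using that[of 1 2] by simp
  next
    case False
    obtain a where a: "a \<in> K" "\<And>z. z \<in> K \<Longrightarrow> rho a \<le> rho z"
      using continuous_attains_inf[OF K(1) False continuous_on_rho] by blast
    obtain b where b: "b \<in> K" "\<And>z. z \<in> K \<Longrightarrow> rho z \<le> rho b"
      using continuous_attains_sup[OF K(1) False continuous_on_rho] by blast
    have "rho a > 0" using a(1) K(2) rho_S_pos by blast
    then show thesis using that[of "rho a" "rho b"] a b by blast
  qed
  define J :: "real \<Rightarrow> real" where "J = indicator {r0..r1}"
  have [measurable]: "J \<in> borel_measurable borel" by (simp add: J_def)
  have J0: "J x \<ge> 0" for x by (simp add: J_def)
  define sw where "sw z = indicator S z * wt z" for z
  have [measurable]: "sw \<in> borel_measurable borel" unfolding sw_def[abs_def] by measurable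
  have sw0: "sw z \<ge> 0" for z by (simp add: sw_def)
  define rw where "rw r = indicator {0<..} r * (3 * om * r\<^sup>2)" for r :: real
  have [measurable]: "rw \<in> borel_measurable borel" unfolding rw_def[abs_def] by measurable
  have rw0: "rw r \<ge> 0" for r using om_pos by (simp add: rw_def)
  have radial: "(\<integral>\<^sup>+z. ennreal (sw z) * ennreal (F (rho z)) \<partial>lborel) = (\<integral>\<^sup>+r. ennreal (rw r) * ennreal (F r) \<partial>lborel)"
    if [measurable]: "F \<in> borel_measurable borel" for F :: "real \<Rightarrow> real"
    using nn_integral_radial[of "\<lambda>r. ennreal (F r)"]
    unfolding mS_def rad_def by (simp add: nn_integral_density sw_def rw_def)
  \<comment> \<open>On the compact support the weight is bounded below, so \<open>p\<close> is
    dominated by a multiple of the density of \<open>mS\<close>, localised to radii in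
    \<open>[r0, r1]\<close>.\<close>
  obtain c1 where c1: "c1 \<ge> 0" "\<And>z. \<bar>p z\<bar> \<le> c1 * (sw z * J (rho z))"
  proof -
    have wK: "wt z > 0" if "z \<in> K" for z using that K(2) xnorm2_S_pos[of z] by auto
    have "continuous_on K (\<lambda>z. p z / wt z)"
    proof -
      have "continuous_on K (\<lambda>z. wt z)" unfolding xnorm2_def
        using K(2) xnorm2_S_pos unfolding xnorm2_def by (intro continuous_intros) force
      moreover have "continuous_on K p" unfolding p_def[abs_def]
        by (intro continuous_intros continuous_on_subset[OF continuous_on_grad_rho K(2)] smooth3_continuous[OF f(1)])
      moreover have "\<forall>z\<in>K. wt z \<noteq> 0" using wK by force
      ultimately show ?thesis by (intro continuous_on_divide)
    qed
    then have "bounded ((\<lambda>z. p z / wt z) ` K)" using K(1) by (intro compact_imp_bounded compact_continuous_image)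
    then obtain b where b: "\<And>z. z \<in> K \<Longrightarrow> \<bar>p z / wt z\<bar> \<le> b" by (auto simp: bounded_iff)
    show thesis
    proof (rule that[of "max b 0"])
      fix z show "\<bar>p z\<bar> \<le> max b 0 * (sw z * J (rho z))"
      proof (cases "z \<in> K")
        case True
        then have e: "sw z * J (rho z) = wt z" using K(2) r by (auto simp: sw_def J_def)
        have "\<bar>p z\<bar> \<le> b * wt z" using b[OF True] wK[OF True] by (simp add: abs_div_pos[symmetric] divide_le_eq)
        also have "b * wt z \<le> max b 0 * wt z" by (intro mult_right_mono) auto
        finally show ?thesis unfolding e .
      qed (use pK sw0 J0 in simp)
    qed simp
  qed
  \<comment> \<open>\<open>F\<close> vanishes up to \<open>r0\<close> because the support of
    \<open>q\<close> is not yet reached, and beyond \<open>r1\<close> because the total integral of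
    \<open>q\<close> is 0.\<close>
  define F where "F r = (\<integral>z. (if rho z < r then q z else 0) \<partial>lborel)" for r
  have Fm[measurable]: "F \<in> borel_measurable borel" unfolding F_def[abs_def] by measurable
  define F0 where "F0 = (\<integral>z. \<bar>q z\<bar> \<partial>lborel)"
  have qr: "integrable lborel (\<lambda>z. if rho z < r then q z else 0)" for r
    by (rule Bochner_Integration.integrable_bound[OF qi]) auto
  have F0: "F0 \<ge> 0" by (simp add: F0_def)
  have FF0: "\<bar>F r\<bar> \<le> F0" for r
  proof -
    have "\<bar>F r\<bar> \<le> (\<integral>z. \<bar>if rho z < r then q z else 0\<bar> \<partial>lborel)" unfolding F_def by (rule integral_abs_bound)
    also have "\<dots> \<le> F0" unfolding F0_def using qi qr by (intro integral_mono) auto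
    finally show ?thesis .
  qed
  have Flow: "F s = 0" if "s \<le> r0" for s
  proof -
    have "(if rho z < s then q z else 0) = 0" for z using r(3)[of z] pK(2)[of z] that by (cases "z \<in> K") auto
    then show ?thesis by (simp add: F_def)
  qed
  have Fhigh: "F s = 0" if "r1 < s" for s
  proof -
    have "(if rho z < s then q z else 0) = q z" for z using r(4)[of z] pK(2)[of z] that by (cases "z \<in> K") auto
    then show ?thesis using q0 by (simp add: F_def)
  qed
  have Fub: "integrable lborel (\<lambda>s. k s * F s)"
      "(\<integral>s. k s * F s \<partial>lborel) = (\<integral>z. q z * (\<integral>s. k s * indicator {rho z<..} s \<partial>lborel) \<partial>lborel)"
    if k: "integrable lborel k" for k :: "real \<Rightarrow> real"
  proof -
    have [measurable]: "k \<in> borel_measurable borel" using borel_measurable_integrable[OF k] by simp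
    show "integrable lborel (\<lambda>s. k s * F s)"
    proof (rule Bochner_Integration.integrable_bound)
      show "integrable lborel (\<lambda>s. F0 * \<bar>k s\<bar>)" using k by auto
      show "AE s in lborel. norm (k s * F s) \<le> norm (F0 * \<bar>k s\<bar>)"
      proof (rule AE_I2)
        fix s show "norm (k s * F s) \<le> norm (F0 * \<bar>k s\<bar>)"
          using mult_right_mono[OF FF0[of s], of "\<bar>k s\<bar>"] F0 by (simp add: abs_mult mult.commute)
      qed
    qed measurable
    have ki: "integrable lborel (\<lambda>s. q z * (k s * indicator {rho z<..} s))" for z
    proof (intro integrable_mult_right)
      show "integrable lborel (\<lambda>s. k s * indicator {rho z<..} s)"
        by (rule Bochner_Integration.integrable_bound[OF k]) (auto simp: indicator_def)
    qed
    have "integrable (lborel \<Otimes>\<^sub>M lborel) (\<lambda>(z, s). q z * (k s * indicator {rho z<..} s))"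
    proof (rule lborel_pair.Fubini_integrable)
      have [measurable]: "(\<lambda>x::(real^3) \<times> real. indicator {rho (fst x)<..} (snd x) :: real) \<in> borel_measurable (lborel \<Otimes>\<^sub>M lborel)"
      proof -
        have "(\<lambda>x::(real^3) \<times> real. if rho (fst x) < snd x then 1 else 0 :: real) \<in> borel_measurable (lborel \<Otimes>\<^sub>M lborel)"
          by measurable
        then show ?thesis by (simp add: indicator_def[abs_def] of_bool_def)
      qed
      show "(\<lambda>(z, s). q z * (k s * indicator {rho z<..} s)) \<in> borel_measurable (lborel \<Otimes>\<^sub>M lborel)"
        unfolding case_prod_beta by measurable
      show "AE z in lborel. integrable lborel (\<lambda>s. case (z, s) of (z, s) \<Rightarrow> q z * (k s * indicator {rho z<..} s))"
        using ki by simp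
      show "integrable lborel (\<lambda>z. \<integral>s. norm (case (z, s) of (z, s) \<Rightarrow> q z * (k s * indicator {rho z<..} s)) \<partial>lborel)"
      proof (rule Bochner_Integration.integrable_bound)
        show "integrable lborel (\<lambda>z. \<bar>q z\<bar> * (\<integral>s. \<bar>k s\<bar> \<partial>lborel))" using qi by auto
        show "AE z in lborel. norm (\<integral>s. norm (case (z, s) of (z, s) \<Rightarrow> q z * (k s * indicator {rho z<..} s)) \<partial>lborel)
           \<le> norm (\<bar>q z\<bar> * (\<integral>s. \<bar>k s\<bar> \<partial>lborel))"
        proof (rule AE_I2)
          fix z
          have "(\<integral>s. norm (q z * (k s * indicator {rho z<..} s)) \<partial>lborel) \<le> (\<integral>s. \<bar>q z\<bar> * \<bar>k s\<bar> \<partial>lborel)"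
            using k by (intro integral_mono integrable_norm[OF ki[of z]]) (auto simp: abs_mult indicator_def)
          then show "norm (\<integral>s. norm (case (z, s) of (z, s) \<Rightarrow> q z * (k s * indicator {rho z<..} s)) \<partial>lborel)
           \<le> norm (\<bar>q z\<bar> * (\<integral>s. \<bar>k s\<bar> \<partial>lborel))" by (simp add: abs_mult)
        qed
        have "(\<lambda>z. \<integral>s. \<bar>q z\<bar> * (\<bar>k s\<bar> * (if rho z < s then 1 else 0)) \<partial>lborel) \<in> borel_measurable lborel"
          by measurable
        then show "(\<lambda>z. \<integral>s. norm (case (z, s) of (z, s) \<Rightarrow> q z * (k s * indicator {rho z<..} s)) \<partial>lborel) \<in> borel_measurable lborel"
          by (simp add: abs_mult indicator_def of_bool_def)
      qed
    qed
    from lborel_pair.Fubini_integral[OF this]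
    have "(\<integral>s. \<integral>z. q z * (k s * indicator {rho z<..} s) \<partial>lborel \<partial>lborel) = (\<integral>z. \<integral>s. q z * (k s * indicator {rho z<..} s) \<partial>lborel \<partial>lborel)" .
    moreover have "(\<integral>z. q z * (k s * indicator {rho z<..} s) \<partial>lborel) = k s * F s" for s
    proof -
      have "(\<integral>z. q z * (k s * indicator {rho z<..} s) \<partial>lborel) = (\<integral>z. k s * (if rho z < s then q z else 0) \<partial>lborel)"
        by (intro Bochner_Integration.integral_cong) (auto simp: indicator_def)
      then show ?thesis by (simp add: F_def)
    qed
    ultimately show "(\<integral>s. k s * F s \<partial>lborel) = (\<integral>z. q z * (\<integral>s. k s * indicator {rho z<..} s \<partial>lborel) \<partial>lborel)" by simp
  qed
  \<comment> \<open>The term \<open>c1\<close> pays for negative values of \<open>p\<close>; the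
    other term pays for those of \<open>F\<close>, since \<open>rw\<close> is at least
    \<open>3 * om * r0\<^sup>2\<close> on \<open>[r0, r1]\<close>.\<close>
  define c where "c = c1 + F0 / (3 * om * r0\<^sup>2)"
  have c: "c \<ge> c1" "c \<ge> 0" "F0 \<le> c * (3 * om * r0\<^sup>2)"
    using c1(1) F0 om_pos r(1) by (auto simp: c_def distrib_right)
  \<comment> \<open>\<open>p\<close> and \<open>F\<close> are signed; adding multiples of two radially corresponding densities makes both sides
    nonnegative, so that equality on half-lines extends to all Borel sets.\<close>
  define d1 where "d1 z = p z + c * (sw z * J (rho z))" for z
  define d2 where "d2 s = F s + c * (rw s * J s)" for s
  have [measurable]: "d1 \<in> borel_measurable borel" "d2 \<in> borel_measurable borel"
    unfolding d1_def[abs_def] d2_def[abs_def] by measurable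
  have d1: "d1 z \<ge> 0" for z
    using c1(2)[of z] mult_right_mono[OF c(1), of "sw z * J (rho z)"] sw0[of z] J0[of "rho z"] by (simp add: d1_def abs_le_iff)
  have d2: "d2 s \<ge> 0" for s
  proof (cases "r0 \<le> s \<and> s \<le> r1")
    case True
    then have "F0 \<le> c * rw s" using c(2,3) r(1) om_pos power_mono[of r0 s 2]
      by (auto simp: rw_def intro!: order_trans[OF c(3)] mult_left_mono)
    then show ?thesis using FF0[of s] True by (simp add: d2_def J_def abs_le_iff)
  next
    case False
    then have "F s = 0" using Flow[of s] Fhigh[of s] by linarith
    then show ?thesis using c(2) rw0 J0 by (simp add: d2_def)
  qed
  have fin: "(\<integral>\<^sup>+s. ennreal (rw s) * ennreal (J s * indicator {x<..} s) \<partial>lborel) < \<infinity>" for x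
  proof -
    have "(\<integral>\<^sup>+s. ennreal (rw s) * ennreal (J s * indicator {x<..} s) \<partial>lborel) \<le> (\<integral>\<^sup>+s. ennreal (rw s) * indicator {..<r1 + 1} s \<partial>lborel)"
      by (intro nn_integral_mono mult_left_mono) (auto simp: J_def indicator_def)
    also have "\<dots> = emeasure rad {..<r1 + 1}" unfolding rad_def rw_def by (subst emeasure_density) auto
    also have "\<dots> < \<infinity>" using r by (subst emeasure_rad_lessThan) auto
    finally show ?thesis .
  qed
  have pushforward: "distr (density lborel (\<lambda>z. ennreal (d1 z))) borel (\<lambda>z. rho z) = density lborel (\<lambda>s. ennreal (d2 s))"
  proof (rule measure_eqI_lessThan)
    fix x
    let ?a = "\<lambda>z. sw z * (J (rho z) * indicator {x<..} (rho z))" and ?b = "\<lambda>s. rw s * (J s * indicator {x<..} s)"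
    have nn: "(\<integral>\<^sup>+z. ennreal (?a z) \<partial>lborel) = (\<integral>\<^sup>+s. ennreal (?b s) \<partial>lborel)"
      using radial[of "\<lambda>s. J s * indicator {x<..} s"] sw0 rw0 by (simp add: ennreal_mult')
    have ib: "integrable lborel ?b"
      using fin[of x] rw0 J0 by (intro integrableI_nonneg) (auto simp: ennreal_mult' less_top)
    have ia: "integrable lborel ?a"
      using fin[of x] rw0 sw0 J0 nn by (intro integrableI_nonneg) (auto simp: ennreal_mult' less_top)
    have ab: "(\<integral>z. ?a z \<partial>lborel) = (\<integral>s. ?b s \<partial>lborel)"
      using nn rw0 sw0 J0 by (subst (1 2) integral_eq_nn_integral) auto
    have k: "integrable lborel (indicator {x<..r1} :: real \<Rightarrow> real)"
      using emeasure_bounded_finite[of "{x<..r1}"] by (intro integrable_real_indicator) auto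
    \<comment> \<open>The inner integral is the length of the levels between max(x, rho z) and
      \<open>r1\<close>. It splits off a term independent of \<open>z\<close>, which disappears on
      integration against \<open>q\<close>.\<close>
    have inner: "q z * (\<integral>s. indicator {x<..r1} s * indicator {rho z<..} s \<partial>lborel) = max (r1 - x) 0 * q z - max (rho z - x) 0 * q z" for z
    proof (cases "z \<in> K")
      case True
      have "(\<integral>s. indicator {x<..r1} s * indicator {rho z<..} s \<partial>lborel) = (\<integral>s. indicat_real {max x (rho z)<..r1} s \<partial>lborel)"
        by (intro Bochner_Integration.integral_cong) (auto simp: indicator_def)
      also have "\<dots> = max (r1 - max x (rho z)) 0" by (simp add: measure_def max_def)
      also have "\<dots> = max (r1 - x) 0 - max (rho z - x) 0" using r(4)[OF True] by (auto simp: max_def)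
      finally have e: "(\<integral>s. indicator {x<..r1} s * indicator {rho z<..} s \<partial>lborel) = max (r1 - x) 0 - max (rho z - x) 0" .
      show ?thesis unfolding e by (simp add: algebra_simps)
    qed (simp add: pK)
    have mq: "integrable lborel (\<lambda>z. max (rho z - x) 0 * q z)"
    proof (rule Bochner_Integration.integrable_bound)
      show "integrable lborel (\<lambda>z. max (r1 - x) 0 * q z)" using qi by auto
      show "AE z in lborel. norm (max (rho z - x) 0 * q z) \<le> norm (max (r1 - x) 0 * q z)"
      proof (rule AE_I2)
        fix z show "norm (max (rho z - x) 0 * q z) \<le> norm (max (r1 - x) 0 * q z)"
          using r(4)[of z] pK(2)[of z] by (cases "z \<in> K") (auto simp: abs_mult intro!: mult_right_mono)
      qed
    qed measurable
    have kF: "indicator {x<..r1} s * F s = indicator {x<..} s * F s" for s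
      using Fhigh[of s] by (auto simp: indicator_def)
    have "(\<integral>s. indicator {x<..} s * F s \<partial>lborel) = (\<integral>z. max (r1 - x) 0 * q z - max (rho z - x) 0 * q z \<partial>lborel)"
      using Fub(2)[OF k] unfolding inner kF .
    also have "\<dots> = - (\<integral>z. max (rho z - x) 0 * q z \<partial>lborel)" using mq qi q0 by simp
    finally have PF: "(\<integral>s. indicator {x<..} s * F s \<partial>lborel) = (\<integral>z. indicator {z. x < rho z} z * p z \<partial>lborel)"
      by (simp add: p2)
    have iF: "integrable lborel (\<lambda>s. indicator {x<..} s * F s)" using Fub(1)[OF k] unfolding kF .
    have "emeasure (distr (density lborel (\<lambda>z. ennreal (d1 z))) borel (\<lambda>z. rho z)) {x<..} = (\<integral>\<^sup>+z. ennreal (d1 z) * indicator {x<..} (rho z) \<partial>lborel)"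
      by (subst nn_integral_indicator[symmetric], simp, subst nn_integral_distr, simp, simp, subst nn_integral_density) auto
    also have "\<dots> = (\<integral>\<^sup>+z. ennreal (indicator {z. x < rho z} z * p z + c * ?a z) \<partial>lborel)"
      by (intro nn_integral_cong) (auto simp: d1_def indicator_def)
    also have "\<dots> = ennreal (\<integral>z. indicator {z. x < rho z} z * p z + c * ?a z \<partial>lborel)"
    proof (rule nn_integral_eq_integral)
      show "integrable lborel (\<lambda>z. indicator {z. x < rho z} z * p z + c * ?a z)" using p1 ia by auto
      show "AE z in lborel. 0 \<le> indicator {z. x < rho z} z * p z + c * ?a z"
        using d1 by (intro AE_I2) (auto simp: d1_def indicator_def)
    qed
    finally have L: "emeasure (distr (density lborel (\<lambda>z. ennreal (d1 z))) borel (\<lambda>z. rho z)) {x<..}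
      = ennreal (\<integral>z. indicator {z. x < rho z} z * p z + c * ?a z \<partial>lborel)" .
    also have "(\<integral>z. indicator {z. x < rho z} z * p z + c * ?a z \<partial>lborel) = (\<integral>s. indicator {x<..} s * F s + c * ?b s \<partial>lborel)"
      using p1 ia ib iF PF ab by simp
    also have "ennreal \<dots> = (\<integral>\<^sup>+s. ennreal (indicator {x<..} s * F s + c * ?b s) \<partial>lborel)"
    proof (rule nn_integral_eq_integral[symmetric])
      show "integrable lborel (\<lambda>s. indicator {x<..} s * F s + c * ?b s)" using iF ib by auto
      show "AE s in lborel. 0 \<le> indicator {x<..} s * F s + c * ?b s"
        using d2 by (intro AE_I2) (auto simp: d2_def indicator_def)
    qed
    also have "\<dots> = (\<integral>\<^sup>+s. ennreal (d2 s) * indicator {x<..} s \<partial>lborel)"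
      by (intro nn_integral_cong) (auto simp: d2_def indicator_def)
    also have "\<dots> = emeasure (density lborel (\<lambda>s. ennreal (d2 s))) {x<..}"
      by (subst emeasure_density) auto
    finally show eq: "emeasure (distr (density lborel (\<lambda>z. ennreal (d1 z))) borel (\<lambda>z. rho z)) {x<..} = emeasure (density lborel (\<lambda>s. ennreal (d2 s))) {x<..}" .
    show "emeasure (distr (density lborel (\<lambda>z. ennreal (d1 z))) borel (\<lambda>z. rho z)) {x<..} < \<infinity>"
      unfolding L by simp
  qed auto
  have psi_int: "integrable lborel (\<lambda>s. g s * indicator {a<..} s)" "(\<integral>s. g s * indicator {a<..} s \<partial>lborel) = \<psi> a" if a: "a > 0" for a
  proof -
    have e: "(\<integral>\<^sup>+s. ennreal (g s * indicator {a<..} s) \<partial>lborel) = ennreal (\<psi> a)"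
      unfolding psi_eq[OF a] by (intro nn_integral_cong) (auto simp: indicator_def)
    have "has_bochner_integral lborel (\<lambda>s. g s * indicator {a<..} s) (\<psi> a)"
      by (rule has_bochner_integral_nn_integral[OF _ _ _ e]) (use g0 psi in auto)
    then show "integrable lborel (\<lambda>s. g s * indicator {a<..} s)" "(\<integral>s. g s * indicator {a<..} s \<partial>lborel) = \<psi> a"
      by (auto simp: has_bochner_integral_iff)
  qed
  \<comment> \<open>An integrable truncation of \<open>g\<close> that agrees with it wherever
    \<open>F\<close> can be nonzero. The left end lies strictly below \<open>r0\<close> so that the
    interval contains the closed range \<open>[r0, r1]\<close> used in \<open>J\<close>.\<close>
  define k where "k s = g s * indicator {r0/2<..r1} s" for s
  have [measurable]: "k \<in> borel_measurable borel" unfolding k_def[abs_def] by measurable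
  have ki: "integrable lborel k"
    by (rule Bochner_Integration.integrable_bound[OF psi_int(1)[of "r0/2"]]) (use r(1) in \<open>auto simp: k_def[abs_def] indicator_def\<close>)
  have gF: "g s * F s = k s * F s" for s
  proof (cases "s \<le> r0 \<or> r1 < s")
    case True
    then have "F s = 0" using Flow[of s] Fhigh[of s] by blast
    then show ?thesis by simp
  next
    case False
    then show ?thesis using r(1) by (simp add: k_def indicator_def)
  qed
  let ?B = "\<lambda>s. rw s * (J s * g s)" and ?A = "\<lambda>z. sw z * (J (rho z) * g (rho z))"
  have iB: "integrable lborel ?B"
  proof (rule Bochner_Integration.integrable_bound)
    show "integrable lborel (\<lambda>s. (3 * om * r1\<^sup>2) * k s)" using ki by auto
    show "AE s in lborel. norm (?B s) \<le> norm (3 * om * r1\<^sup>2 * k s)"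
    proof (rule AE_I2)
      fix s show "norm (?B s) \<le> norm (3 * om * r1\<^sup>2 * k s)"
        using om_pos g0[of s] r(1) by (auto simp: rw_def J_def k_def indicator_def abs_mult intro!: mult_right_mono power_mono)
    qed
  qed measurable
  have AB: "(\<integral>\<^sup>+z. ennreal (?A z) \<partial>lborel) = (\<integral>\<^sup>+s. ennreal (?B s) \<partial>lborel)"
    using radial[of "\<lambda>s. J s * g s"] sw0 rw0 by (simp add: ennreal_mult')
  have A0: "?A z \<ge> 0" and B0: "?B s \<ge> 0" for z s using sw0 rw0 J0 g0 by auto
  have "(\<integral>\<^sup>+s. ennreal (?B s) \<partial>lborel) < \<infinity>"
    using iB B0 by (simp add: integrable_iff_bounded)
  then have iA: "integrable lborel ?A"
    using A0 AB by (intro integrableI_nonneg) auto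
  have AB': "(\<integral>z. ?A z \<partial>lborel) = (\<integral>s. ?B s \<partial>lborel)"
    using AB A0 B0 by (subst (1 2) integral_eq_nn_integral) auto
  have ip: "integrable lborel (\<lambda>z. g (rho z) * p z)"
  proof (rule Bochner_Integration.integrable_bound)
    show "integrable lborel (\<lambda>z. c1 * ?A z)" using iA by auto
    show "AE z in lborel. norm (g (rho z) * p z) \<le> norm (c1 * ?A z)"
    proof (rule AE_I2)
      fix z
      have "g (rho z) * \<bar>p z\<bar> \<le> g (rho z) * (c1 * (sw z * J (rho z)))" using c1(2)[of z] g0 by (rule mult_left_mono)
      also have "\<dots> = c1 * ?A z" by (simp add: algebra_simps)
      finally have "\<bar>g (rho z) * p z\<bar> \<le> c1 * ?A z" using g0 by (simp add: abs_mult)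
      then show "norm (g (rho z) * p z) \<le> norm (c1 * ?A z)" by (metis abs_ge_self order_trans real_norm_def)
    qed
  qed measurable
  have iF: "integrable lborel (\<lambda>s. g s * F s)" unfolding gF by (rule Fub(1)[OF ki])
  have "(\<integral>\<^sup>+z. ennreal (g (rho z) * p z + c * ?A z) \<partial>lborel) = (\<integral>\<^sup>+z. ennreal (d1 z) * ennreal (g (rho z)) \<partial>lborel)"
    using d1 g0 by (intro nn_integral_cong) (simp add: ennreal_mult[symmetric] d1_def algebra_simps)
  also have "\<dots> = (\<integral>\<^sup>+s. ennreal (g s) \<partial>distr (density lborel (\<lambda>z. ennreal (d1 z))) borel (\<lambda>z. rho z))"
    by (subst nn_integral_distr, simp, simp, subst nn_integral_density) auto
  also have "\<dots> = (\<integral>\<^sup>+s. ennreal (d2 s) * ennreal (g s) \<partial>lborel)"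
    unfolding pushforward by (subst nn_integral_density) auto
  also have "\<dots> = (\<integral>\<^sup>+s. ennreal (g s * F s + c * ?B s) \<partial>lborel)"
    using d2 g0 by (intro nn_integral_cong) (simp add: ennreal_mult[symmetric] d2_def algebra_simps)
  finally have eq: "(\<integral>\<^sup>+z. ennreal (g (rho z) * p z + c * ?A z) \<partial>lborel) = (\<integral>\<^sup>+s. ennreal (g s * F s + c * ?B s) \<partial>lborel)" .
  have n1: "g (rho z) * p z + c * ?A z \<ge> 0" for z
  proof -
    have "g (rho z) * d1 z \<ge> 0" using g0 d1 by simp
    then show ?thesis by (simp add: d1_def algebra_simps)
  qed
  have n2: "g s * F s + c * ?B s \<ge> 0" for s
  proof -
    have "g s * d2 s \<ge> 0" using g0 d2 by simp
    then show ?thesis by (simp add: d2_def algebra_simps)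
  qed
  have "(\<integral>z. g (rho z) * p z + c * ?A z \<partial>lborel) = (\<integral>s. g s * F s + c * ?B s \<partial>lborel)"
    using eq n1 n2 by (subst (1 2) integral_eq_nn_integral) auto
  then have "(\<integral>z. g (rho z) * p z \<partial>lborel) = (\<integral>s. g s * F s \<partial>lborel)"
    using ip iA iF iB AB' by simp
  also have "\<dots> = (\<integral>z. q z * (\<integral>s. k s * indicator {rho z<..} s \<partial>lborel) \<partial>lborel)"
    unfolding gF by (rule Fub(2)[OF ki])
  \<comment> \<open>Truncating at \<open>r1\<close> subtracts the constant \<open>\<psi> r1\<close>
    from the tail integral, which is harmless because \<open>q\<close> has integral 0.\<close>
  also have "\<dots> = (\<integral>z. \<psi> (rho z) * q z - \<psi> r1 * q z \<partial>lborel)"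
  proof (rule Bochner_Integration.integral_cong[OF refl])
    fix z
    show "q z * (\<integral>s. k s * indicator {rho z<..} s \<partial>lborel) = \<psi> (rho z) * q z - \<psi> r1 * q z"
    proof (cases "z \<in> K")
      case True
      have pos: "rho z > 0" "r1 > 0" using r(1,2) r(3)[OF True] by auto
      have "(\<integral>s. k s * indicator {rho z<..} s \<partial>lborel) = (\<integral>s. g s * indicator {rho z<..} s - g s * indicator {r1<..} s \<partial>lborel)"
        using r(1) r(3,4)[OF True] by (intro Bochner_Integration.integral_cong) (auto simp: k_def indicator_def)
      also have "\<dots> = \<psi> (rho z) - \<psi> r1"
        using psi_int[OF pos(1)] psi_int[OF pos(2)] by simp
      finally have e: "(\<integral>s. k s * indicator {rho z<..} s \<partial>lborel) = \<psi> (rho z) - \<psi> r1" .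
      show ?thesis unfolding e by (simp add: algebra_simps)
    qed (simp add: pK)
  qed
  also have "\<dots> = (\<integral>z. \<psi> (rho z) * q z \<partial>lborel)"
  proof -
    have "integrable lborel (\<lambda>z. \<psi> (rho z) * q z)"
    proof (rule Bochner_Integration.integrable_bound)
      show "integrable lborel (\<lambda>z. \<psi> r0 * q z)" using qi by auto
      show "AE z in lborel. norm (\<psi> (rho z) * q z) \<le> norm (\<psi> r0 * q z)"
      proof (rule AE_I2)
        fix z show "norm (\<psi> (rho z) * q z) \<le> norm (\<psi> r0 * q z)"
          using antimonoD[OF psi(1), of r0 "rho z"] r(3)[of z] psi(2) pK(2)[of z]
          by (cases "z \<in> K") (auto simp: abs_mult intro!: mult_right_mono)
      qed
    qed measurable
    then show ?thesis using qi q0 by simp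
  qed
  finally show ?thesis unfolding p_def q_def by simp
qed

section \<open>Null boundary of the sector and the weak derivatives of the rearrangement\<close>

lemma convex_S: "convex S"
proof (rule convexI)
  fix x y :: "real^3" and a b :: real
  assume *: "x \<in> S" "y \<in> S" "0 \<le> a" "0 \<le> b" "a + b = 1"
  consider "a = 0" | "b = 0" | "a > 0" "b > 0" using * by linarith
  then show "a *\<^sub>R x + b *\<^sub>R y \<in> S"
  proof cases
    case 3
    then show ?thesis using * unfolding S_wedge by (intro wedge_add[OF angle_S]) (simp_all add: wedge_scaleR)
  qed (use * in auto)
qed

lemma AE_closure_S: "AE z in lborel. z \<in> closure S \<longrightarrow> z \<in> S"
proof (rule AE_I')
  have "negligible (frontier S)" by (rule negligible_convex_frontier[OF convex_S])
  then have "frontier S \<in> null_sets lebesgue" by (simp add: negligible_iff_null_sets)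
  moreover have "frontier S \<in> sets lborel" by (simp add: borel_closed frontier_closed)
  ultimately show "frontier S \<in> null_sets lborel" by (simp add: null_sets_completion_iff)
  show "{z \<in> space lborel. \<not> (z \<in> closure S \<longrightarrow> z \<in> S)} \<subseteq> frontier S"
    using interior_subset by (auto simp: frontier_def)
qed

text \<open>The sector is convex, so its frontier is a null set; this reconciles equimeasurability,
  which is posed on the closure, with \<open>mS\<close>, which lives on the open sector.\<close>

lemma emeasure_closure_S:
  assumes [measurable]: "{z. P z} \<in> sets borel"
  shows "emeasure (wmeasure \<alpha>) {z \<in> closure S. P z} = emeasure mS {z. P z}"
proof -
  have c[measurable]: "closure S \<in> sets borel" by (simp add: borel_closed)
  have "{z \<in> closure S. P z} = closure S \<inter> {z. P z}" by auto
  then have [measurable]: "{z \<in> closure S. P z} \<in> sets borel" by simp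
  have "emeasure (wmeasure \<alpha>) {z \<in> closure S. P z} = (\<integral>\<^sup>+z. ennreal (wt z) * indicator {z \<in> closure S. P z} z \<partial>lborel)"
    unfolding wmeasure_def by (subst emeasure_density) auto
  also have "\<dots> = (\<integral>\<^sup>+z. ennreal (indicator S z * wt z) * indicator {z. P z} z \<partial>lborel)"
  proof (rule nn_integral_cong_AE)
    show "AE z in lborel. ennreal (wt z) * indicator {z \<in> closure S. P z} z = ennreal (indicator S z * wt z) * indicator {z. P z} z"
      using AE_closure_S
    proof eventually_elim
      case (elim z)
      then show ?case using closure_subset[of S] by (cases "z \<in> S") (auto simp: indicator_def)
    qed
  qed
  also have "\<dots> = emeasure mS {z. P z}"
    unfolding mS_def by (subst emeasure_density) auto
  finally show ?thesis .
qed

text \<open>The duality argument needs a finite energy bound; it holds because the gradient is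
  bounded with compact support and the weight is locally bounded.\<close>

lemma nn_integral_gnorm_grad3_finite:
  assumes "smooth3 f" "compact (closure {z. f z \<noteq> 0})"
  shows "(\<integral>\<^sup>+z. ennreal ((gnorm (grad3 f) z)\<^sup>2) \<partial>lborel) < \<infinity>"
proof -
  obtain R B where RB: "R > 0" "B \<ge> 0" "\<And>z. norm z > R \<Longrightarrow> f z = 0" "\<And>z. norm z > R \<Longrightarrow> grad3 f z = 0"
    "\<And>z. \<bar>f z\<bar> \<le> B" "\<And>z. norm (grad3 f z) \<le> B" "\<And>x y. \<bar>f x - f y\<bar> \<le> B * norm (x - y)"
    using smooth3_compact_support[OF assms] by metis
  define C where "C = B\<^sup>2 + B\<^sup>2 + (R\<^sup>2) powr \<alpha> * B\<^sup>2"
  have "(\<integral>\<^sup>+z. ennreal ((gnorm (grad3 f) z)\<^sup>2) \<partial>lborel) \<le> (\<integral>\<^sup>+z. ennreal C * indicator (cball 0 R) z \<partial>(lborel :: (real^3) measure))"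
  proof (intro nn_integral_mono)
    fix z :: "real^3"
    show "ennreal ((gnorm (grad3 f) z)\<^sup>2) \<le> ennreal C * indicator (cball 0 R) z"
    proof (cases "norm z \<le> R")
      case True
      have p: "(pd f i z)\<^sup>2 \<le> B\<^sup>2" for i
      proof -
        have "\<bar>pd f i z\<bar> \<le> B" using component_le_norm_cart[of "grad3 f z" i] RB(6)[of z] by simp
        then show ?thesis using RB(2) by (simp add: abs_le_square_iff[symmetric])
      qed
      have "cmod (hor z) \<le> R" using norm_hor_le[of z] True by simp
      then have "xnorm2 z \<le> R\<^sup>2" unfolding xnorm2_hor by (rule power_mono) simp
      then have w: "wt z \<le> (R\<^sup>2) powr \<alpha>" using alpha_pos by (intro powr_mono2) (auto simp: xnorm2_def)
      have "(gnorm (grad3 f) z)\<^sup>2 \<le> C"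
        unfolding gnorm_sq grushin_sq_def C_def grad3_nth by (intro add_mono mult_mono p w) auto
      then show ?thesis using True by (simp add: ennreal_leI)
    next
      case False
      then have "grad3 f z = 0" using RB(4) by simp
      then have "pd f i z = 0" for i using grad3_nth[of f z i] by simp
      then show ?thesis by (simp add: gnorm_sq grushin_sq_def)
    qed
  qed
  also have "\<dots> = ennreal C * emeasure lborel (cball 0 R :: (real^3) set)" by (rule nn_integral_cmult_indicator) auto
  also have "\<dots> < \<infinity>" using emeasure_bounded_finite[of "cball 0 R :: (real^3) set"] by (simp add: ennreal_mult_less_top)
  finally show ?thesis .
qed

text \<open>Since \<open>g\<close> is minus the derivative of \<open>\<psi>\<close>, the weak
  gradient is \<open>- (g (rho z))\<close> times that of \<open>rho\<close>. Its local integrability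
  comes from the weighted square bound: on a compact part of the sector the weight is bounded below,
  and t <= 1 + t^2.\<close>

lemma weak_pd_radial:
  fixes g \<psi> :: "real \<Rightarrow> real"
  assumes g[measurable]: "g \<in> borel_measurable borel" and g0: "\<And>r. g r \<ge> 0"
    and psi: "antimono \<psi>" "\<And>r. \<psi> r \<ge> 0"
    and psi_eq: "\<And>a. a > 0 \<Longrightarrow> ennreal (\<psi> a) = (\<integral>\<^sup>+r. ennreal (g r) * indicator {a<..} r \<partial>lborel)"
    and fin: "(\<integral>\<^sup>+r. ennreal ((g r)\<^sup>2) \<partial>rad) < \<infinity>"
  shows "weak_pd S (\<lambda>z. \<psi> (rho z)) i (\<lambda>z. - (g (rho z) * grad_rho z $ i))"
  unfolding weak_pd_def
proof (intro conjI allI impI)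
  show "(\<lambda>z. - (g (rho z) * grad_rho z $ i)) \<in> borel_measurable lborel" by measurable
next
  fix K assume K: "compact K \<and> K \<subseteq> S"
  have Kb[measurable]: "K \<in> sets borel" using K by (simp add: borel_compact)
  have "bounded ((\<lambda>z. grad_rho z $ i) ` K)"
    using K by (intro compact_imp_bounded compact_continuous_image continuous_intros continuous_on_subset[OF continuous_on_grad_rho]) auto
  then obtain M where M: "\<And>z. z \<in> K \<Longrightarrow> \<bar>grad_rho z $ i\<bar> \<le> M" by (auto simp: bounded_iff)
  obtain w0 where w0: "w0 > 0" "\<And>z. z \<in> K \<Longrightarrow> w0 \<le> wt z"
  proof (cases "K = {}")
    case False
    have "continuous_on K (\<lambda>z. wt z)" unfolding xnorm2_def
      using K xnorm2_S_pos unfolding xnorm2_def by (intro continuous_intros) force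
    then obtain a where "a \<in> K" "\<And>z. z \<in> K \<Longrightarrow> wt a \<le> wt z"
      using continuous_attains_inf[of K "\<lambda>z. wt z"] K False by blast
    moreover from this(1) have "wt a > 0" using K xnorm2_S_pos[of a] by auto
    ultimately show thesis using that[of "wt a"] by blast
  qed (use that[of 1] in simp)
  define h where "h z = indicator S z * wt z * (g (rho z))\<^sup>2" for z
  have [measurable]: "h \<in> borel_measurable borel" unfolding h_def[abs_def] by measurable
  have h0: "h z \<ge> 0" for z by (simp add: h_def)
  have "(\<integral>\<^sup>+z. ennreal (h z) \<partial>lborel) = (\<integral>\<^sup>+r. ennreal ((g r)\<^sup>2) \<partial>rad)"
    using nn_integral_radial[of "\<lambda>r. ennreal ((g r)\<^sup>2)"] unfolding mS_def
    by (simp add: nn_integral_density h_def ennreal_mult')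
  then have ih: "integrable lborel h" using fin h0 by (intro integrableI_nonneg) auto
  have iK: "integrable lborel (indicator K :: real^3 \<Rightarrow> real)"
    using emeasure_bounded_finite[OF compact_imp_bounded, of K] K by (intro integrable_real_indicator) auto
  show "set_integrable lborel K (\<lambda>z. - (g (rho z) * grad_rho z $ i))"
    unfolding set_integrable_def
  proof (rule Bochner_Integration.integrable_bound)
    show "integrable lborel (\<lambda>z. \<bar>M\<bar> * (indicator K z + h z / w0))" using ih iK by auto
    show "AE z in lborel. norm (indicator K z *\<^sub>R - (g (rho z) * grad_rho z $ i)) \<le> norm (\<bar>M\<bar> * (indicator K z + h z / w0))"
    proof (rule AE_I2)
      fix z
      show "norm (indicator K z *\<^sub>R - (g (rho z) * grad_rho z $ i)) \<le> norm (\<bar>M\<bar> * (indicator K z + h z / w0))"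
      proof (cases "z \<in> K")
        case True
        let ?x = "g (rho z)"
        have "?x \<le> 1 + ?x\<^sup>2" using sum_squares_bound[of ?x 1] g0[of "rho z"] by simp
        also have "?x\<^sup>2 \<le> h z / w0"
        proof -
          have "w0 * ?x\<^sup>2 \<le> wt z * ?x\<^sup>2" using w0(2)[OF True] by (intro mult_right_mono) auto
          then show ?thesis using True K w0(1) by (auto simp: h_def pos_le_divide_eq mult.commute)
        qed
        finally have x: "?x \<le> 1 + h z / w0" by simp
        have "?x * \<bar>grad_rho z $ i\<bar> \<le> (1 + h z / w0) * \<bar>M\<bar>"
          using x M[OF True] g0 h0[of z] w0(1) by (intro mult_mono) auto
        then show ?thesis using True g0 h0[of z] w0(1) by (simp add: abs_mult mult.commute)
      qed simp
    qed
  qed measurable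
next
  fix f assume "test_fun S f"
  then have f: "smooth3 f" "compact (closure {z. f z \<noteq> 0})" "closure {z. f z \<noteq> 0} \<subseteq> S" by (auto simp: test_fun_def)
  have out: "f z = 0 \<and> pd f i z = 0" if "z \<notin> S" for z
  proof -
    have "z \<notin> closure {z. f z \<noteq> 0}" using that f(3) by blast
    then show ?thesis using closure_subset[of "{z. f z \<noteq> 0}"] grad3_eq_0[of z f] grad3_nth[of f z i] by auto
  qed
  have "(\<integral>z\<in>S. \<psi> (rho z) * pd f i z \<partial>lborel) = (\<integral>z. \<psi> (rho z) * pd f i z \<partial>lborel)"
    unfolding set_lebesgue_integral_def
  proof (rule Bochner_Integration.integral_cong[OF refl])
    fix z show "indicat_real S z *\<^sub>R (\<psi> (rho z) * pd f i z) = \<psi> (rho z) * pd f i z"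
      using out[of z] by (cases "z \<in> S") simp_all
  qed
  also have "\<dots> = (\<integral>z. g (rho z) * (grad_rho z $ i * f z) \<partial>lborel)"
    by (rule integral_psi_pd[OF f g g0 psi psi_eq])
  also have "\<dots> = (\<integral>z. - (indicat_real S z *\<^sub>R (- (g (rho z) * grad_rho z $ i) * f z)) \<partial>lborel)"
  proof (rule Bochner_Integration.integral_cong[OF refl])
    fix z show "g (rho z) * (grad_rho z $ i * f z) = - (indicat_real S z *\<^sub>R (- (g (rho z) * grad_rho z $ i) * f z))"
      using out[of z] by (cases "z \<in> S") simp_all
  qed
  also have "\<dots> = - (\<integral>z\<in>S. - (g (rho z) * grad_rho z $ i) * f z \<partial>lborel)"
    unfolding set_lebesgue_integral_def by (rule Bochner_Integration.integral_minus)
  finally show "(\<integral>z\<in>S. \<psi> (rho z) * pd f i z \<partial>lborel) = - (\<integral>z\<in>S. - (g (rho z) * grad_rho z $ i) * f z \<partial>lborel)" .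
qed

text \<open>The Grushin form is quadratic, so the factor \<open>g\<close> comes out squared; the
  eikonal equation turns what is left into the weight, and only the law of the radius
  remains.\<close>

lemma nn_integral_grushin_sq_radial:
  assumes [measurable]: "g \<in> borel_measurable borel"
  shows "(\<integral>\<^sup>+z\<in>S. ennreal (grushin_sq \<alpha> z (- (g (rho z) * grad_rho z $ 1)) (- (g (rho z) * grad_rho z $ 2)) (- (g (rho z) * grad_rho z $ 3))) \<partial>lborel)
    = (\<integral>\<^sup>+r. ennreal ((g r)\<^sup>2) \<partial>rad)"
proof -
  have hom: "grushin_sq \<alpha> z (- (t * a)) (- (t * b)) (- (t * c)) = t\<^sup>2 * grushin_sq \<alpha> z a b c" for z t a b c
    by (simp add: grushin_sq_def power_mult_distrib algebra_simps)
  have "(\<integral>\<^sup>+z\<in>S. ennreal (grushin_sq \<alpha> z (- (g (rho z) * grad_rho z $ 1)) (- (g (rho z) * grad_rho z $ 2)) (- (g (rho z) * grad_rho z $ 3))) \<partial>lborel)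
    = (\<integral>\<^sup>+z. ennreal (indicator S z * wt z) * ennreal ((g (rho z))\<^sup>2) \<partial>lborel)"
  proof (rule nn_integral_cong)
    fix z
    show "ennreal (grushin_sq \<alpha> z (- (g (rho z) * grad_rho z $ 1)) (- (g (rho z) * grad_rho z $ 2)) (- (g (rho z) * grad_rho z $ 3))) * indicator S z
      = ennreal (indicator S z * wt z) * ennreal ((g (rho z))\<^sup>2)"
    proof (cases "z \<in> S")
      case True
      then show ?thesis unfolding hom grushin_sq_grad_rho[OF True] by (simp add: ennreal_mult[symmetric] mult.commute)
    qed simp
  qed
  also have "\<dots> = (\<integral>\<^sup>+z. ennreal ((g (rho z))\<^sup>2) \<partial>mS)"
    unfolding mS_def by (rule nn_integral_density[symmetric]) auto
  also have "\<dots> = (\<integral>\<^sup>+r. ennreal ((g r)\<^sup>2) \<partial>rad)" by (rule nn_integral_radial) measurable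
  finally show ?thesis .
qed

end

theorem theorem2p2:
  fixes \<alpha> :: real and u :: "real^3 \<Rightarrow> real" and \<phi> :: "real \<Rightarrow> real"
  assumes alpha_pos: "\<alpha> > 0"
    and u_smooth: "smooth3 u"
    and u_compact_support: "compact (closure {z. u z \<noteq> 0})"
    and u_nonneg: "\<forall>z. u z \<ge> 0"
    and phi_nonneg: "\<forall>s\<ge>0. \<phi> s \<ge> 0"
    and phi_noninc: "\<forall>s t. 0 \<le> s \<and> s \<le> t \<longrightarrow> \<phi> t \<le> \<phi> s"
    and phi_rcont: "\<forall>s\<ge>0. continuous (at_right s) \<phi>"
    and equimeas: "\<forall>t>0. emeasure (wmeasure \<alpha>) {z \<in> closure (sector \<alpha>). \<phi> (gauge \<alpha> z) > t}
                          = emeasure (wmeasure \<alpha>) {z. u z > t}"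
  shows "\<exists>g1 g2 g3.
           weak_pd (sector \<alpha>) (\<lambda>z. \<phi> (gauge \<alpha> z)) 1 g1 \<and>
           weak_pd (sector \<alpha>) (\<lambda>z. \<phi> (gauge \<alpha> z)) 2 g2 \<and>
           weak_pd (sector \<alpha>) (\<lambda>z. \<phi> (gauge \<alpha> z)) 3 g3 \<and>
           (\<integral>\<^sup>+z\<in>sector \<alpha>. ennreal (grushin_sq \<alpha> z (g1 z) (g2 z) (g3 z)) \<partial>lborel)
             \<le> (\<integral>\<^sup>+z. ennreal (grushin_sq \<alpha> z (pd u 1 z) (pd u 2 z) (pd u 3 z)) \<partial>lborel)"
proof -
  interpret grushin \<alpha> by unfold_locales (rule alpha_pos)
  \<comment> \<open>The factor \<open>\<alpha> + 1\<close> passes from the gauge to the norm in flat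
    coordinates. Clamping at 0 extends the profile constantly to negative arguments, so that it is
    antitone on the whole line although \<open>\<phi>\<close> is controlled on nonnegative arguments
    only.\<close>
  define \<psi> where "\<psi> r = \<phi> ((\<alpha> + 1) * max 0 r)" for r
  have psi_rho: "\<psi> (rho z) = \<phi> (gauge \<alpha> z)" for z
    using rho_nonneg[of z] alpha_pos by (simp add: \<psi>_def max_def)
  have anti: "antimono \<psi>"
  proof (rule antimonoI)
    fix r s :: real assume "r \<le> s"
    then have "(\<alpha> + 1) * max 0 r \<le> (\<alpha> + 1) * max 0 s" using alpha_pos by (intro mult_left_mono) auto
    then show "\<psi> s \<le> \<psi> r" using phi_noninc alpha_pos by (simp add: \<psi>_def)
  qed
  have nonneg: "\<psi> r \<ge> 0" for r using phi_nonneg alpha_pos by (simp add: \<psi>_def)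
  have rcont: "continuous (at_right r) \<psi>" if r: "r \<ge> 0" for r
  proof -
    let ?m = "\<lambda>x. (\<alpha> + 1) * max 0 x"
    have "(\<phi> \<longlongrightarrow> \<phi> (?m r)) (at_right (?m r))" using phi_rcont alpha_pos by (simp add: continuous_within)
    \<comment> \<open>For \<open>r \<ge> 0\<close> the clamped rescaling is strictly increasing to
      the right of \<open>r\<close>, so right neighbourhoods go to right neighbourhoods and right
      continuity is inherited.\<close>
    moreover have "filterlim ?m (at_right (?m r)) (at_right r)"
      unfolding filterlim_at
    proof
      have "(?m \<longlongrightarrow> ?m r) (at_right r)" by (intro tendsto_intros)
      moreover have "eventually (\<lambda>x. ?m x \<in> {?m r<..} \<and> ?m x \<noteq> ?m r) (at_right r)"
        using eventually_at_right_less[of r] by eventually_elim (use r alpha_pos in auto)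
      ultimately show "(?m \<longlongrightarrow> ?m r) (at_right r)" "eventually (\<lambda>x. ?m x \<in> {?m r<..} \<and> ?m x \<noteq> ?m r) (at_right r)" .
    qed
    ultimately have "((\<lambda>x. \<phi> (?m x)) \<longlongrightarrow> \<phi> (?m r)) (at_right r)" by (rule filterlim_compose)
    then show ?thesis by (simp add: continuous_within \<psi>_def[abs_def])
  qed
  have psim[measurable]: "\<psi> \<in> borel_measurable borel" by (rule borel_measurable_antimono[OF anti])
  have equi: "emeasure mS {z. s < \<psi> (rho z)} = emeasure (wmeasure \<alpha>) {z. s < u z}" if "s > 0" for s
  proof -
    have "{z. s < \<psi> (rho z)} \<in> sets borel" by measurable
    from emeasure_closure_S[OF this] show ?thesis using equimeas that by (simp add: psi_rho)
  qed
  obtain R B where RB: "R > 0" "\<And>z. norm z > R \<Longrightarrow> u z = 0" "\<And>x y. \<bar>u x - u y\<bar> \<le> B * norm (x - y)"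
    using smooth3_compact_support[OF u_smooth u_compact_support] by metis
  have fin: "(\<integral>\<^sup>+z. ennreal ((gnorm (grad3 u) z)\<^sup>2) \<partial>lborel) < \<infinity>"
    by (rule nn_integral_gnorm_grad3_finite[OF u_smooth u_compact_support])
  have gm: "grad3 u \<in> borel_measurable borel"
    by (intro borel_measurable_continuous_onI continuous_grad3 u_smooth)
  obtain g where g: "g \<in> borel_measurable borel" "\<And>r. g r \<ge> 0"
    "\<And>a. a > 0 \<Longrightarrow> ennreal (\<psi> a) = (\<integral>\<^sup>+r. ennreal (g r) * indicator {a<..} r \<partial>lborel)"
    "(\<integral>\<^sup>+r. ennreal ((g r)\<^sup>2) \<partial>rad) \<le> (\<integral>\<^sup>+z. ennreal ((gnorm (grad3 u) z)\<^sup>2) \<partial>lborel)"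
    using rearrangement_density[OF has_derivative_grad3[OF smooth3_differentiable[OF u_smooth]] gm RB(3,2,1) fin anti rcont nonneg equi]
    by blast
  have gfin: "(\<integral>\<^sup>+r. ennreal ((g r)\<^sup>2) \<partial>rad) < \<infinity>" using g(4) fin by (rule order_le_less_trans)
  have "weak_pd S (\<lambda>z. \<phi> (gauge \<alpha> z)) i (\<lambda>z. - (g (rho z) * grad_rho z $ i))" for i
    using weak_pd_radial[OF g(1,2) anti nonneg g(3) gfin, of i] by (simp add: psi_rho)
  moreover have "(\<integral>\<^sup>+z\<in>S. ennreal (grushin_sq \<alpha> z (- (g (rho z) * grad_rho z $ 1)) (- (g (rho z) * grad_rho z $ 2)) (- (g (rho z) * grad_rho z $ 3))) \<partial>lborel)
     \<le> (\<integral>\<^sup>+z. ennreal (grushin_sq \<alpha> z (pd u 1 z) (pd u 2 z) (pd u 3 z)) \<partial>lborel)"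
    unfolding nn_integral_grushin_sq_radial[OF g(1)] using g(4) by (simp add: gnorm_sq)
  ultimately show ?thesis by blast
qed

end
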